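(* Let $\mu\in(0,1)$, $\nu\in[0,1]$, $\omega,\lambda\in\mathbb{C}$, $\rho>0$, $\gamma,\varpi\ge 0$, $\kappa\ge 0$, and let $f\in L^1[0,\infty)$ be a given function. The solution to the Cauchy problem $$\begin{cases}\mathcal{D}^{\gamma,\mu,\nu}_{\rho,\omega,0^+}y(x)=\lambda\,\mathbf{E}^{\varpi}_{\rho,\mu,\omega,0^+}y(x)+f(x), & x\in(0,\infty),\\[4pt] \left[\mathbf{E}^{-\gamma(1-\nu)}_{\rho,(1-\nu)(1-\mu),\omega,0^+}y(x)\right]_{x=0^+}=\kappa,\end{cases}$$ is given by $$y(x)=\kappa\sum_{k=0}^{\infty}\lambda^k x^{\nu(1-\mu)+\mu+2\mu k-1}E^{\gamma+k(\varpi+\gamma)-\gamma\nu}_{\rho,\,\nu(1-\mu)+\mu+2k\mu}(\omega x^{\rho})+\sum_{k=0}^{\infty}\lambda^k\,\mathbf{E}^{\gamma+k(\varpi+\gamma)}_{\rho,\mu(2k+1),\omega,0^+}f(x).$$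
   Context: The three-parameter (Prabhakar) Mittag--Leffler function is $E^{\gamma}_{\rho,\mu}(x)=\sum_{k=0}^{\infty}\frac{\Gamma(\gamma+k)}{\Gamma(\gamma)\Gamma(\rho k+\mu)}\frac{x^k}{k!}$, where $\Gamma(\gamma+k)/\Gamma(\gamma)$ is read as the Pochhammer symbol $\gamma(\gamma+1)\cdots(\gamma+k-1)$ (so that $E^0_{\rho,\mu}(x)=1/\Gamma(\mu)$). Prabhakar integral, for $\rho,\mu>0$ and $\gamma,\omega\in\mathbb{C}$: $\mathbf{E}^{\gamma}_{\rho,\mu,\omega,0^+}f(x)=\int_0^x (x-y)^{\mu-1}E^{\gamma}_{\rho,\mu}[\omega(x-y)^{\rho}]f(y)\,dy$; by convention $\mathbf{E}^{0}_{\rho,0,\omega,0^+}f=f$. Hilfer--Prabhakar derivative, for $\mu\in(0,1)$, $\nu\in[0,1]$, $\rho>0$, $\gamma\in\mathbb{R}$, $\omega\in\mathbb{C}$: $$\mathcal{D}^{\gamma,\mu,\nu}_{\rho,\omega,0^+}y(x)=\left(\mathbf{E}^{-\gamma\nu}_{\rho,\nu(1-\mu),\omega,0^+}\frac{d}{dx}\left(\mathbf{E}^{-\gamma(1-\nu)}_{\rho,(1-\nu)(1-\mu),\omega,0^+}y\right)\right)(x),$$ defined for integrable $y$ on (finite intervals of) $[0,\infty)$ such that $\mathbf{E}^{-\gamma(1-\nu)}_{\rho,(1-\nu)(1-\mu),\omega,0^+}y$ is absolutely continuous.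
   Formalization: The formula is shown to be a solution only if f is a.e. the outer Prabhakar integral of some locally integrable h; this is also proved necessary for any solution to exist. Without it existence fails: ν=1, γ=λ=0, f=|x-1|^{-μ} on [0,2]. *)

theory Defs
  imports "HOL-Analysis.Analysis"
begin

definition prabhakar_ML :: "complex \<Rightarrow> real \<Rightarrow> real \<Rightarrow> complex \<Rightarrow> complex" where
  "prabhakar_ML \<gamma> \<rho> \<mu> z =
     (\<Sum>k. pochhammer \<gamma> k / complex_of_real (Gamma (\<rho> * real k + \<mu>)) * (z ^ k / fact k))"

definition prabhakar_integral ::
  "complex \<Rightarrow> real \<Rightarrow> real \<Rightarrow> complex \<Rightarrow> (real \<Rightarrow> complex) \<Rightarrow> real \<Rightarrow> complex" where
  "prabhakar_integral \<gamma> \<rho> \<mu> \<omega> f x =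
     (if \<gamma> = 0 \<and> \<mu> = 0 then f x
      else LINT t:{0..x}|lebesgue.
        complex_of_real ((x - t) powr (\<mu> - 1)) *
        prabhakar_ML \<gamma> \<rho> \<mu> (\<omega> * complex_of_real ((x - t) powr \<rho>)) * f t)"

text \<open>The library constant \<open>absolutely_continuous\<close> is about pairs of measures; the following is the
  classical \<open>\<epsilon>\<close>-\<open>\<delta>\<close> notion for functions.\<close>

definition abs_continuous_on :: "real set \<Rightarrow> (real \<Rightarrow> complex) \<Rightarrow> bool" where
  "abs_continuous_on S g \<longleftrightarrow>
     (\<forall>\<epsilon>>0. \<exists>\<delta>>0. \<forall>(n::nat) a b.
        (\<forall>i<n. a i \<le> b i \<and> {a i..b i} \<subseteq> S) \<and>
        disjoint_family_on (\<lambda>i. {a i<..<b i}) {..<n} \<and>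
        (\<Sum>i<n. b i - a i) < \<delta>
        \<longrightarrow> (\<Sum>i<n. norm (g (b i) - g (a i))) < \<epsilon>)"

definition hp_inner ::
  "real \<Rightarrow> real \<Rightarrow> real \<Rightarrow> real \<Rightarrow> complex \<Rightarrow> (real \<Rightarrow> complex) \<Rightarrow> real \<Rightarrow> complex" where
  "hp_inner \<gamma> \<mu> \<nu> \<rho> \<omega> y =
     prabhakar_integral (complex_of_real (- \<gamma> * (1 - \<nu>))) \<rho> ((1 - \<nu>) * (1 - \<mu>)) \<omega> y"

definition hp_derivative ::
  "real \<Rightarrow> real \<Rightarrow> real \<Rightarrow> real \<Rightarrow> complex \<Rightarrow> (real \<Rightarrow> complex) \<Rightarrow> real \<Rightarrow> complex" where
  "hp_derivative \<gamma> \<mu> \<nu> \<rho> \<omega> y =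
     prabhakar_integral (complex_of_real (- \<gamma> * \<nu>)) \<rho> (\<nu> * (1 - \<mu>)) \<omega>
       (\<lambda>x. vector_derivative (hp_inner \<gamma> \<mu> \<nu> \<rho> \<omega> y) (at x))"

text \<open>Absolute continuity on \<open>(0, b]\<close> forces a finite limit at \<open>0+\<close>, so it is absolute continuity on
  \<open>[0, b]\<close> of the function extended by that limit. The point \<open>0\<close> is left out because the integral
  over \<open>{0..0}\<close> is \<open>0\<close>, whatever the limit is; initial values are limits at \<open>0+\<close>.\<close>

definition hp_domain ::
  "real \<Rightarrow> real \<Rightarrow> real \<Rightarrow> real \<Rightarrow> complex \<Rightarrow> (real \<Rightarrow> complex) set" where
  "hp_domain \<gamma> \<mu> \<nu> \<rho> \<omega> =
     {y. \<forall>b>0. y absolutely_integrable_on {0..b} \<and>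
               abs_continuous_on {0<..b} (hp_inner \<gamma> \<mu> \<nu> \<rho> \<omega> y)}"

definition hp_initial_value ::
  "real \<Rightarrow> real \<Rightarrow> real \<Rightarrow> real \<Rightarrow> complex \<Rightarrow> real \<Rightarrow> (real \<Rightarrow> complex) \<Rightarrow> bool" where
  "hp_initial_value \<gamma> \<mu> \<nu> \<rho> \<omega> \<kappa> y \<longleftrightarrow>
     (hp_inner \<gamma> \<mu> \<nu> \<rho> \<omega> y \<longlongrightarrow> complex_of_real \<kappa>) (at_right 0)"

text \<open>As \<open>f\<close> is only an \<open>L\<^sup>1\<close> function, the equation is required almost everywhere.\<close>

definition hp_cauchy_solution ::
  "real \<Rightarrow> real \<Rightarrow> real \<Rightarrow> real \<Rightarrow> complex \<Rightarrow> complex \<Rightarrow> real \<Rightarrow> real \<Rightarrow>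
   (real \<Rightarrow> complex) \<Rightarrow> (real \<Rightarrow> complex) \<Rightarrow> bool" where
  "hp_cauchy_solution \<gamma> \<mu> \<nu> \<rho> \<omega> lam \<sigma> \<kappa> f y \<longleftrightarrow>
     y \<in> hp_domain \<gamma> \<mu> \<nu> \<rho> \<omega> \<and>
     (AE x in lebesgue_on {0<..}.
        hp_derivative \<gamma> \<mu> \<nu> \<rho> \<omega> y x =
        lam * prabhakar_integral (complex_of_real \<sigma>) \<rho> \<mu> \<omega> y x + f x) \<and>
     hp_initial_value \<gamma> \<mu> \<nu> \<rho> \<omega> \<kappa> y"

definition hom_term ::
  "real \<Rightarrow> real \<Rightarrow> real \<Rightarrow> real \<Rightarrow> complex \<Rightarrow> complex \<Rightarrow> real \<Rightarrow> real \<Rightarrow> nat \<Rightarrow> complex" where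
  "hom_term \<gamma> \<mu> \<nu> \<rho> \<omega> lam \<sigma> x k =
     lam ^ k * complex_of_real (x powr (\<nu> * (1 - \<mu>) + \<mu> + 2 * \<mu> * real k - 1)) *
     prabhakar_ML (complex_of_real (\<gamma> + real k * (\<sigma> + \<gamma>) - \<gamma> * \<nu>)) \<rho>
       (\<nu> * (1 - \<mu>) + \<mu> + 2 * real k * \<mu>) (\<omega> * complex_of_real (x powr \<rho>))"

definition inhom_term ::
  "real \<Rightarrow> real \<Rightarrow> real \<Rightarrow> complex \<Rightarrow> complex \<Rightarrow> real \<Rightarrow> (real \<Rightarrow> complex) \<Rightarrow> real \<Rightarrow> nat \<Rightarrow> complex" where
  "inhom_term \<gamma> \<mu> \<rho> \<omega> lam \<sigma> f x k =
     lam ^ k * prabhakar_integral (complex_of_real (\<gamma> + real k * (\<sigma> + \<gamma>))) \<rho>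
       (\<mu> * (2 * real k + 1)) \<omega> f x"

definition hp_solution_formula ::
  "real \<Rightarrow> real \<Rightarrow> real \<Rightarrow> real \<Rightarrow> complex \<Rightarrow> complex \<Rightarrow> real \<Rightarrow> real \<Rightarrow>
   (real \<Rightarrow> complex) \<Rightarrow> real \<Rightarrow> complex" where
  "hp_solution_formula \<gamma> \<mu> \<nu> \<rho> \<omega> lam \<sigma> \<kappa> f x =
     complex_of_real \<kappa> * (\<Sum>k. hom_term \<gamma> \<mu> \<nu> \<rho> \<omega> lam \<sigma> x k) +
     (\<Sum>k. inhom_term \<gamma> \<mu> \<rho> \<omega> lam \<sigma> f x k)"

text \<open>\<open>f\<close> is in the range of the outer operator of the derivative. Every \<open>f\<close> integrable on finite
  intervals is if \<open>\<nu> = 0\<close>, where that operator is the identity; for \<open>\<nu> > 0\<close> this restricts \<open>f\<close>.\<close>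

definition hp_solvable_source ::
  "real \<Rightarrow> real \<Rightarrow> real \<Rightarrow> real \<Rightarrow> complex \<Rightarrow> (real \<Rightarrow> complex) \<Rightarrow> bool" where
  "hp_solvable_source \<gamma> \<mu> \<nu> \<rho> \<omega> f \<longleftrightarrow>
     (\<exists>h. (\<forall>b>0. h absolutely_integrable_on {0..b}) \<and>
          (AE x in lebesgue_on {0<..}.
             f x = prabhakar_integral (complex_of_real (- \<gamma> * \<nu>)) \<rho> (\<nu> * (1 - \<mu>)) \<omega> h x))"

end

theory Submission
  imports Defs
begin

text \<open>
Write \<open>e(c,m)\<close> for the kernel \<open>t\<^sup>m\<^sup>-\<^sup>1 E\<^sup>c(\<omega> t\<^sup>\<rho>)\<close> on the positive half line, with \<open>e(0,0)\<close> read as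
the unit mass \<open>\<delta>\<close> at \<open>0\<close>. Every operator of the problem is a convolution with such a kernel, and
\<open>e(c,m) * e(d,n) = e(c+d,m+n)\<close> by the Beta integral and the Vandermonde identity
(\<open>conv_pkernel\<close>); moreover \<open>e(0,1)\<close> is the Heaviside function \<open>H\<close>. Let
\<open>A = e(-\<gamma>(1-\<nu>), (1-\<nu>)(1-\<mu>))\<close> and \<open>B = e(-\<gamma>\<nu>, \<nu>(1-\<mu>))\<close> be the inner and the outer kernel of the
derivative, \<open>L = e(\<sigma>,\<mu>)\<close> the kernel on the right-hand side, \<open>K = e(\<sigma>+\<gamma>, 2\<mu>)\<close>, and
\<open>D = e(\<gamma>(1-\<nu>), \<mu>+\<nu>(1-\<mu>))\<close>. Then \<open>A * D = H\<close> and \<open>L * D = B * K\<close>.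

By the fundamental theorem of calculus for absolutely continuous functions, \<open>y\<close> belongs to the domain
of the derivative and has the initial value \<open>\<kappa>\<close> precisely when \<open>A * y = \<kappa> + H * h\<close> for a locally
integrable \<open>h\<close>, that is, when \<open>y = D * (h + \<kappa>\<delta>)\<close>. The derivative of \<open>y\<close> is then \<open>B * h\<close>, so the
equation reads \<open>f = B * (h - \<lambda> K * (h + \<kappa>\<delta>))\<close>. This shows at once that \<open>f\<close> must lie in the range
of \<open>B\<close>. If \<open>f = B * h\<^sub>0\<close>, the Volterra equation \<open>h = h\<^sub>0 + \<lambda> K * (h + \<kappa>\<delta>)\<close> is solved by
\<open>h = h\<^sub>0 + \<lambda> R * (h\<^sub>0 + \<kappa>\<delta>)\<close> with the resolvent \<open>R = \<Sum>k. \<lambda>\<^sup>k K\<^sup>k\<^sup>+\<^sup>1\<close>, a series of kernels \<open>e\<close>. Hence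
\<open>y = G * (h\<^sub>0 + \<kappa>\<delta>)\<close> with \<open>G = \<Sum>k. \<lambda>\<^sup>k D * K\<^sup>k\<close>. As \<open>G = F * B\<close> for
\<open>F = \<Sum>k. \<lambda>\<^sup>k e(\<gamma>+k(\<sigma>+\<gamma>), \<mu>(2k+1))\<close>, this is \<open>y = \<kappa> G + F * f\<close>, the asserted formula. For
uniqueness no iteration of the Volterra equation is needed: convolving it with \<open>G\<close> and using
\<open>G = D + \<lambda> G * K\<close> already gives \<open>D * (h + \<kappa>\<delta>) = G * (h\<^sub>0 + \<kappa>\<delta>)\<close>.

Three analytic points carry the argument. The series converge, uniformly enough to be convolved
termwise, because \<open>1 / \<Gamma>(a)\<close> decays faster than every exponential: on \<open>(0,b]\<close> the \<open>k\<close>-th term is at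
most \<open>C 2\<^sup>-\<^sup>k\<close> times the leading power of \<open>t\<close> (\<open>kernel_majorant\<close>). Convolution identities hold almost
everywhere for locally integrable functions, but absolute continuity of \<open>A * y\<close> is a pointwise claim;
it is saved by the fact that the orders of \<open>A\<close> and \<open>D\<close>, and for \<open>\<nu> = 1\<close> those of \<open>F\<close> and \<open>B\<close>, add
up to \<open>1\<close>, which makes the identities valid at every point (\<open>order_ge_conv_assoc\<close>,
\<open>conv_conv_delta\<close>). Finally, an absolutely continuous function is shown to be an indefinite integral
by splitting it into monotone parts and applying the Radon-Nikodym theorem, and an indefinite
integral is differentiated almost everywhere by Henstock's lemma and Vitali's covering lemma.\<close>

section \<open>Convolution of locally integrable functions on the half line\<close>

definition nconv :: "(real \<Rightarrow> ennreal) \<Rightarrow> (real \<Rightarrow> ennreal) \<Rightarrow> real \<Rightarrow> ennreal" where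
  "nconv p q x = (\<integral>\<^sup>+t. p (x - t) * q t \<partial>lborel)"

definition conv :: "(real \<Rightarrow> complex) \<Rightarrow> (real \<Rightarrow> complex) \<Rightarrow> real \<Rightarrow> complex" where
  "conv p q x = (LINT t|lborel. p (x - t) * q t)"

text \<open>The absolute value as an extended nonnegative function: all absolute convergence is expressed by the
finiteness of \<open>nconv\<close> of moduli, for which associativity needs no integrability.\<close>
definition modulus :: "(real \<Rightarrow> complex) \<Rightarrow> real \<Rightarrow> ennreal" where
  "modulus p t = ennreal (norm (p t))"

definition heaviside :: "real \<Rightarrow> complex" where
  "heaviside t = (if 0 < t then 1 else 0)"

text \<open>Local integrability is stated as finiteness of the integrals of the modulus over \<open>(0,b)\<close>, written as
a convolution with the Heaviside function. In this form the associativity of \<open>nconv\<close> shows that the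
class is closed under convolution.\<close>
definition loc_int :: "(real \<Rightarrow> complex) \<Rightarrow> bool" where
  "loc_int p \<longleftrightarrow> p \<in> borel_measurable borel \<and> (\<forall>t\<le>0. p t = 0) \<and>
     (\<forall>b. nconv (modulus heaviside) (modulus p) b < \<infinity>)"

lemma modulus_measurable [measurable]:
  "p \<in> borel_measurable borel \<Longrightarrow> modulus p \<in> borel_measurable borel"
  unfolding modulus_def[abs_def] by measurable

lemma heaviside_measurable [measurable]: "heaviside \<in> borel_measurable borel"
  unfolding heaviside_def[abs_def] by measurable

lemma nconv_measurable [measurable]:
  assumes [measurable]: "p \<in> borel_measurable borel" "q \<in> borel_measurable borel"
  shows "nconv p q \<in> borel_measurable borel"
  unfolding nconv_def[abs_def] by measurable

lemma conv_measurable [measurable]: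
  assumes [measurable]: "p \<in> borel_measurable borel" "q \<in> borel_measurable borel"
  shows "conv p q \<in> borel_measurable borel"
  unfolding conv_def[abs_def] by measurable

lemma nconv_commute:
  assumes [measurable]: "p \<in> borel_measurable borel" "q \<in> borel_measurable borel"
  shows "nconv p q x = nconv q p x"
  unfolding nconv_def
  by (subst nn_integral_real_affine[where c = "-1" and t = x]) (auto simp: mult.commute)

lemma conv_commute: "conv p q x = conv q p x"
  unfolding conv_def
  by (subst lborel_integral_real_affine[where c = "-1" and t = x]) (auto simp: mult.commute)

lemma nconv_assoc:
  assumes [measurable]: "p \<in> borel_measurable borel" "q \<in> borel_measurable borel"
    "r \<in> borel_measurable borel"
  shows "nconv p (nconv q r) x = nconv (nconv p q) r x"
proof -
  have "nconv p (nconv q r) x = (\<integral>\<^sup>+t. (\<integral>\<^sup>+s. p (x - t) * (q (t - s) * r s) \<partial>lborel) \<partial>lborel)"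
    unfolding nconv_def by (simp add: nn_integral_cmult)
  also have "\<dots> = (\<integral>\<^sup>+s. (\<integral>\<^sup>+t. p (x - t) * (q (t - s) * r s) \<partial>lborel) \<partial>lborel)"
    by (rule lborel_pair.Fubini'[symmetric]) measurable
  also have "\<dots> = (\<integral>\<^sup>+s. (\<integral>\<^sup>+t. p (x - s - t) * q t \<partial>lborel) * r s \<partial>lborel)"
  proof (rule nn_integral_cong)
    fix s
    have "(\<integral>\<^sup>+t. p (x - t) * (q (t - s) * r s) \<partial>lborel)
        = (\<integral>\<^sup>+t. p (x - s - t) * q t * r s \<partial>lborel)"
      by (subst nn_integral_real_affine[where c = 1 and t = s]) (auto simp: algebra_simps)
    then show "(\<integral>\<^sup>+t. p (x - t) * (q (t - s) * r s) \<partial>lborel)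
        = (\<integral>\<^sup>+t. p (x - s - t) * q t \<partial>lborel) * r s"
      by (simp add: nn_integral_multc)
  qed
  finally show ?thesis by (simp add: nconv_def)
qed

lemma conv_integrable:
  assumes [measurable]: "p \<in> borel_measurable borel" "q \<in> borel_measurable borel"
    and "nconv (modulus p) (modulus q) x < \<infinity>"
  shows "integrable lborel (\<lambda>t. p (x - t) * q t)"
  using assms(3) unfolding nconv_def modulus_def
  by (intro integrableI_bounded) (auto simp: norm_mult ennreal_mult)

lemma modulus_conv_le:
  assumes [measurable]: "p \<in> borel_measurable borel" "q \<in> borel_measurable borel"
  shows "modulus (conv p q) x \<le> nconv (modulus p) (modulus q) x"
proof -
  have "modulus (conv p q) x \<le> (\<integral>\<^sup>+t. ennreal (norm (p (x - t) * q t)) \<partial>lborel)"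
  proof (cases "integrable lborel (\<lambda>t. p (x - t) * q t)")
    case True
    then show ?thesis unfolding modulus_def conv_def
      by (rule integral_norm_bound_ennreal)
  qed (simp add: modulus_def conv_def not_integrable_integral_eq)
  then show ?thesis by (simp add: nconv_def modulus_def norm_mult ennreal_mult)
qed

lemma nconv_mono:
  assumes "\<And>t. p (x - t) * q t \<le> p' (x - t) * q' t"
  shows "nconv p q x \<le> nconv p' q' x"
  unfolding nconv_def by (intro nn_integral_mono assms)

text \<open>Fubini's theorem applies at the single point \<open>x\<close> as soon as the double integral of the moduli at that
point is finite. This pointwise form is what allows identities at every point later on.\<close>
lemma conv_assoc:
  assumes [measurable]: "p \<in> borel_measurable borel" "q \<in> borel_measurable borel"
    "r \<in> borel_measurable borel"
    and fin: "nconv (modulus p) (nconv (modulus q) (modulus r)) x < \<infinity>"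
  shows "conv p (conv q r) x = conv (conv p q) r x"
proof -
  let ?f = "\<lambda>t s. p (x - t) * (q (t - s) * r s)"
  have "(\<integral>\<^sup>+ts. ennreal (norm (case_prod ?f ts)) \<partial>(lborel \<Otimes>\<^sub>M lborel))
      = (\<integral>\<^sup>+t. (\<integral>\<^sup>+s. ennreal (norm (?f t s)) \<partial>lborel) \<partial>lborel)"
    by (subst lborel.nn_integral_fst[symmetric]) (auto simp: split_beta')
  also have "\<dots> = nconv (modulus p) (nconv (modulus q) (modulus r)) x"
    unfolding nconv_def modulus_def
    by (simp add: norm_mult ennreal_mult nn_integral_cmult)
  finally have int: "integrable (lborel \<Otimes>\<^sub>M lborel) (case_prod ?f)"
    using fin by (intro integrableI_bounded) auto
  have "conv p (conv q r) x = (LINT t|lborel. (LINT s|lborel. ?f t s))"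
    by (simp add: conv_def)
  also have "\<dots> = (LINT s|lborel. (LINT t|lborel. ?f t s))"
    by (rule lborel_pair.Fubini_integral[OF int, symmetric])
  also have "\<dots> = (LINT s|lborel. (LINT t|lborel. p (x - s - t) * q t) * r s)"
  proof (rule Bochner_Integration.integral_cong[OF refl])
    fix s
    have "(LINT t|lborel. ?f t s) = (LINT t|lborel. p (x - s - t) * q t * r s)"
      by (subst lborel_integral_real_affine[where c = 1 and t = s]) (auto simp: algebra_simps)
    then show "(LINT t|lborel. ?f t s) = (LINT t|lborel. p (x - s - t) * q t) * r s"
      by simp
  qed
  finally show ?thesis by (simp add: conv_def)
qed

lemma nconv_cong_AE:
  assumes [measurable]: "p \<in> borel_measurable borel"
    "q \<in> borel_measurable borel" "q' \<in> borel_measurable borel"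
    and "AE t in lborel. q t = q' t"
  shows "nconv p q x = nconv p q' x"
  unfolding nconv_def by (rule nn_integral_cong_AE) (use assms in auto)

lemma conv_cong_AE:
  assumes [measurable]: "p \<in> borel_measurable borel"
    "q \<in> borel_measurable borel" "q' \<in> borel_measurable borel"
    and "AE t in lborel. q t = q' t"
  shows "conv p q x = conv p q' x"
  unfolding conv_def by (rule integral_cong_AE) (use assms in auto)

lemma heaviside_nconv_eq:
  "nconv (modulus heaviside) q x = (\<integral>\<^sup>+t. indicator {..<x} t * q t \<partial>lborel)"
  unfolding nconv_def modulus_def heaviside_def
  by (intro nn_integral_cong) (auto split: split_indicator)

text \<open>A function with finite integrals over all bounded intervals is finite almost everywhere.\<close>
lemma nconv_heaviside_finite_AE:
  assumes [measurable]: "q \<in> borel_measurable borel"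
    and "\<And>b. nconv (modulus heaviside) q b < \<infinity>"
  shows "AE x in lborel. q x < \<infinity>"
proof -
  have "AE x in lborel. \<forall>n::nat. indicator {..<real n} x * q x \<noteq> \<infinity>"
    unfolding AE_all_countable
  proof
    fix n :: nat
    show "AE x in lborel. indicator {..<real n} x * q x \<noteq> \<infinity>"
      using assms(2)[of "real n"] unfolding heaviside_nconv_eq
      by (intro nn_integral_PInf_AE) (auto simp: less_top)
  qed
  then show ?thesis
  proof eventually_elim
    case (elim x)
    obtain n :: nat where "x < real n" using reals_Archimedean2 by blast
    then show ?case using elim[rule_format, of n] by (simp add: less_top)
  qed
qed

lemma loc_int_measurable [measurable_dest]: "loc_int p \<Longrightarrow> p \<in> borel_measurable borel"
  by (simp add: loc_int_def)

lemma loc_int_nonpos: "loc_int p \<Longrightarrow> t \<le> 0 \<Longrightarrow> p t = 0"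
  by (simp add: loc_int_def)

lemma loc_int_finite: "loc_int p \<Longrightarrow> nconv (modulus heaviside) (modulus p) b < \<infinity>"
  by (simp add: loc_int_def)

text \<open>If \<open>q\<close> lives on the positive half line, only the values of \<open>p\<close> below \<open>x\<close> enter the convolution at
\<open>x\<close>; a bound there suffices.\<close>
lemma nconv_le_const:
  assumes [measurable]: "p \<in> borel_measurable borel" "q \<in> borel_measurable borel"
    and le: "\<And>t. 0 < t \<Longrightarrow> p (x - t) \<le> c * p' (x - t)" and q0: "\<And>t. t \<le> 0 \<Longrightarrow> q t = 0"
    and [measurable]: "p' \<in> borel_measurable borel"
  shows "nconv p q x \<le> c * nconv p' q x"
proof -
  have "nconv p q x \<le> (\<integral>\<^sup>+t. c * (p' (x - t) * q t) \<partial>lborel)"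
    unfolding nconv_def
  proof (rule nn_integral_mono)
    fix t
    show "p (x - t) * q t \<le> c * (p' (x - t) * q t)"
      using mult_right_mono[OF le[of t], of "q t"] q0[of t]
      by (cases "0 < t") (auto simp: mult.assoc)
  qed
  also have "\<dots> = c * nconv p' q x"
    unfolding nconv_def by (subst nn_integral_cmult) auto
  finally show ?thesis .
qed

lemma modulus_nonpos: "(\<And>t. t \<le> 0 \<Longrightarrow> p t = 0) \<Longrightarrow> t \<le> 0 \<Longrightarrow> modulus p t = 0"
  by (simp add: modulus_def)

lemma nconv_nonpos:
  assumes "\<And>t. t \<le> 0 \<Longrightarrow> p t = 0" "\<And>t. t \<le> 0 \<Longrightarrow> q t = 0" "x \<le> 0"
  shows "nconv p q x = 0"
proof -
  have "(\<lambda>t. p (x - t) * q t) = (\<lambda>_. 0)"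
  proof
    fix t show "p (x - t) * q t = 0" using assms by (cases "t \<le> 0") auto
  qed
  then show ?thesis by (simp add: nconv_def)
qed

text \<open>With \<open>H\<close> the Heaviside function, \<open>H * (\<bar>p\<bar> * q) = (H * \<bar>p\<bar>) * q\<close>, and \<open>H * \<bar>p\<bar>\<close> is bounded by its
value at \<open>b\<close> on \<open>(0,b)\<close> because it increases.\<close>
lemma loc_int_nconv_finite:
  assumes p: "loc_int p" and [measurable]: "q \<in> borel_measurable borel"
    and q0: "\<And>t. t \<le> 0 \<Longrightarrow> q t = 0"
    and qf: "\<And>b. nconv (modulus heaviside) q b < \<infinity>"
  shows "nconv (modulus heaviside) (nconv (modulus p) q) b < \<infinity>"
proof -
  note [measurable] = loc_int_measurable[OF p]
  let ?c = "nconv (modulus heaviside) (modulus p) b"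
  have "nconv (modulus heaviside) (nconv (modulus p) q) b
      = nconv (nconv (modulus heaviside) (modulus p)) q b"
    by (rule nconv_assoc) measurable
  also have "\<dots> \<le> ?c * nconv (modulus heaviside) q b"
  proof (rule nconv_le_const)
    fix t :: real assume t: "0 < t"
    show "nconv (modulus heaviside) (modulus p) (b - t) \<le> ?c * modulus heaviside (b - t)"
    proof (cases "t < b")
      case True
      then show ?thesis unfolding heaviside_nconv_eq using t
        by (auto intro!: nn_integral_mono simp: modulus_def heaviside_def split: split_indicator)
    next
      case False
      then have "nconv (modulus heaviside) (modulus p) (b - t) = 0"
        by (intro nconv_nonpos) (auto simp: modulus_def heaviside_def loc_int_nonpos[OF p])
      then show ?thesis by simp
    qed
  qed (use q0 in auto)
  also have "\<dots> < \<infinity>" using loc_int_finite[OF p] qf by (auto simp: ennreal_mult_less_top)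
  finally show ?thesis .
qed

lemma conv_nonpos:
  assumes "\<And>t. t \<le> 0 \<Longrightarrow> p t = 0" "\<And>t. t \<le> 0 \<Longrightarrow> q t = 0" "x \<le> 0"
  shows "conv p q x = 0"
proof -
  have "(\<lambda>t. p (x - t) * q t) = (\<lambda>_. 0)"
  proof
    fix t show "p (x - t) * q t = 0" using assms by (cases "t \<le> 0") auto
  qed
  then show ?thesis by (simp add: conv_def)
qed

lemma loc_int_conv:
  assumes p: "loc_int p" and q: "loc_int q"
  shows "loc_int (conv p q)"
proof -
  note [measurable] = loc_int_measurable[OF p] loc_int_measurable[OF q]
  have "nconv (modulus heaviside) (modulus (conv p q)) b < \<infinity>" for b
  proof -
    have "nconv (modulus heaviside) (modulus (conv p q)) b
        \<le> nconv (modulus heaviside) (nconv (modulus p) (modulus q)) b"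
      by (intro nconv_mono mult_left_mono modulus_conv_le) auto
    also have "\<dots> < \<infinity>"
      using loc_int_finite[OF q] loc_int_nonpos[OF q]
      by (intro loc_int_nconv_finite p) (auto simp: modulus_def)
    finally show ?thesis .
  qed
  then show ?thesis
    using p q by (auto simp: loc_int_def intro!: conv_nonpos)
qed

lemma loc_int_conv_finite_AE:
  assumes p: "loc_int p" and q: "loc_int q"
  shows "AE x in lborel. nconv (modulus p) (modulus q) x < \<infinity>"
  using assms loc_int_nonpos[OF q]
  by (intro nconv_heaviside_finite_AE loc_int_nconv_finite)
     (auto simp: modulus_nonpos loc_int_finite[OF q, simplified])

lemma loc_int_conv_assoc_AE:
  assumes p: "loc_int p" and q: "loc_int q" and r: "loc_int r"
  shows "AE x in lborel. conv p (conv q r) x = conv (conv p q) r x"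
proof -
  note [measurable] = loc_int_measurable[OF p] loc_int_measurable[OF q] loc_int_measurable[OF r]
  have "AE x in lborel. nconv (modulus p) (nconv (modulus q) (modulus r)) x < \<infinity>"
    using loc_int_nonpos[OF q] loc_int_nonpos[OF r]
    by (intro nconv_heaviside_finite_AE loc_int_nconv_finite p q nconv_nonpos)
       (auto simp: modulus_nonpos loc_int_finite[OF r, simplified])
  then show ?thesis by eventually_elim (rule conv_assoc, auto)
qed

lemma modulus_add_le: "modulus (\<lambda>t. p t + q t) t \<le> modulus p t + modulus q t"
  unfolding modulus_def by (metis ennreal_leI ennreal_plus norm_ge_zero norm_triangle_ineq)

lemma nconv_add_right:
  assumes [measurable]: "p \<in> borel_measurable borel" "q \<in> borel_measurable borel"
    "r \<in> borel_measurable borel"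
  shows "nconv p (\<lambda>t. q t + r t) x = nconv p q x + nconv p r x"
  unfolding nconv_def by (subst nn_integral_add[symmetric]) (auto simp: distrib_left)

lemma modulus_cmult: "modulus (\<lambda>t. c * p t) t = ennreal (norm c) * modulus p t"
  by (simp add: modulus_def norm_mult ennreal_mult)

lemma modulus_cmult': "modulus (\<lambda>t. c * p t) = (\<lambda>t. ennreal (norm c) * modulus p t)"
  by (rule ext) (rule modulus_cmult)

lemma nconv_cmult_right:
  assumes [measurable]: "p \<in> borel_measurable borel" "q \<in> borel_measurable borel"
  shows "nconv p (\<lambda>t. c * q t) x = c * nconv p q x"
  unfolding nconv_def by (subst nn_integral_cmult[symmetric]) (auto simp: mult_ac)

lemma loc_int_add:
  assumes p: "loc_int p" and q: "loc_int q"
  shows "loc_int (\<lambda>t. p t + q t)"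
proof -
  note [measurable] = loc_int_measurable[OF p] loc_int_measurable[OF q]
  have "nconv (modulus heaviside) (modulus (\<lambda>t. p t + q t)) b < \<infinity>" for b
  proof -
    have "nconv (modulus heaviside) (modulus (\<lambda>t. p t + q t)) b
        \<le> nconv (modulus heaviside) (\<lambda>t. modulus p t + modulus q t) b"
      by (intro nconv_mono mult_left_mono modulus_add_le) auto
    also have "\<dots> < \<infinity>"
      using loc_int_finite[OF p, of b] loc_int_finite[OF q, of b] by (subst nconv_add_right) auto
    finally show ?thesis .
  qed
  then show ?thesis using p q by (auto simp: loc_int_def)
qed

lemma loc_int_cmult:
  assumes p: "loc_int p"
  shows "loc_int (\<lambda>t. c * p t)"
proof -
  note [measurable] = loc_int_measurable[OF p]
  have "nconv (modulus heaviside) (modulus (\<lambda>t. c * p t)) b < \<infinity>" for b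
    using loc_int_finite[OF p, of b]
    by (simp add: modulus_cmult' nconv_cmult_right ennreal_mult_less_top)
  then show ?thesis using p by (auto simp: loc_int_def)
qed

lemma conv_add_right:
  assumes [measurable]: "p \<in> borel_measurable borel" "q \<in> borel_measurable borel"
    "r \<in> borel_measurable borel"
    and "nconv (modulus p) (modulus q) x < \<infinity>" "nconv (modulus p) (modulus r) x < \<infinity>"
  shows "conv p (\<lambda>t. q t + r t) x = conv p q x + conv p r x"
  unfolding conv_def
  by (subst Bochner_Integration.integral_add[symmetric]) (auto intro!: conv_integrable assms simp: distrib_left)

lemma conv_cmult_right: "conv p (\<lambda>t. c * q t) x = c * conv p q x"
proof -
  have "(\<lambda>t. p (x - t) * (c * q t)) = (\<lambda>t. c * (p (x - t) * q t))" by (auto simp: mult_ac)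
  then show ?thesis unfolding conv_def by simp
qed

lemma conv_suminf_right:
  assumes [measurable]: "p \<in> borel_measurable borel" "\<And>k. q k \<in> borel_measurable borel"
    and fin: "(\<Sum>k. nconv (modulus p) (modulus (q k)) x) < \<infinity>"
  shows "summable (\<lambda>k. norm (conv p (q k) x))" (is ?A)
    and "conv p (\<lambda>t. \<Sum>k. q k t) x = (\<Sum>k. conv p (q k) x)" (is ?B)
proof -
  let ?f = "\<lambda>k t. p (x - t) * q k t"
  have fin_k: "nconv (modulus p) (modulus (q k)) x < \<infinity>" for k
  proof -
    have "nconv (modulus p) (modulus (q k)) x \<le> (\<Sum>k. nconv (modulus p) (modulus (q k)) x)"
      using sum_le_suminf[OF summableI, of "{k}" "\<lambda>k. nconv (modulus p) (modulus (q k)) x"] by auto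
    then show ?thesis using fin by (rule le_less_trans)
  qed
  have int: "integrable lborel (?f k)" for k
    by (intro conv_integrable fin_k) auto
  have eq: "nconv (modulus p) (modulus (q k)) x = ennreal (LINT t|lborel. norm (?f k t))" for k
    unfolding nconv_def modulus_def
    by (subst nn_integral_eq_integral[OF integrable_norm[OF int], symmetric])
       (auto simp: norm_mult ennreal_mult)
  have sum: "summable (\<lambda>k. LINT t|lborel. norm (?f k t))"
  proof (rule summable_suminf_not_top)
    show "(\<Sum>i. ennreal (LINT t|lborel. norm (?f i t))) \<noteq> top"
      using fin unfolding eq by (auto simp: less_top)
  qed auto
  have "(\<integral>\<^sup>+t. (\<Sum>k. ennreal (norm (?f k t))) \<partial>lborel) < \<infinity>"
    using fin unfolding nconv_def modulus_def
    by (subst nn_integral_suminf) (auto simp: norm_mult ennreal_mult)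
  then have "AE t in lborel. (\<Sum>k. ennreal (norm (?f k t))) \<noteq> \<infinity>"
    by (intro nn_integral_PInf_AE) auto
  then have AEs: "AE t in lborel. summable (\<lambda>k. norm (?f k t))"
    by eventually_elim (rule summable_suminf_not_top, auto)
  show ?A
    using sum by (rule summable_comparison_test'[where N=0]) (auto simp: conv_def)
  have "(\<Sum>k. conv p (q k) x) = (LINT t|lborel. (\<Sum>k. ?f k t))"
    unfolding conv_def by (rule integral_suminf[OF int AEs sum, symmetric])
  also have "\<dots> = conv p (\<lambda>t. \<Sum>k. q k t) x"
    unfolding conv_def
  proof (rule integral_cong_AE)
    show "AE t in lborel. (\<Sum>k. ?f k t) = p (x - t) * (\<Sum>k. q k t)"
      using AEs
    proof eventually_elim
      case (elim t)
      show ?case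
      proof (cases "p (x - t) = 0")
        case False
        have "summable (\<lambda>k. inverse (p (x - t)) * ?f k t)"
          by (intro summable_mult summable_norm_cancel[OF elim])
        then have "summable (\<lambda>k. q k t)" using False by simp
        then show ?thesis by (rule suminf_mult)
      qed simp
    qed
  qed auto
  finally show ?B ..
qed

section \<open>Power kernels and bounds for the reciprocal Gamma function\<close>

definition powker :: "real \<Rightarrow> real \<Rightarrow> real" where
  "powker a t = (if 0 < t then t powr (a - 1) / Gamma a else 0)"

lemma powker_measurable [measurable]: "powker a \<in> borel_measurable borel"
  unfolding powker_def[abs_def] by measurable

lemma powker_nonneg: "0 < a \<Longrightarrow> 0 \<le> powker a t"
  using Gamma_real_pos[of a] by (simp add: powker_def)

lemma powker_nonpos: "t \<le> 0 \<Longrightarrow> powker a t = 0"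
  by (simp add: powker_def)

text \<open>The Beta integral, after the substitution \<open>t = x u\<close>: the normalised powers form a convolution
semigroup.\<close>
lemma nconv_powker:
  assumes a: "0 < a" and b: "0 < b"
  shows "nconv (\<lambda>t. ennreal (powker a t)) (\<lambda>t. ennreal (powker b t)) x = ennreal (powker (a + b) x)"
proof (cases "0 < x")
  case False
  then show ?thesis by (subst nconv_nonpos) (auto simp: powker_nonpos)
next
  case x: True
  let ?B = "\<lambda>u. if u \<in> {0..1} then u powr (b - 1) * (1 - u) powr (a - 1) else 0 :: real"
  have G: "0 < Gamma a" "0 < Gamma b" "0 < Gamma (a + b)" using a b by (auto intro: Gamma_real_pos)
  define K where "K = x powr (a + b - 2) / (Gamma a * Gamma b)"
  have K0: "0 \<le> K" using G by (simp add: K_def)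
  have "(?B has_integral Beta b a) UNIV"
    using has_integral_Beta_real[OF b a] by (subst has_integral_restrict_UNIV) auto
  then have B: "(\<integral>\<^sup>+u. ennreal (?B u) \<partial>lborel) = ennreal (Beta b a)"
    by (intro nn_integral_has_integral_lborel) auto
  have "nconv (\<lambda>t. ennreal (powker a t)) (\<lambda>t. ennreal (powker b t)) x
      = ennreal \<bar>x\<bar> * (\<integral>\<^sup>+u. ennreal (powker a (x - (0 + x * u))) * ennreal (powker b (0 + x * u)) \<partial>lborel)"
    unfolding nconv_def using x by (subst nn_integral_real_affine[where c = x and t = 0]) auto
  also have "(\<integral>\<^sup>+u. ennreal (powker a (x - (0 + x * u))) * ennreal (powker b (0 + x * u)) \<partial>lborel)
      = (\<integral>\<^sup>+u. ennreal K * ennreal (?B u) \<partial>lborel)"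
  proof (rule nn_integral_cong)
    fix u
    have "powker a (x - (0 + x * u)) * powker b (0 + x * u) = K * ?B u"
    proof (cases "0 < u \<and> u < 1")
      case True
      then have "x - x * u = x * (1 - u)" "0 < x * (1 - u)" "0 < x * u" using x by (auto simp: algebra_simps)
      then show ?thesis using True x
        by (simp add: powker_def K_def powr_mult mult_ac powr_add [symmetric] diff_add_eq add_diff_eq)
    next
      case False
      then have "x - x * u = x * (1 - u)" by (auto simp: algebra_simps)
      with False show ?thesis using x
        by (auto simp: powker_def not_less mult_le_0_iff zero_less_mult_iff)
    qed
    then show "ennreal (powker a (x - (0 + x * u))) * ennreal (powker b (0 + x * u)) = ennreal K * ennreal (?B u)"
      using powker_nonneg[OF a] powker_nonneg[OF b] K0 by (simp add: ennreal_mult[symmetric])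
  qed
  also have "\<dots> = ennreal K * ennreal (Beta b a)" by (subst nn_integral_cmult, measurable) (simp only: B)
  also have "ennreal \<bar>x\<bar> * \<dots> = ennreal (x * K * Beta b a)"
    using x K0 G by (simp add: ennreal_mult[symmetric] Beta_def mult.assoc add.commute)
  also have "x * K * Beta b a = powker (a + b) x"
  proof -
    have "x * x powr (a + b - 2) = x powr (a + b - 1)"
      using x powr_add[of x 1 "a + b - 2"] by simp
    then show ?thesis using x G by (simp add: K_def powker_def Beta_def add.commute field_simps)
  qed
  finally show ?thesis .
qed

text \<open>Superexponential growth of \<open>\<Gamma>\<close>: integrating only over \<open>[R,R+1]\<close> in Euler's integral gives
\<open>\<Gamma>(a+1) \<ge> R\<^sup>a e\<^sup>-\<^sup>R\<^sup>-\<^sup>1\<close>, and the factor \<open>a\<close> lost in passing to \<open>\<Gamma>(a)\<close> is absorbed in \<open>e\<^sup>a\<close> by the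
choice \<open>R = e S\<close>.\<close>
lemma inverse_Gamma_bound:
  assumes S: "0 < S"
  obtains C :: real where "0 \<le> C" "\<And>a. 0 < a \<Longrightarrow> 1 / Gamma a \<le> C * S powr (- a)"
proof
  define R where "R = S * exp 1"
  have R: "0 < R" using S by (simp add: R_def)
  show "0 \<le> exp (R + 1)" by simp
  fix a :: real assume a: "0 < a"
  let ?f = "\<lambda>t::real. t powr a / exp t"
  have I: "(?f has_integral Gamma (a + 1)) {0..}"
    using Gamma_integral_real[of "a + 1"] a by simp
  have J: "((\<lambda>_. R powr a / exp (R + 1)) has_integral (R powr a / exp (R + 1))) {R..R+1}"
    using has_integral_const_real[of "R powr a / exp (R + 1)" R "R + 1"] by simp
  have fI: "?f integrable_on {R..R+1}"
    using R by (intro integrable_continuous_interval continuous_intros) auto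
  have "R powr a / exp (R + 1) \<le> integral {R..R+1} ?f"
  proof (rule has_integral_le[OF J integrable_integral[OF fI]])
    fix t assume "t \<in> {R..R+1}"
    then show "R powr a / exp (R + 1) \<le> ?f t"
      using R a by (intro frac_le powr_mono2) auto
  qed
  also have "\<dots> \<le> Gamma (a + 1)"
    by (rule has_integral_subset_le[OF _ integrable_integral[OF fI] I]) (use R in auto)
  finally have low: "R powr a / exp (R + 1) \<le> Gamma (a + 1)" .
  have "Gamma (a + 1) = a * Gamma a" using a by (intro Gamma_plus1) (auto elim!: nonpos_Ints_cases)
  then have "1 / Gamma a = a / Gamma (a + 1)" using a by simp
  also have "\<dots> \<le> a / (R powr a / exp (R + 1))"
    using low a R by (intro divide_left_mono) auto
  also have "\<dots> = a * exp (R + 1) / R powr a" by simp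
  also have "R powr a = S powr a * exp a"
    using S by (simp add: R_def powr_def ln_mult distrib_left exp_add)
  also have "a * exp (R + 1) / (S powr a * exp a) = exp (R + 1) * S powr (- a) * (a / exp a)"
    by (simp add: powr_minus_divide)
  also have "\<dots> \<le> exp (R + 1) * S powr (- a) * 1"
  proof -
    have "a \<le> exp a" using exp_ge_add_one_self[of a] by linarith
    then show ?thesis by (intro mult_left_mono) auto
  qed
  finally show "1 / Gamma a \<le> exp (R + 1) * S powr (- a)" by simp
qed

text \<open>The coefficient of \<open>x\<^sup>j\<close> in the expansion of \<open>(1 - w x)\<^sup>-\<^sup>c\<close>; the addition rule \<open>pcoef_add\<close> is the
product rule of these generating functions.\<close>
definition pcoef :: "'a::real_normed_field \<Rightarrow> 'a \<Rightarrow> nat \<Rightarrow> 'a" where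
  "pcoef c w j = pochhammer c j / fact j * w ^ j"

lemma pcoef_nonneg: "0 \<le> c \<Longrightarrow> 0 \<le> w \<Longrightarrow> 0 \<le> pcoef c (w::real) j"
  by (auto simp: pcoef_def pochhammer_prod intro!: mult_nonneg_nonneg divide_nonneg_nonneg prod_nonneg)

lemma norm_pcoef_le: "norm (pcoef c w j) \<le> pcoef (norm c) (norm w) j"
proof -
  have "norm (pochhammer c j) \<le> pochhammer (norm c) j"
    unfolding pochhammer_prod prod_norm[symmetric]
  proof (intro prod_mono conjI norm_ge_zero)
    fix i :: nat
    show "norm (c + of_nat i) \<le> norm c + of_nat i"
      using norm_triangle_ineq[of c "of_nat i"] by simp
  qed
  then show ?thesis
    by (auto simp: pcoef_def norm_mult norm_divide norm_power intro!: mult_right_mono divide_right_mono)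
qed

lemma pcoef_add: "(\<Sum>j\<le>n. pcoef a w j * pcoef b w (n - j)) = pcoef (a + b) w n"
proof -
  have "pcoef a w j * pcoef b w (n - j) =
      of_nat (n choose j) * pochhammer a j * pochhammer b (n - j) * (w ^ n / fact n)" if "j \<le> n" for j
    using that
    by (simp add: pcoef_def binomial_fact power_add[symmetric] field_simps)
  then show ?thesis
    unfolding pcoef_def[of "a + b"] pochhammer_binomial_sum sum_divide_distrib sum_distrib_right
    by (intro sum.cong) auto
qed

text \<open>For an integer parameter \<open>N + 1\<close> the coefficient is a binomial coefficient times \<open>w\<^sup>j\<close>, and it
increases with the parameter. The exponential bound in \<open>N\<close> matters because the parameter grows with
the index of the series solution.\<close>
lemma pcoef_le_power:
  fixes c w :: real
  assumes "0 \<le> c" "c \<le> real N + 1" "0 \<le> w"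
  shows "pcoef c w j \<le> 2 ^ N * (2 * w) ^ j"
proof -
  have "pochhammer c j \<le> pochhammer (real (Suc N)) j"
    unfolding pochhammer_prod using assms by (intro prod_mono) auto
  also have "pochhammer (real (Suc N)) j = fact (N + j) / fact N"
  proof -
    have "(fact (N + j) :: real) = fact N * pochhammer (real (Suc N)) j"
      using pochhammer_product'[of "1::real" N j] by (simp only: pochhammer_fact of_nat_Suc add.commute)
    then show ?thesis by simp
  qed
  finally have "pochhammer c j / fact j \<le> fact (N + j) / (fact N * fact j)"
    by (simp add: field_simps)
  also have "\<dots> = real ((N + j) choose N)"
    by (simp add: binomial_fact)
  also have "\<dots> \<le> real (2 ^ (N + j))"
    using binomial_le_pow2[of "N + j" N] by (simp only: of_nat_le_iff)
  finally have "pochhammer c j / fact j \<le> 2 ^ (N + j)" by simp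
  then have "pochhammer c j / fact j * w ^ j \<le> 2 ^ (N + j) * w ^ j"
    using assms by (intro mult_right_mono) auto
  then show ?thesis by (simp add: pcoef_def power_add power_mult_distrib mult_ac)
qed

lemma small_scale_exists:
  assumes "0 < (p::real)" "0 \<le> Q" "0 < b"
  shows "eventually (\<lambda>S. Q * (b / S) powr p \<le> 1 / 2) at_top"
proof -
  have "((\<lambda>S. b / S) \<longlongrightarrow> 0) at_top"
    by (rule tendsto_divide_0[OF tendsto_const]) (simp add: filterlim_at_top_imp_at_infinity filterlim_ident)
  then have "((\<lambda>S. Q * (b / S) powr p) \<longlongrightarrow> Q * 0 powr p) at_top"
    using assms by (intro tendsto_mult tendsto_const tendsto_powr2)
      (auto intro!: eventually_mono[OF eventually_gt_at_top[of 0]])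
  then have "((\<lambda>S. Q * (b / S) powr p) \<longlongrightarrow> 0) at_top" using assms by simp
  then have "eventually (\<lambda>S. Q * (b / S) powr p < 1 / 2) at_top"
    by (rule order_tendstoD) simp
  then show ?thesis by eventually_elim simp
qed

text \<open>The estimate behind all convergence statements. It bounds the terms of the double series, with \<open>j\<close>
the index inside a Mittag-Leffler function and \<open>k\<close> the index of the outer series, by a product of two
geometric series times the leading power. The numerators grow at most exponentially in \<open>j\<close> and \<open>k\<close>,
while \<open>1 / \<Gamma>\<close> contributes \<open>S\<^sup>-\<^sup>\<rho>\<^sup>j\<^sup>-\<^sup>\<beta>\<^sup>k\<close> with \<open>S\<close> as large as desired.\<close>
lemma kernel_majorant:
  fixes \<rho> \<alpha> \<beta> a s L w b :: real
  assumes pos: "0 < \<rho>" "0 < \<beta>" "0 < \<alpha>" "0 \<le> a" "0 \<le> s" "0 \<le> L" "0 \<le> w"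
  obtains C where "0 \<le> C"
    "\<And>k j x. x \<le> b \<Longrightarrow> L ^ k * (pcoef (a + real k * s) w j * powker (\<rho> * real j + (\<alpha> + \<beta> * real k)) x)
        \<le> C * (1 / 2) ^ k * (1 / 2) ^ j * powker \<alpha> x"
proof -
  \<comment> \<open>the scale \<open>S\<close> below needs a positive bound for \<open>x\<close>\<close>
  define b' where "b' = max b 1"
  have b': "0 < b'" "b \<le> b'" by (auto simp: b'_def)
  \<comment> \<open>an integer dominating \<open>a\<close> and \<open>s\<close>, so that \<open>a + k s \<le> N (k + 1)\<close>\<close>
  obtain N :: nat where N: "a \<le> real N" "s \<le> real N"
    using real_arch_simple[of "max a s"] by auto
  have "eventually (\<lambda>S. 2 ^ N * L * (b' / S) powr \<beta> \<le> 1 / 2 \<and> 2 * w * (b' / S) powr \<rho> \<le> 1 / 2 \<and> 0 < S) at_top"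
    using pos b' by (intro eventually_conj small_scale_exists eventually_gt_at_top) auto
  then obtain S where S: "2 ^ N * L * (b' / S) powr \<beta> \<le> 1 / 2" "2 * w * (b' / S) powr \<rho> \<le> 1 / 2" "0 < S"
    by (metis (no_types, lifting) eventually_at_top_linorder order_refl)
  obtain C where C: "0 \<le> C" "\<And>a. 0 < a \<Longrightarrow> 1 / Gamma a \<le> C * S powr (- a)"
    using inverse_Gamma_bound[OF S(3)] by blast
  define D where "D = C * 2 ^ N * S powr (- \<alpha>) * Gamma \<alpha>"
  have G: "0 < Gamma \<alpha>" using pos by (intro Gamma_real_pos)
  have D: "0 \<le> D" using C G by (simp add: D_def)
  show ?thesis
  proof (rule that[OF D])
    fix k j :: nat and x :: real assume xb: "x \<le> b"
    show "L ^ k * (pcoef (a + real k * s) w j * powker (\<rho> * real j + (\<alpha> + \<beta> * real k)) x)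
        \<le> D * (1 / 2) ^ k * (1 / 2) ^ j * powker \<alpha> x"
    proof (cases "0 < x")
      case x: True
      define e where "e = \<rho> * real j + (\<alpha> + \<beta> * real k)"
      have e: "0 < e" using pos by (auto simp: e_def intro!: add_nonneg_pos[OF _ add_pos_nonneg])
      have cle: "a + real k * s \<le> real (N * (k + 1)) + 1"
      proof -
        have "real k * s \<le> real k * real N" using N by (intro mult_left_mono) auto
        then show ?thesis using N by (simp add: algebra_simps)
      qed
      have p1: "pcoef (a + real k * s) w j \<le> 2 ^ (N * (k + 1)) * (2 * w) ^ j"
        using pos by (intro pcoef_le_power cle) auto
      have "powker e x = x powr (e - 1) * (1 / Gamma e)" using x by (simp add: powker_def)
      also have "\<dots> \<le> x powr (e - 1) * (C * S powr (- e))"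
        using C(2)[OF e] by (intro mult_left_mono) auto
      also have "\<dots> = C * S powr (-\<alpha>) * x powr (\<alpha> - 1) * (x / S) powr (\<rho> * real j) * (x / S) powr (\<beta> * real k)"
      proof -
        have 1: "x powr (e - 1) = x powr (\<rho> * real j) * x powr (\<beta> * real k) * x powr (\<alpha> - 1)"
          unfolding powr_add[symmetric] by (simp add: e_def algebra_simps)
        have 2: "S powr (- e) = S powr (-\<alpha>) / (S powr (\<rho> * real j) * S powr (\<beta> * real k))"
          unfolding powr_add[symmetric] powr_diff[symmetric] by (simp add: e_def algebra_simps)
        show ?thesis unfolding 1 2 using x S(3) by (simp add: powr_divide)
      qed
      also have "\<dots> \<le> C * S powr (-\<alpha>) * x powr (\<alpha> - 1) * (b' / S) powr (\<rho> * real j) * (b' / S) powr (\<beta> * real k)"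
      proof -
        have q: "(x / S) powr r \<le> (b' / S) powr r" if "0 \<le> r" for r
          using that x S(3) xb b' by (intro powr_mono2 divide_right_mono) auto
        show ?thesis
          using C(1) pos by (intro mult_mono q order_refl mult_nonneg_nonneg) auto
      qed
      also have "(b' / S) powr (\<rho> * real j) = ((b' / S) powr \<rho>) ^ j"
        using b' S(3) by (simp add: powr_powr[symmetric] powr_realpow)
      also have "(b' / S) powr (\<beta> * real k) = ((b' / S) powr \<beta>) ^ k"
        using b' S(3) by (simp add: powr_powr[symmetric] powr_realpow)
      finally have p2: "powker e x \<le> C * S powr (-\<alpha>) * x powr (\<alpha> - 1) * ((b' / S) powr \<rho>) ^ j * ((b' / S) powr \<beta>) ^ k" .
      have "L ^ k * (pcoef (a + real k * s) w j * powker e x)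
          \<le> L ^ k * ((2 ^ (N * (k + 1)) * (2 * w) ^ j) *
             (C * S powr (-\<alpha>) * x powr (\<alpha> - 1) * ((b' / S) powr \<rho>) ^ j * ((b' / S) powr \<beta>) ^ k))"
        by (rule mult_left_mono[OF mult_mono[OF p1 p2]]) (use pos powker_nonneg[OF e] in auto)
      also have "\<dots> = C * 2 ^ N * S powr (-\<alpha>) * x powr (\<alpha> - 1) *
          (2 ^ N * L * (b' / S) powr \<beta>) ^ k * (2 * w * (b' / S) powr \<rho>) ^ j"
        by (simp add: power_mult_distrib power_mult power_add mult_ac)
      also have "\<dots> \<le> C * 2 ^ N * S powr (-\<alpha>) * x powr (\<alpha> - 1) * (1 / 2) ^ k * (1 / 2) ^ j"
        using S C(1) pos by (intro mult_mono power_mono mult_nonneg_nonneg) auto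
      also have "\<dots> = D * (1 / 2) ^ k * (1 / 2) ^ j * powker \<alpha> x"
        using x G by (simp add: D_def powker_def)
      finally show ?thesis by (simp add: e_def)
    qed (simp add: powker_def)
  qed
qed


section \<open>Prabhakar kernels and their convolution semigroup\<close>

definition pkernel :: "complex \<Rightarrow> real \<Rightarrow> real \<Rightarrow> complex \<Rightarrow> real \<Rightarrow> complex" where
  "pkernel c \<rho> m \<omega> t =
     (if 0 < t then complex_of_real (t powr (m - 1)) *
        prabhakar_ML c \<rho> m (\<omega> * complex_of_real (t powr \<rho>)) else 0)"

lemma pkernel_nonpos: "t \<le> 0 \<Longrightarrow> pkernel c \<rho> m \<omega> t = 0"
  by (simp add: pkernel_def)

lemma norm_pkernel_term_le:
  assumes "0 < e"
  shows "norm (pcoef c \<omega> j * complex_of_real (powker e x)) \<le> pcoef (norm c) (norm \<omega>) j * powker e x"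
  using norm_pcoef_le[of c \<omega> j] powker_nonneg[OF assms, of x] by (auto simp: norm_mult intro!: mult_right_mono)

lemma pkernel_term_bound:
  assumes "0 < \<rho>" "0 < m"
  obtains C where "0 \<le> C" "\<And>j x. x \<le> b \<Longrightarrow> pcoef (norm c) (norm \<omega>) j * powker (\<rho> * real j + m) x
      \<le> C * (1 / 2) ^ j * powker m x"
proof -
  obtain C where "0 \<le> C" and C: "\<And>k j x. x \<le> b \<Longrightarrow>
     1 ^ k * (pcoef (norm c + real k * 0) (norm \<omega>) j * powker (\<rho> * real j + (m + 1 * real k)) x)
        \<le> C * (1 / 2) ^ k * (1 / 2) ^ j * powker m x"
    using kernel_majorant[of \<rho> 1 m "norm c" 0 1 "norm \<omega>" b] assms by auto
  then show ?thesis using C[where k = 0] by (intro that[of C]) auto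
qed

lemma pkernel_term_summable:
  assumes "0 < \<rho>" "0 < m"
  shows "summable (\<lambda>j. pcoef (norm c) (norm \<omega>) j * powker (\<rho> * real j + m) x)"
proof -
  obtain C where C: "0 \<le> C" "\<And>j y. y \<le> x \<Longrightarrow> pcoef (norm c) (norm \<omega>) j * powker (\<rho> * real j + m) y
      \<le> C * (1 / 2) ^ j * powker m y"
    using pkernel_term_bound[OF assms] by metis
  have e: "0 < \<rho> * real j + m" for j using assms by (intro add_nonneg_pos) auto
  show ?thesis
  proof (rule summable_comparison_test'[where N = 0])
    show "summable (\<lambda>j. C * (1 / 2) ^ j * powker m x)"
      by (intro summable_mult summable_mult2 summable_geometric) auto
    fix j :: nat
    show "norm (pcoef (norm c) (norm \<omega>) j * powker (\<rho> * real j + m) x) \<le> C * (1 / 2) ^ j * powker m x"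
      using C(2)[of x j] powker_nonneg[OF e, of j x] pcoef_nonneg[of "norm c" "norm \<omega>" j] by simp
  qed
qed

lemma pkernel_sums:
  assumes "0 < \<rho>" "0 < m"
  shows "(\<lambda>j. pcoef c \<omega> j * complex_of_real (powker (\<rho> * real j + m) x)) sums pkernel c \<rho> m \<omega> x"
proof -
  have e: "0 < \<rho> * real j + m" for j using assms by (intro add_nonneg_pos) auto
  have sm: "summable (\<lambda>j. pcoef c \<omega> j * complex_of_real (powker (\<rho> * real j + m) x))"
    by (rule summable_comparison_test'[OF pkernel_term_summable[OF assms], where N = 0])
       (rule norm_pkernel_term_le[OF e])
  show ?thesis
  proof (cases "0 < x")
    case True
    let ?u = "\<lambda>j. pochhammer c j / complex_of_real (Gamma (\<rho> * real j + m)) *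
          ((\<omega> * complex_of_real (x powr \<rho>)) ^ j / fact j)"
    have eq: "pcoef c \<omega> j * complex_of_real (powker (\<rho> * real j + m) x) = complex_of_real (x powr (m - 1)) * ?u j" for j
    proof -
      have "x powr (\<rho> * real j + m - 1) = x powr (m - 1) * (x powr \<rho>) ^ j"
        using True by (simp add: powr_realpow[symmetric] powr_powr powr_add[symmetric] algebra_simps)
      then show ?thesis using True by (simp add: pcoef_def powker_def power_mult_distrib mult_ac)
    qed
    have "summable ?u" using sm True unfolding eq summable_cmult_iff by simp
    then have "?u sums prabhakar_ML c \<rho> m (\<omega> * complex_of_real (x powr \<rho>))"
      unfolding prabhakar_ML_def by (rule summable_sums)
    from sums_mult[OF this, of "complex_of_real (x powr (m - 1))"]
    show ?thesis unfolding eq using True by (simp add: pkernel_def)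
  qed (simp add: pkernel_def powker_def)
qed

lemma pkernel_measurable [measurable]:
  assumes "0 < \<rho>" "0 < m"
  shows "pkernel c \<rho> m \<omega> \<in> borel_measurable borel"
proof -
  have "pkernel c \<rho> m \<omega> = (\<lambda>x. \<Sum>j. pcoef c \<omega> j * complex_of_real (powker (\<rho> * real j + m) x))"
    using pkernel_sums[OF assms] by (auto simp: sums_iff)
  then show ?thesis by simp
qed

text \<open>A kernel of order \<open>a\<close> is dominated by \<open>t\<^sup>a\<^sup>-\<^sup>1\<close> on every bounded interval, with a constant that
depends on the interval; evaluating at \<open>t \<le> 0\<close> shows that it vanishes there. Orders add under convolution, and
a total order of at least \<open>1\<close> means local boundedness.\<close>
definition order_ge :: "real \<Rightarrow> (real \<Rightarrow> complex) \<Rightarrow> bool" where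
  "order_ge a p \<longleftrightarrow> 0 < a \<and> p \<in> borel_measurable borel \<and>
     (\<forall>b. \<exists>C\<ge>0. \<forall>t\<le>b. norm (p t) \<le> C * powker a t)"

lemma order_ge_measurable [measurable_dest]: "order_ge a p \<Longrightarrow> p \<in> borel_measurable borel"
  by (simp add: order_ge_def)

lemma order_ge_nonpos: "order_ge a p \<Longrightarrow> t \<le> 0 \<Longrightarrow> p t = 0"
  unfolding order_ge_def by (metis mult_zero_right norm_le_zero_iff powker_nonpos)

lemma order_ge_modulus:
  assumes "order_ge a p"
  obtains C where "0 \<le> C" "\<And>t. t \<le> b \<Longrightarrow> modulus p t \<le> ennreal C * ennreal (powker a t)"
proof -
  obtain C where C: "0 \<le> C" "\<And>t. t \<le> b \<Longrightarrow> norm (p t) \<le> C * powker a t" and a: "0 < a"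
    using assms unfolding order_ge_def by metis
  show ?thesis
  proof (rule that[OF C(1)])
    fix t assume "t \<le> b"
    then show "modulus p t \<le> ennreal C * ennreal (powker a t)"
      using C powker_nonneg[OF a, of t] by (simp add: modulus_def ennreal_mult[symmetric])
  qed
qed

lemma modulus_heaviside: "modulus heaviside = (\<lambda>t. ennreal (powker 1 t))"
  by (auto simp: modulus_def heaviside_def powker_def fun_eq_iff)

lemma order_ge_nconv:
  assumes p: "order_ge a p" and q: "order_ge b q"
  obtains C where "\<And>x. x \<le> B \<Longrightarrow> nconv (modulus p) (modulus q) x \<le> ennreal C * ennreal (powker (a + b) x)"
proof -
  have a: "0 < a" and b: "0 < b" using p q by (auto simp: order_ge_def)
  obtain C where C0: "0 \<le> C" and C: "\<And>t. t \<le> B \<Longrightarrow> modulus p t \<le> ennreal C * ennreal (powker a t)"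
    using order_ge_modulus[OF p] by blast
  obtain D where D0: "0 \<le> D" and D: "\<And>t. t \<le> B \<Longrightarrow> modulus q t \<le> ennreal D * ennreal (powker b t)"
    using order_ge_modulus[OF q] by blast
  show ?thesis
  proof (rule that[of "C * D"])
    fix x assume x: "x \<le> B"
    have "nconv (modulus p) (modulus q) x
       \<le> nconv (\<lambda>t. ennreal C * ennreal (powker a t)) (\<lambda>t. ennreal D * ennreal (powker b t)) x"
    proof (rule nconv_mono)
      fix t
      consider "t \<le> 0" | "x - t \<le> 0" | "0 < t" "t < x" by linarith
      then show "modulus p (x - t) * modulus q t
        \<le> ennreal C * ennreal (powker a (x - t)) * (ennreal D * ennreal (powker b t))"
      proof cases
        case 3
        then show ?thesis using x by (intro mult_mono C D) auto
      qed (auto simp: modulus_def order_ge_nonpos[OF p] order_ge_nonpos[OF q])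
    qed
    also have "\<dots> = ennreal C * ennreal D * nconv (\<lambda>t. ennreal (powker a t)) (\<lambda>t. ennreal (powker b t)) x"
      unfolding nconv_def by (subst nn_integral_cmult[symmetric]) (auto simp: mult_ac)
    also have "\<dots> = ennreal (C * D) * ennreal (powker (a + b) x)"
      using C0 D0 by (simp add: nconv_powker[OF a b] ennreal_mult)
    finally show "nconv (modulus p) (modulus q) x \<le> ennreal (C * D) * ennreal (powker (a + b) x)" .
  qed
qed

lemma order_ge_nconv_finite:
  assumes "order_ge a p" "order_ge b q"
  shows "nconv (modulus p) (modulus q) x < \<infinity>"
proof -
  obtain C where "\<And>y. y \<le> x \<Longrightarrow> nconv (modulus p) (modulus q) y \<le> ennreal C * ennreal (powker (a + b) y)"
    using order_ge_nconv[OF assms] by blast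
  from this[of x] show ?thesis by (rule le_less_trans) (auto simp: ennreal_mult_less_top)
qed

lemma heaviside_order: "order_ge 1 heaviside"
  unfolding order_ge_def by (auto intro!: exI[of _ 1] simp: heaviside_def powker_def)

lemma order_ge_loc_int: "order_ge a p \<Longrightarrow> loc_int p"
  unfolding loc_int_def
  using order_ge_nconv_finite[OF heaviside_order] order_ge_nonpos order_ge_measurable by blast

text \<open>A locally bounded kernel can be convolved with a locally integrable function at every point.\<close>
lemma nconv_order_ge_1_finite:
  assumes [measurable]: "p \<in> borel_measurable borel" "u \<in> borel_measurable borel"
    and p: "\<And>t. t \<le> x \<Longrightarrow> p t \<le> ennreal C * ennreal (powker a t)" and a: "1 \<le> a"
    and u0: "\<And>t. t \<le> 0 \<Longrightarrow> u t = 0" and u: "\<And>b. nconv (modulus heaviside) u b < \<infinity>"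
  shows "nconv p u x < \<infinity>"
proof -
  define D where "D = x powr (a - 1) / Gamma a"
  have "nconv p u x \<le> ennreal C * ennreal D * nconv (modulus heaviside) u x"
  proof (rule nconv_le_const)
    fix t :: real assume t: "0 < t"
    have "powker a (x - t) \<le> D" if "t < x"
      using that t a Gamma_real_pos[of a] unfolding D_def powker_def
      by (auto intro!: divide_right_mono powr_mono2)
    then have "ennreal (powker a (x - t)) \<le> ennreal D * modulus heaviside (x - t)"
      by (auto simp: modulus_heaviside powker_def intro!: ennreal_leI)
    then have "ennreal C * ennreal (powker a (x - t)) \<le> ennreal C * (ennreal D * modulus heaviside (x - t))"
      by (rule mult_left_mono) simp
    with p[of "x - t"] t show "p (x - t) \<le> ennreal C * ennreal D * modulus heaviside (x - t)"
      by (auto simp: mult.assoc)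
  qed (use u0 in auto)
  also have "\<dots> < \<infinity>" using u[of x] by (simp add: ennreal_mult_less_top)
  finally show ?thesis .
qed

lemma order_ge_nconv_finite_everywhere:
  assumes p: "order_ge a p" and q: "order_ge b q" and ab: "1 \<le> a + b"
    and [measurable]: "u \<in> borel_measurable borel" and u0: "\<And>t. t \<le> 0 \<Longrightarrow> u t = 0"
    and u: "\<And>B. nconv (modulus heaviside) u B < \<infinity>"
  shows "nconv (modulus p) (nconv (modulus q) u) x < \<infinity>"
proof -
  note [measurable] = order_ge_measurable[OF p] order_ge_measurable[OF q]
  obtain C where "\<And>t. t \<le> x \<Longrightarrow> nconv (modulus p) (modulus q) t \<le> ennreal C * ennreal (powker (a + b) t)"
    using order_ge_nconv[OF p q] by blast
  then have "nconv (nconv (modulus p) (modulus q)) u x < \<infinity>"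
    by (rule nconv_order_ge_1_finite[OF _ _ _ ab u0 u, rotated 2]) auto
  then show ?thesis by (subst nconv_assoc) auto
qed

lemma order_ge_conv_assoc:
  assumes p: "order_ge a p" and q: "order_ge b q" and ab: "1 \<le> a + b" and h: "loc_int h"
  shows "conv p (conv q h) x = conv (conv p q) h x"
proof (rule conv_assoc)
  show "nconv (modulus p) (nconv (modulus q) (modulus h)) x < \<infinity>"
    using order_ge_nconv_finite_everywhere[OF p q ab, of "modulus h" x] loc_int_finite[OF h]
      loc_int_nonpos[OF h] loc_int_measurable[OF h] by (auto simp: modulus_nonpos)
qed (use p q h in \<open>auto dest: order_ge_measurable loc_int_measurable\<close>)

lemma order_ge_conv_finite:
  assumes p: "order_ge a p" and a: "1 \<le> a" and h: "loc_int h"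
  shows "nconv (modulus p) (modulus h) x < \<infinity>"
proof -
  note [measurable] = order_ge_measurable[OF p] loc_int_measurable[OF h]
  obtain C where "\<And>t. t \<le> x \<Longrightarrow> modulus p t \<le> ennreal C * ennreal (powker a t)"
    using order_ge_modulus[OF p] by blast
  then show ?thesis
    by (rule nconv_order_ge_1_finite[OF _ _ _ a _ loc_int_finite[OF h], rotated 2])
       (auto simp: modulus_def loc_int_nonpos[OF h])
qed

lemma pkernel_order:
  assumes "0 < \<rho>" "0 < m"
  shows "order_ge m (pkernel c \<rho> m \<omega>)"
  unfolding order_ge_def
proof (intro conjI allI pkernel_measurable assms)
  fix b
  have e: "0 < \<rho> * real j + m" for j using assms by (intro add_nonneg_pos) auto
  obtain C where C: "0 \<le> C" "\<And>j x. x \<le> b \<Longrightarrow> pcoef (norm c) (norm \<omega>) j * powker (\<rho> * real j + m) x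
      \<le> C * (1 / 2) ^ j * powker m x"
    using pkernel_term_bound[OF assms] by metis
  show "\<exists>C\<ge>0. \<forall>t\<le>b. norm (pkernel c \<rho> m \<omega> t) \<le> C * powker m t"
  proof (intro exI[of _ "C * 2"] conjI allI impI)
    fix t assume t: "t \<le> b"
    have s: "(\<lambda>j. C * (1 / 2) ^ j * powker m t) sums (C * 2 * powker m t)"
      using geometric_sums[of "1 / 2 :: real"] by (intro sums_mult2 sums_mult) auto
    have "norm (pkernel c \<rho> m \<omega> t) = norm (\<Sum>j. pcoef c \<omega> j * complex_of_real (powker (\<rho> * real j + m) t))"
      using pkernel_sums[OF assms] by (simp add: sums_iff)
    also have "\<dots> \<le> (\<Sum>j. C * (1 / 2) ^ j * powker m t)"
      using s by (intro norm_suminf_le order_trans[OF norm_pkernel_term_le[OF e] C(2)[OF t]]) (simp add: sums_iff)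
    also have "\<dots> = C * 2 * powker m t" using s by (simp add: sums_iff)
    finally show "norm (pkernel c \<rho> m \<omega> t) \<le> C * 2 * powker m t" .
  qed (use C in auto)
qed


lemma conv_geometric_series:
  assumes [measurable]: "p \<in> borel_measurable borel" "\<And>k. q k \<in> borel_measurable borel"
    "u \<in> borel_measurable borel"
    and C: "0 \<le> C" and p0: "\<And>t. t \<le> 0 \<Longrightarrow> p t = 0"
    and q: "\<And>k t. t \<le> x \<Longrightarrow> modulus (q k) t \<le> ennreal (C * (1 / 2) ^ k) * u t"
    and fin: "nconv (modulus p) u x < \<infinity>"
  shows "summable (\<lambda>k. norm (conv p (q k) x))" "conv p (\<lambda>t. \<Sum>k. q k t) x = (\<Sum>k. conv p (q k) x)"
proof -
  have "(\<Sum>k. nconv (modulus p) (modulus (q k)) x) \<le> (\<Sum>k. ennreal (C * (1 / 2) ^ k) * nconv (modulus p) u x)"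
  proof (intro suminf_le summableI)
    fix k
    have "nconv (modulus p) (modulus (q k)) x \<le> nconv (modulus p) (\<lambda>t. ennreal (C * (1 / 2) ^ k) * u t) x"
    proof (rule nconv_mono)
      fix t
      show "modulus p (x - t) * modulus (q k) t \<le> modulus p (x - t) * (ennreal (C * (1 / 2) ^ k) * u t)"
        using p0[of "x - t"] q[of t k] by (cases "t \<le> x") (auto intro: mult_left_mono simp: modulus_def)
    qed
    then show "nconv (modulus p) (modulus (q k)) x \<le> ennreal (C * (1 / 2) ^ k) * nconv (modulus p) u x"
      by (subst (asm) nconv_cmult_right) auto
  qed
  also have "\<dots> = (\<Sum>k. ennreal (C * (1 / 2) ^ k)) * nconv (modulus p) u x"
    by (rule ennreal_suminf_multc)
  also have "(\<Sum>k. ennreal (C * (1 / 2) ^ k)) = ennreal (\<Sum>k. C * (1 / 2) ^ k)"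
    using C by (intro suminf_ennreal2) (auto intro!: summable_mult summable_geometric)
  also have "\<dots> * nconv (modulus p) u x < \<infinity>"
    using fin by (simp add: ennreal_mult_less_top)
  finally have *: "(\<Sum>k. nconv (modulus p) (modulus (q k)) x) < \<infinity>" .
  show "summable (\<lambda>k. norm (conv p (q k) x))" "conv p (\<lambda>t. \<Sum>k. q k t) x = (\<Sum>k. conv p (q k) x)"
    by (rule conv_suminf_right[OF _ _ *]; measurable)+
qed

lemma conv_powker:
  assumes a: "0 < a" and b: "0 < b"
  shows "conv (\<lambda>t. complex_of_real (powker a t)) (\<lambda>t. complex_of_real (powker b t)) x = complex_of_real (powker (a + b) x)"
    and "integrable lborel (\<lambda>t. powker a (x - t) * powker b t)"
proof -
  have nn: "0 \<le> powker a (x - t) * powker b t" for t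
    using powker_nonneg[OF a] powker_nonneg[OF b] by simp
  have I: "(\<integral>\<^sup>+t. ennreal (powker a (x - t) * powker b t) \<partial>lborel) = ennreal (powker (a + b) x)"
    unfolding nconv_powker[OF a b, symmetric] nconv_def using powker_nonneg[OF a] powker_nonneg[OF b]
    by (simp add: ennreal_mult)
  show int: "integrable lborel (\<lambda>t. powker a (x - t) * powker b t)"
    by (rule integrableI_nn_integral_finite[OF _ _ I]) (use nn powker_nonneg[of "a + b"] a b in auto)
  have "(LINT t|lborel. powker a (x - t) * powker b t) = powker (a + b) x"
    by (rule integral_eq_nn_integral[THEN trans]) (use nn I powker_nonneg[of "a + b"] a b in auto)
  then show "conv (\<lambda>t. complex_of_real (powker a t)) (\<lambda>t. complex_of_real (powker b t)) x = complex_of_real (powker (a + b) x)"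
    unfolding conv_def of_real_mult[symmetric] integral_complex_of_real by simp
qed

text \<open>For fixed \<open>t\<close> the product of the two kernels is expanded as a Cauchy product, whose terms are sums of
products of powers of \<open>x - t\<close> and \<open>t\<close>. All products in the \<open>k\<close>-th sum integrate to the same power of
\<open>x\<close>, so that their coefficients add up by \<open>pcoef_add\<close>. The same computation with absolute values
justifies integrating term by term.\<close>
lemma conv_pkernel:
  assumes \<rho>: "0 < \<rho>" and m: "0 < m" and n: "0 < n"
  shows "conv (pkernel c \<rho> m \<omega>) (pkernel d \<rho> n \<omega>) x = pkernel (c + d) \<rho> (m + n) \<omega> x"
proof -
  let ?u = "\<lambda>c m t j. pcoef c \<omega> j * complex_of_real (powker (\<rho> * real j + m) t)"
  let ?U = "\<lambda>c m t j. pcoef (norm c) (norm \<omega>) j * powker (\<rho> * real j + m) t"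
  let ?w = "\<lambda>k t. \<Sum>j\<le>k. ?u c m (x - t) j * ?u d n t (k - j)"
  \<comment> \<open>the majorant, with all coefficients replaced by those of the moduli\<close>
  let ?W = "\<lambda>k t. \<Sum>j\<le>k. ?U c m (x - t) j * ?U d n t (k - j)"
  have em: "0 < \<rho> * real j + m" for j using \<rho> m by (intro add_nonneg_pos) auto
  have en: "0 < \<rho> * real j + n" for j using \<rho> n by (intro add_nonneg_pos) auto
  have exponent: "\<rho> * real j + m + (\<rho> * real (k - j) + n) = \<rho> * real k + (m + n)" if "j \<le> k" for j k
    using that by (simp add: of_nat_diff algebra_simps)
  have su: "summable (\<lambda>j. norm (?u c m t j))" if "0 < m" for c m t
  proof (rule summable_comparison_test'[OF pkernel_term_summable[OF \<rho> that], where N = 0])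
    fix j
    have "0 < \<rho> * real j + m" using \<rho> that by (intro add_nonneg_pos) auto
    then show "norm (norm (?u c m t j)) \<le> ?U c m t j" using norm_pkernel_term_le by simp
  qed
  have prod: "(\<lambda>k. ?w k t) sums (pkernel c \<rho> m \<omega> (x - t) * pkernel d \<rho> n \<omega> t)" for t
    using Cauchy_product_sums[OF su[OF m] su[OF n]] pkernel_sums[OF \<rho> m] pkernel_sums[OF \<rho> n]
    by (simp add: sums_iff)
  have U0: "0 \<le> ?U c m t j" if "0 < \<rho> * real j + m" for c m t j
    using that by (intro mult_nonneg_nonneg pcoef_nonneg powker_nonneg) auto
  have w_le_W: "norm (?w k t) \<le> ?W k t" for k t
    by (rule sum_norm_le, subst norm_mult, intro mult_mono norm_pkernel_term_le em en U0) auto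
  have termE: "(\<lambda>t. ?u c m (x - t) j * ?u d n t (k - j)) = (\<lambda>t. pcoef c \<omega> j * pcoef d \<omega> (k - j) *
      complex_of_real (powker (\<rho> * real j + m) (x - t) * powker (\<rho> * real (k - j) + n) t))" for k j
    by (auto simp: mult_ac)
  have TermE: "(\<lambda>t. ?U c m (x - t) j * ?U d n t (k - j)) = (\<lambda>t. pcoef (norm c) (norm \<omega>) j * pcoef (norm d) (norm \<omega>) (k - j) *
      (powker (\<rho> * real j + m) (x - t) * powker (\<rho> * real (k - j) + n) t))" for k j
    by (auto simp: mult_ac)
  have term_int: "integrable lborel (\<lambda>t. ?u c m (x - t) j * ?u d n t (k - j))" for k j
    unfolding termE by (intro integrable_mult_right integrable_of_real conv_powker(2) em en)
  have Term_int: "integrable lborel (\<lambda>t. ?U c m (x - t) j * ?U d n t (k - j))" for k j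
    unfolding TermE by (intro integrable_mult_right conv_powker(2) em en)
  have w_int: "integrable lborel (?w k)" for k by (intro Bochner_Integration.integrable_sum term_int)
  have W_int: "integrable lborel (?W k)" for k by (intro Bochner_Integration.integrable_sum Term_int)
  have w_val: "(LINT t|lborel. ?w k t) = ?u (c + d) (m + n) x k" for k
  proof -
    have "(LINT t|lborel. ?w k t) = (\<Sum>j\<le>k. LINT t|lborel. ?u c m (x - t) j * ?u d n t (k - j))"
      by (rule Bochner_Integration.integral_sum) (rule term_int)
    also have "\<dots> = (\<Sum>j\<le>k. pcoef c \<omega> j * pcoef d \<omega> (k - j) * complex_of_real (powker (\<rho> * real k + (m + n)) x))"
    proof (rule sum.cong[OF refl])
      fix j assume "j \<in> {..k}"
      then have jk: "j \<le> k" by simp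
      show "(LINT t|lborel. ?u c m (x - t) j * ?u d n t (k - j))
          = pcoef c \<omega> j * pcoef d \<omega> (k - j) * complex_of_real (powker (\<rho> * real k + (m + n)) x)"
        using conv_powker(1)[OF em[of j] en[of "k - j"], of x, unfolded exponent[OF jk]] unfolding termE
        by (simp add: conv_def)
    qed
    also have "\<dots> = ?u (c + d) (m + n) x k"
      by (simp add: sum_distrib_right[symmetric] pcoef_add)
    finally show ?thesis .
  qed
  have W_val: "(LINT t|lborel. ?W k t) = ?U (complex_of_real (norm c + norm d)) (m + n) x k" for k
  proof -
    have "(LINT t|lborel. ?W k t) = (\<Sum>j\<le>k. LINT t|lborel. ?U c m (x - t) j * ?U d n t (k - j))"
      by (rule Bochner_Integration.integral_sum) (rule Term_int)
    also have "\<dots> = (\<Sum>j\<le>k. pcoef (norm c) (norm \<omega>) j * pcoef (norm d) (norm \<omega>) (k - j) * powker (\<rho> * real k + (m + n)) x)"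
    proof (rule sum.cong[OF refl])
      fix j assume "j \<in> {..k}"
      then have jk: "j \<le> k" by simp
      have "complex_of_real (LINT t|lborel. powker (\<rho> * real j + m) (x - t) * powker (\<rho> * real (k - j) + n) t)
          = complex_of_real (powker (\<rho> * real k + (m + n)) x)"
        using conv_powker(1)[OF em[of j] en[of "k - j"], of x, unfolded exponent[OF jk]]
        unfolding conv_def of_real_mult[symmetric] integral_complex_of_real by simp
      then show "(LINT t|lborel. ?U c m (x - t) j * ?U d n t (k - j))
          = pcoef (norm c) (norm \<omega>) j * pcoef (norm d) (norm \<omega>) (k - j) * powker (\<rho> * real k + (m + n)) x"
        unfolding TermE by simp
    qed
    also have "\<dots> = pcoef (norm c + norm d) (norm \<omega>) k * powker (\<rho> * real k + (m + n)) x"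
      by (simp add: sum_distrib_right[symmetric] pcoef_add)
    also have "norm c + norm d = norm (complex_of_real (norm c + norm d))"
      unfolding norm_of_real by simp
    finally show ?thesis .
  qed
  have mn: "0 < m + n" using m n by simp
  have sumW: "summable (\<lambda>k. LINT t|lborel. ?W k t)"
    unfolding W_val by (rule pkernel_term_summable[OF \<rho> mn])
  have W0: "0 \<le> ?W k t" for k t
    by (intro sum_nonneg mult_nonneg_nonneg[OF U0 U0] em en)
  have "summable (\<lambda>k. LINT t|lborel. norm (?w k t))"
  proof (rule summable_comparison_test'[OF sumW, where N = 0])
    fix k
    have "(LINT t|lborel. norm (?w k t)) \<le> (LINT t|lborel. ?W k t)"
      by (rule integral_mono[OF integrable_norm[OF w_int] W_int w_le_W])
    then show "norm (LINT t|lborel. norm (?w k t)) \<le> (LINT t|lborel. ?W k t)" by simp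
  qed
  moreover have "AE t in lborel. summable (\<lambda>k. norm (?w k t))"
  proof (rule AE_I2)
    fix t
    have sU: "summable (\<lambda>j. norm (?U c m t j))" if "0 < m" for c m t
    proof -
      have "0 < \<rho> * real j + m" for j using \<rho> that by (intro add_nonneg_pos) auto
      from U0[OF this] have "norm (?U c m t j) = ?U c m t j" for j by (rule real_norm_def[THEN trans, OF abs_of_nonneg])
      then show ?thesis using pkernel_term_summable[OF \<rho> that] by simp
    qed
    have "summable (\<lambda>k. ?W k t)"
      using Cauchy_product_sums[OF sU[OF m] sU[OF n]] by (rule sums_summable)
    then show "summable (\<lambda>k. norm (?w k t))"
      by (rule summable_comparison_test'[where N = 0]) (use w_le_W in auto)
  qed
  ultimately have "(LINT t|lborel. (\<Sum>k. ?w k t)) = (\<Sum>k. LINT t|lborel. ?w k t)"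
    by (intro integral_suminf w_int)
  then show ?thesis
    using prod pkernel_sums[OF \<rho> mn, of "c + d" \<omega> x] unfolding w_val by (simp add: conv_def sums_iff)
qed


section \<open>Series of Prabhakar kernels\<close>

text \<open>By the semigroup law the \<open>k\<close>-th term is \<open>lam\<^sup>k\<close> times the convolution of the kernel with parameters \<open>c\<close>
and \<open>m\<close> with \<open>k\<close> copies of the kernel with parameters \<open>s\<close> and \<open>\<beta>\<close>.\<close>
definition kseries :: "complex \<Rightarrow> real \<Rightarrow> real \<Rightarrow> real \<Rightarrow> real \<Rightarrow> real \<Rightarrow> complex \<Rightarrow> real \<Rightarrow> complex" where
  "kseries lam s \<beta> c \<rho> m \<omega> t =
     (\<Sum>k. lam ^ k * pkernel (complex_of_real (c + real k * s)) \<rho> (m + \<beta> * real k) \<omega> t)"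

lemma kseries_term_bound:
  assumes pos: "0 < \<rho>" "0 < \<beta>" "0 < m" "0 \<le> c" "0 \<le> s"
  obtains C where "0 \<le> C"
    "\<And>k t. t \<le> b \<Longrightarrow> norm (lam ^ k * pkernel (complex_of_real (c + real k * s)) \<rho> (m + \<beta> * real k) \<omega> t)
       \<le> C * (1 / 2) ^ k * powker m t"
proof -
  obtain C where C0: "0 \<le> C" and C: "\<And>k j x. x \<le> b \<Longrightarrow> norm lam ^ k * (pcoef (c + real k * s) (norm \<omega>) j *
      powker (\<rho> * real j + (m + \<beta> * real k)) x) \<le> C * (1 / 2) ^ k * (1 / 2) ^ j * powker m x"
    using kernel_majorant[of \<rho> \<beta> m c s "norm lam" "norm \<omega>" b] pos by auto
  show ?thesis
  proof (rule that[of "C * 2"])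
    fix k t assume t: "t \<le> b"
    let ?c = "complex_of_real (c + real k * s)" and ?m = "m + \<beta> * real k"
    have nc: "norm ?c = c + real k * s" using pos unfolding norm_of_real by simp
    have m: "0 < ?m" using pos by (intro add_pos_nonneg) auto
    have e: "0 < \<rho> * real j + ?m" for j using pos by (intro add_nonneg_pos[OF _ m]) auto
    have sm: "(\<lambda>j. C * (1 / 2) ^ k * powker m t * (1 / 2) ^ j) sums (C * (1 / 2) ^ k * powker m t * 2)"
      using geometric_sums[of "1 / 2 :: real"] by (intro sums_mult) auto
    have s1: "(\<lambda>j. lam ^ k * (pcoef ?c \<omega> j * complex_of_real (powker (\<rho> * real j + ?m) t)))
        sums (lam ^ k * pkernel ?c \<rho> ?m \<omega> t)"
      by (intro sums_mult pkernel_sums pos m)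
    have "norm (lam ^ k * pkernel ?c \<rho> ?m \<omega> t)
        = norm (\<Sum>j. lam ^ k * (pcoef ?c \<omega> j * complex_of_real (powker (\<rho> * real j + ?m) t)))"
      using s1 by (simp add: sums_iff)
    also have "\<dots> \<le> (\<Sum>j. C * (1 / 2) ^ k * powker m t * (1 / 2) ^ j)"
    proof (rule norm_suminf_le)
      fix j
      have "norm (lam ^ k * (pcoef ?c \<omega> j * complex_of_real (powker (\<rho> * real j + ?m) t)))
         \<le> norm lam ^ k * (pcoef (c + real k * s) (norm \<omega>) j * powker (\<rho> * real j + ?m) t)"
        using norm_pkernel_term_le[OF e, of ?c \<omega> j j t]
        unfolding nc norm_mult[of "lam ^ k"] norm_power by (rule mult_left_mono) simp
      also have "\<dots> \<le> C * (1 / 2) ^ k * powker m t * (1 / 2) ^ j"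
        using C[OF t, of k j] by (simp add: mult_ac)
      finally show "norm (lam ^ k * (pcoef ?c \<omega> j * complex_of_real (powker (\<rho> * real j + ?m) t)))
         \<le> C * (1 / 2) ^ k * powker m t * (1 / 2) ^ j" .
    qed (use sm in \<open>simp add: sums_iff\<close>)
    also have "\<dots> = C * 2 * (1 / 2) ^ k * powker m t" using sm by (simp add: sums_iff mult_ac)
    finally show "norm (lam ^ k * pkernel ?c \<rho> ?m \<omega> t) \<le> C * 2 * (1 / 2) ^ k * powker m t" .
  qed (use C0 in auto)
qed

lemma kseries_summable:
  assumes pos: "0 < \<rho>" "0 < \<beta>" "0 < m" "0 \<le> c" "0 \<le> s"
  shows "summable (\<lambda>k. lam ^ k * pkernel (complex_of_real (c + real k * s)) \<rho> (m + \<beta> * real k) \<omega> t)"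
proof -
  obtain C where C: "\<And>k x. x \<le> t \<Longrightarrow> norm (lam ^ k * pkernel (complex_of_real (c + real k * s)) \<rho> (m + \<beta> * real k) \<omega> x)
       \<le> C * (1 / 2) ^ k * powker m x"
    using kseries_term_bound[OF pos, where b = t and lam = lam and \<omega> = \<omega>] by metis
  show ?thesis
  proof (rule summable_comparison_test'[where N = 0])
    show "summable (\<lambda>k. C * (1 / 2) ^ k * powker m t)"
      by (intro summable_mult summable_mult2 summable_geometric) auto
  qed (rule C, simp)
qed

lemma kseries_order:
  assumes pos: "0 < \<rho>" "0 < \<beta>" "0 < m" "0 \<le> c" "0 \<le> s"
  shows "order_ge m (kseries lam s \<beta> c \<rho> m \<omega>)"
  unfolding order_ge_def
proof (intro conjI allI pos)
  have [measurable]: "pkernel (complex_of_real (c + real k * s)) \<rho> (m + \<beta> * real k) \<omega> \<in> borel_measurable borel" for k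
    using pos by (intro pkernel_measurable add_pos_nonneg) auto
  show "kseries lam s \<beta> c \<rho> m \<omega> \<in> borel_measurable borel"
    unfolding kseries_def[abs_def] by measurable
  fix b
  obtain C where C: "0 \<le> C" "\<And>k x. x \<le> b \<Longrightarrow> norm (lam ^ k * pkernel (complex_of_real (c + real k * s)) \<rho> (m + \<beta> * real k) \<omega> x)
       \<le> C * (1 / 2) ^ k * powker m x"
    using kseries_term_bound[OF pos, where b = b and lam = lam and \<omega> = \<omega>] by metis
  show "\<exists>C\<ge>0. \<forall>t\<le>b. norm (kseries lam s \<beta> c \<rho> m \<omega> t) \<le> C * powker m t"
  proof (intro exI[of _ "C * 2"] conjI allI impI)
    fix t assume t: "t \<le> b"
    have sm: "(\<lambda>k. C * (1 / 2) ^ k * powker m t) sums (C * 2 * powker m t)"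
      using geometric_sums[of "1 / 2 :: real"] by (intro sums_mult2 sums_mult) auto
    have "norm (kseries lam s \<beta> c \<rho> m \<omega> t) \<le> (\<Sum>k. C * (1 / 2) ^ k * powker m t)"
      unfolding kseries_def using sm by (intro norm_suminf_le C t) (simp add: sums_iff)
    also have "\<dots> = C * 2 * powker m t" using sm by (simp add: sums_iff)
    finally show "norm (kseries lam s \<beta> c \<rho> m \<omega> t) \<le> C * 2 * powker m t" .
  qed (use C in auto)
qed

text \<open>Splitting off the first term; in the language of integral equations this is the resolvent equation.\<close>
lemma kseries_shift:
  assumes pos: "0 < \<rho>" "0 < \<beta>" "0 < m" "0 \<le> c" "0 \<le> s"
  shows "kseries lam s \<beta> c \<rho> m \<omega> t =
    pkernel (complex_of_real c) \<rho> m \<omega> t + lam * kseries lam s \<beta> (c + s) \<rho> (m + \<beta>) \<omega> t"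
proof -
  have "kseries lam s \<beta> c \<rho> m \<omega> t = pkernel (complex_of_real c) \<rho> m \<omega> t
     + (\<Sum>k. lam ^ Suc k * pkernel (complex_of_real (c + real (Suc k) * s)) \<rho> (m + \<beta> * real (Suc k)) \<omega> t)"
    unfolding kseries_def using suminf_split_head[OF kseries_summable[OF pos, of lam \<omega> t]]
    by (simp add: algebra_simps)
  also have "(\<Sum>k. lam ^ Suc k * pkernel (complex_of_real (c + real (Suc k) * s)) \<rho> (m + \<beta> * real (Suc k)) \<omega> t)
      = (\<Sum>k. lam * (lam ^ k * pkernel (complex_of_real (c + s + real k * s)) \<rho> (m + \<beta> + \<beta> * real k) \<omega> t))"
    by (intro suminf_cong) (simp add: algebra_simps)
  also have "\<dots> = lam * kseries lam s \<beta> (c + s) \<rho> (m + \<beta>) \<omega> t"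
    unfolding kseries_def using pos by (intro suminf_mult kseries_summable) auto
  finally show ?thesis .
qed

lemma conv_kseries_termwise:
  fixes \<omega> :: complex
  assumes pos: "0 < \<rho>" "0 < \<beta>" "0 < m" "0 \<le> c" "0 \<le> s"
    and [measurable]: "p \<in> borel_measurable borel" and p0: "\<And>t. t \<le> 0 \<Longrightarrow> p t = 0"
    and fin: "nconv (modulus p) (\<lambda>t. ennreal (powker m t)) x < \<infinity>"
  defines "q \<equiv> \<lambda>k. pkernel (complex_of_real (c + real k * s)) \<rho> (m + \<beta> * real k) \<omega>"
  shows "summable (\<lambda>k. lam ^ k * conv p (q k) x)"
    "conv p (kseries lam s \<beta> c \<rho> m \<omega>) x = (\<Sum>k. lam ^ k * conv p (q k) x)"
proof -
  have [measurable]: "q k \<in> borel_measurable borel" for k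
    unfolding q_def using pos by (intro pkernel_measurable add_pos_nonneg) auto
  obtain C where C0: "0 \<le> C" and C: "\<And>k t. t \<le> x \<Longrightarrow> norm (lam ^ k * q k t) \<le> C * (1 / 2) ^ k * powker m t"
    using kseries_term_bound[OF pos, where b = x and lam = lam and \<omega> = \<omega>] unfolding q_def by metis
  have le: "modulus (\<lambda>t. lam ^ k * q k t) t \<le> ennreal (C * (1 / 2) ^ k) * ennreal (powker m t)" if "t \<le> x" for k t
    unfolding modulus_def using C[OF that, of k] C0 powker_nonneg[OF pos(3), of t]
    by (simp add: ennreal_mult[symmetric])
  have series_eq: "kseries lam s \<beta> c \<rho> m \<omega> = (\<lambda>t. \<Sum>k. lam ^ k * q k t)"
    by (rule ext) (simp add: kseries_def q_def)
  have "summable (\<lambda>k. norm (conv p (\<lambda>t. lam ^ k * q k t) x))"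
    "conv p (\<lambda>t. \<Sum>k. lam ^ k * q k t) x = (\<Sum>k. conv p (\<lambda>t. lam ^ k * q k t) x)"
    by (rule conv_geometric_series[OF _ _ _ C0 p0 le fin]; measurable)+
  then show "summable (\<lambda>k. lam ^ k * conv p (q k) x)"
    "conv p (kseries lam s \<beta> c \<rho> m \<omega>) x = (\<Sum>k. lam ^ k * conv p (q k) x)"
    unfolding series_eq conv_cmult_right by (auto intro: summable_norm_cancel)
qed

lemma conv_pkernel_kseries:
  assumes pos: "0 < \<rho>" "0 < \<beta>" "0 < m" "0 \<le> c" "0 \<le> s" and n: "0 < n"
  shows "conv (pkernel (complex_of_real d) \<rho> n \<omega>) (kseries lam s \<beta> c \<rho> m \<omega>) x = kseries lam s \<beta> (d + c) \<rho> (n + m) \<omega> x"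
proof -
  have p: "order_ge n (pkernel (complex_of_real d) \<rho> n \<omega>)" using pos n by (intro pkernel_order)
  have pm: "order_ge m (\<lambda>t. complex_of_real (powker m t))"
    unfolding order_ge_def using pos powker_nonneg[OF pos(3)] by (auto intro!: exI[of _ 1])
  have mod: "modulus (\<lambda>t. complex_of_real (powker m t)) = (\<lambda>t. ennreal (powker m t))"
    using powker_nonneg[OF pos(3)] by (auto simp: modulus_def)
  have "conv (pkernel (complex_of_real d) \<rho> n \<omega>) (kseries lam s \<beta> c \<rho> m \<omega>) x =
    (\<Sum>k. lam ^ k * conv (pkernel (complex_of_real d) \<rho> n \<omega>)
        (pkernel (complex_of_real (c + real k * s)) \<rho> (m + \<beta> * real k) \<omega>) x)"
    using order_ge_nconv_finite[OF p pm, of x] order_ge_measurable[OF p] order_ge_nonpos[OF p]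
    unfolding mod by (intro conv_kseries_termwise(2) pos) auto
  also have "\<dots> = (\<Sum>k. lam ^ k * pkernel (complex_of_real (d + c + real k * s)) \<rho> (n + m + \<beta> * real k) \<omega> x)"
  proof (intro suminf_cong arg_cong2[where f = "(*)"] refl)
    fix k
    have "0 < m + \<beta> * real k" using pos by (intro add_pos_nonneg) auto
    from conv_pkernel[OF pos(1) n this, of "complex_of_real d" \<omega> "complex_of_real (c + real k * s)" x]
    show "conv (pkernel (complex_of_real d) \<rho> n \<omega>)
        (pkernel (complex_of_real (c + real k * s)) \<rho> (m + \<beta> * real k) \<omega>) x
        = pkernel (complex_of_real (d + c + real k * s)) \<rho> (n + m + \<beta> * real k) \<omega> x"
      by (simp add: add.assoc)
  qed
  finally show ?thesis by (simp add: kseries_def)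
qed

section \<open>Almost everywhere differentiability of indefinite integrals\<close>

lemma segment_cball_real: "cball ((x + y) / 2) (\<bar>y - x\<bar> / 2) = {min x y..max x (y::real)}"
  unfolding cball_eq_atLeastAtMost by (auto simp: min_def max_def abs_if field_simps)

text \<open>If the difference quotient of the integral at \<open>x\<close> stays away from \<open>f x\<close> on arbitrarily short intervals
with endpoint \<open>x\<close>, these intervals, tagged by \<open>x\<close>, contribute at least a fixed proportion of their
length to the error of a Riemann sum. Henstock's lemma makes the total error of disjoint such
intervals small, hence also their total length, and by Vitali's covering lemma fivefold enlargements
of disjoint ones cover all exceptional points.\<close>
theorem integral_derivative_AE:
  fixes f :: "real \<Rightarrow> 'a::euclidean_space"
  assumes f: "f integrable_on {a..b}"
  shows "negligible {x \<in> {a<..<b}. \<not> ((\<lambda>u. integral {a..u} f) has_vector_derivative f x) (at x)}"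
proof -
  define F where "F u = integral {a..u} f" for u
  define D where "D x y = F y - F x - (y - x) *\<^sub>R f x" for x y
  define E where "E n = {x \<in> {a<..<b}. \<forall>\<delta>>0. \<exists>y\<in>{a..b}. y \<noteq> x \<and> \<bar>y - x\<bar> < \<delta> \<and>
      \<bar>y - x\<bar> < real (Suc n) * norm (D x y)}" for n :: nat
  have "negligible (E n)" for n
    unfolding negligible_outer_le
  proof (intro allI impI)
    fix e :: real assume e: "0 < e"
    \<comment> \<open>the factor \<open>5\<close> pays for the enlargement in the covering lemma, the factor \<open>n + 1\<close> for the proportion\<close>
    let ?\<epsilon> = "e / (5 * real (Suc n))"
    have e0: "0 < ?\<epsilon>" using e by simp
    have fi: "f integrable_on cbox a b" using f by simp
    obtain \<gamma> where \<gamma>: "gauge \<gamma>"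
      and H: "\<And>p. \<lbrakk>p tagged_partial_division_of (cbox a b); \<gamma> fine p\<rbrakk> \<Longrightarrow>
             sum (\<lambda>(x,k). norm(measure lborel k *\<^sub>R f x - integral k f)) p < ?\<epsilon>"
      by (rule Henstock_lemma[OF fi e0]) (rule that)
    define I where "I p = {min (fst p) (snd p)..max (fst p) (snd p)}" for p :: "real \<times> real"
    define c where "c p = (fst p + snd p) / 2" for p :: "real \<times> real"
    define r where "r p = \<bar>snd p - fst p\<bar> / 2" for p :: "real \<times> real"
    have cb: "cball (c p) (r p) = I p" for p
      by (simp add: c_def r_def I_def segment_cball_real)
    define K where "K = {p. fst p \<in> E n \<and> snd p \<in> {a..b} \<and> snd p \<noteq> fst p \<and> I p \<subseteq> \<gamma> (fst p) \<and>
        \<bar>snd p - fst p\<bar> < real (Suc n) * norm (D (fst p) (snd p))}"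
    have KE: "fst p \<in> {a<..<b}" "snd p \<in> {a..b}" "snd p \<noteq> fst p" "I p \<subseteq> \<gamma> (fst p)"
        "\<bar>snd p - fst p\<bar> < real (Suc n) * norm (D (fst p) (snd p))" if "p \<in> K" for p
      using that by (auto simp: K_def E_def)
    have cover: "E n \<subseteq> (\<Union>p\<in>K. cball (c p) (r p))"
    proof
      fix x assume x: "x \<in> E n"
      obtain \<delta> where \<delta>: "0 < \<delta>" "ball x \<delta> \<subseteq> \<gamma> x"
        using \<gamma> unfolding gauge_def by (meson open_contains_ball)
      then obtain y where y: "y \<in> {a..b}" "y \<noteq> x" "\<bar>y - x\<bar> < \<delta>" "\<bar>y - x\<bar> < real (Suc n) * norm (D x y)"
        using x unfolding E_def by blast
      have "I (x, y) \<subseteq> ball x \<delta>"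
        using y by (auto simp: I_def dist_real_def min_def max_def split: if_splits)
      then have "(x, y) \<in> K" using x y \<delta> by (auto simp: K_def)
      moreover have "x \<in> cball (c (x, y)) (r (x, y))" unfolding cb by (auto simp: I_def)
      ultimately show "x \<in> (\<Union>p\<in>K. cball (c p) (r p))" by blast
    qed
    have rB: "0 < r p \<and> r p \<le> \<bar>b - a\<bar>" if "p \<in> K" for p
      using KE[OF that] by (auto simp: r_def)
    obtain C where C: "countable C" "C \<subseteq> K"
      and disj: "pairwise (\<lambda>i j. disjnt (cball (c i) (r i)) (cball (c j) (r j))) C"
      and EC: "E n \<subseteq> (\<Union>i\<in>C. cball (c i) (5 * r i))"
      by (rule Vitali_covering_lemma_cballs[OF cover rB]) (auto intro: that)
    have bound: "(\<Sum>p\<in>P. 2 * r p) \<le> e / 5" if P: "P \<subseteq> C" "finite P" for P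
    proof -
      define p where "p = (\<lambda>q. (fst q, I q)) ` P"
      have PK: "q \<in> K" if "q \<in> P" for q using that P C by blast
      have Idisj: "disjnt (I q) (I q')" if "q \<in> P" "q' \<in> P" "q \<noteq> q'" for q q'
        using disj that P unfolding pairwise_def cb by blast
      have inj: "inj_on (\<lambda>q. (fst q, I q)) P"
      proof (rule inj_onI, rule ccontr)
        fix q q' assume q: "q \<in> P" "q' \<in> P" "(fst q, I q) = (fst q', I q')" "q \<noteq> q'"
        then have "disjnt (I q) (I q)" using Idisj[of q q'] by auto
        moreover have "fst q \<in> I q" by (auto simp: I_def)
        ultimately show False by (auto simp: disjnt_def)
      qed
      have tag: "p tagged_partial_division_of cbox a b"
        unfolding tagged_partial_division_of_def
      proof (intro conjI allI impI)
        show "finite p" using P by (simp add: p_def)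
      next
        fix x k assume "(x, k) \<in> p"
        then obtain q where q: "q \<in> P" "x = fst q" "k = I q" by (auto simp: p_def)
        note KE[OF PK[OF q(1)]]
        then show "x \<in> k" "k \<subseteq> cbox a b" using q by (auto simp: I_def)
        show "\<exists>a b. k = cbox a b" using q by (auto simp: I_def cbox_interval)
      next
        fix x1 k1 x2 k2 assume "(x1, k1) \<in> p \<and> (x2, k2) \<in> p \<and> (x1, k1) \<noteq> (x2, k2)"
        then obtain q q' where q: "q \<in> P" "q' \<in> P" "k1 = I q" "k2 = I q'" "q \<noteq> q'"
          by (auto simp: p_def)
        then have "k1 \<inter> k2 = {}" using Idisj[of q q'] by (auto simp: disjnt_def)
        then show "interior k1 \<inter> interior k2 = {}" using interior_subset by blast
      qed
      have fine: "\<gamma> fine p"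
        unfolding fine_def p_def using KE(4)[OF PK] by auto
      have incr: "norm (measure lborel (I q) *\<^sub>R f (fst q) - integral (I q) f) = norm (D (fst q) (snd q))"
        if q: "q \<in> P" for q
      proof -
        obtain x y where xy: "q = (x, y)" by (cases q)
        have x: "a < x" "x < b" "a \<le> y" "y \<le> b" "y \<noteq> x" using KE[OF PK[OF q]] xy by auto
        have diff: "F v - F u = integral {u..v} f" if "a \<le> u" "u \<le> v" "v \<le> b" for u v
        proof -
          have "f integrable_on {a..v}"
            by (rule integrable_on_subinterval[OF f]) (use that in auto)
          from Henstock_Kurzweil_Integration.integral_combine[OF that(1,2) this]
          show ?thesis by (simp add: F_def algebra_simps)
        qed
        show ?thesis
        proof (cases "x < y")
          case True
          then have "I q = {x..y}" by (simp add: I_def xy)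
          then show ?thesis using True x diff[of x y] by (simp add: D_def xy norm_minus_commute)
        next
          case False
          then have "I q = {y..x}" by (simp add: I_def xy)
          moreover have "(x - y) *\<^sub>R f x - (F x - F y) = D x y"
            by (simp add: D_def scaleR_diff_left)
          ultimately show ?thesis using False x diff[of y x] by (simp add: xy)
        qed
      qed
      have "(\<Sum>q\<in>P. 2 * r q) \<le> (\<Sum>q\<in>P. real (Suc n) * norm (D (fst q) (snd q)))"
        using KE(5)[OF PK] by (intro sum_mono) (auto simp: r_def less_imp_le)
      also have "\<dots> = real (Suc n) * (\<Sum>q\<in>P. norm (measure lborel (I q) *\<^sub>R f (fst q) - integral (I q) f))"
        unfolding sum_distrib_left by (intro sum.cong) (auto simp: incr)
      also have "(\<Sum>q\<in>P. norm (measure lborel (I q) *\<^sub>R f (fst q) - integral (I q) f))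
         = (\<Sum>(x,k)\<in>p. norm (measure lborel k *\<^sub>R f x - integral k f))"
        unfolding p_def by (subst sum.reindex[OF inj]) simp
      also have "real (Suc n) * \<dots> \<le> real (Suc n) * ?\<epsilon>"
        using H[OF tag fine] by (intro mult_left_mono) auto
      also have "\<dots> = e / 5" by (simp del: of_nat_Suc)
      finally show ?thesis .
    qed
    have mb: "measure lebesgue (\<Union>i\<in>P. cball (c i) (5 * r i)) \<le> e" if P: "P \<subseteq> C" "finite P" for P
    proof -
      have "measure lebesgue (\<Union>i\<in>P. cball (c i) (5 * r i)) \<le> (\<Sum>i\<in>P. measure lebesgue (cball (c i) (5 * r i)))"
        by (rule measure_UNION_le) (use P in auto)
      also have "\<dots> = (\<Sum>i\<in>P. 5 * (2 * r i))"
        using rB C P by (intro sum.cong) (auto simp: cball_eq_atLeastAtMost r_def)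
      also have "\<dots> \<le> e" using bound[OF P] by (simp add: sum_distrib_left[symmetric])
      finally show ?thesis .
    qed
    show "\<exists>T. E n \<subseteq> T \<and> T \<in> lmeasurable \<and> measure lebesgue T \<le> e"
    proof (intro exI conjI)
      show "E n \<subseteq> (\<Union>i\<in>C. cball (c i) (5 * r i))" by (rule EC)
      show "(\<Union>i\<in>C. cball (c i) (5 * r i)) \<in> lmeasurable"
        by (rule fmeasurable_UN_bound[OF C(1) _ mb]) auto
      show "measure lebesgue (\<Union>i\<in>C. cball (c i) (5 * r i)) \<le> e"
        by (rule measure_UN_bound[OF C(1) _ mb]) auto
    qed
  qed
  then have neg: "negligible (\<Union>n. E n)" by (rule negligible_Union_nat)
  show ?thesis
  proof (rule negligible_subset[OF neg], rule subsetI, rule ccontr)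
    fix x assume x: "x \<in> {x \<in> {a<..<b}. \<not> ((\<lambda>u. integral {a..u} f) has_vector_derivative f x) (at x)}"
      and nE: "x \<notin> (\<Union>n. E n)"
    have "(F has_vector_derivative f x) (at x)"
      unfolding has_vector_derivative_def has_derivative_within_alt
    proof (intro conjI allI impI bounded_linear_scaleR_left)
      fix e :: real assume "0 < e"
      then obtain n where n: "1 / real (Suc n) < e"
        by (meson nat_approx_posE)
      have "\<exists>\<delta>>0. \<forall>y\<in>{a..b}. y \<noteq> x \<longrightarrow> \<bar>y - x\<bar> < \<delta> \<longrightarrow> real (Suc n) * norm (D x y) \<le> \<bar>y - x\<bar>"
        using x nE unfolding E_def by (fastforce simp: not_less)
      then obtain \<delta> where \<delta>: "0 < \<delta>" and le: "\<And>y. y \<in> {a..b} \<Longrightarrow> y \<noteq> x \<Longrightarrow> \<bar>y - x\<bar> < \<delta> \<Longrightarrow>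
          real (Suc n) * norm (D x y) \<le> \<bar>y - x\<bar>"
        by blast
      show "\<exists>d>0. \<forall>y\<in>UNIV. norm (y - x) < d \<longrightarrow> norm (F y - F x - (y - x) *\<^sub>R f x) \<le> e * norm (y - x)"
      proof (intro exI[of _ "min \<delta> (min (x - a) (b - x))"] conjI ballI impI)
        show "0 < min \<delta> (min (x - a) (b - x))" using x \<delta> by auto
        fix y assume "norm (y - x) < min \<delta> (min (x - a) (b - x))"
        then have y: "y \<in> {a..b}" "\<bar>y - x\<bar> < \<delta>" by (auto simp: abs_if split: if_splits)
        have "norm (D x y) \<le> e * \<bar>y - x\<bar>"
        proof (cases "y = x")
          case False
          have "norm (D x y) \<le> 1 / real (Suc n) * \<bar>y - x\<bar>"
            using le[OF y(1) False y(2)] by (simp add: field_simps)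
          also have "\<dots> \<le> e * \<bar>y - x\<bar>" using n by (intro mult_right_mono) auto
          finally show ?thesis .
        qed (simp add: D_def)
        then show "norm (F y - F x - (y - x) *\<^sub>R f x) \<le> e * norm (y - x)" by (simp add: D_def)
      qed
    qed
    with x show False by (simp add: F_def[abs_def])
  qed
qed


section \<open>Absolutely continuous functions are indefinite integrals\<close>

text \<open>A finite family of nonoverlapping, possibly degenerate, intervals in \<open>[a,b]\<close>. A set of pairs suffices,
since intervals that occur repeatedly are degenerate and contribute nothing to any sum. Working with
packings instead of partitions spares all bookkeeping with ordered subdivision points.\<close>
definition packing :: "real \<Rightarrow> real \<Rightarrow> (real \<times> real) set \<Rightarrow> bool" where
  "packing a b P \<longleftrightarrow> finite P \<and> (\<forall>p\<in>P. a \<le> fst p \<and> fst p \<le> snd p \<and> snd p \<le> b) \<and>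
     pairwise (\<lambda>p q. disjnt {fst p<..<snd p} {fst q<..<snd q}) P"

definition increments :: "(real \<Rightarrow> 'a::real_normed_vector) \<Rightarrow> (real \<times> real) set \<Rightarrow> real" where
  "increments g P = (\<Sum>p\<in>P. norm (g (snd p) - g (fst p)))"

definition total_length :: "(real \<times> real) set \<Rightarrow> real" where
  "total_length P = (\<Sum>p\<in>P. snd p - fst p)"

text \<open>Absolute continuity on every \<open>[0,b]\<close> of a function that is continued by its value at \<open>0\<close> to the
negative half line, so that it can serve as a distribution function on the whole line.\<close>
definition ac_half_line :: "(real \<Rightarrow> 'a::real_normed_vector) \<Rightarrow> bool" where
  "ac_half_line g \<longleftrightarrow> (\<forall>x\<le>0. g x = g 0) \<and>
     (\<forall>b. \<forall>\<epsilon>>0. \<exists>\<delta>>0. \<forall>P. packing 0 b P \<and> total_length P < \<delta> \<longrightarrow> increments g P < \<epsilon>)"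

lemma packing_mono: "packing a b P \<Longrightarrow> a' \<le> a \<Longrightarrow> b \<le> b' \<Longrightarrow> packing a' b' P"
  unfolding packing_def by force

lemma packing_subset: "packing a b P \<Longrightarrow> Q \<subseteq> P \<Longrightarrow> packing a b Q"
  unfolding packing_def by (auto intro: finite_subset pairwise_subset)

lemma packing_empty [simp]: "packing a b {}"
  by (simp add: packing_def)

lemma packing_single: "a \<le> u \<Longrightarrow> u \<le> v \<Longrightarrow> v \<le> b \<Longrightarrow> packing a b {(u, v)}"
  by (simp add: packing_def)

lemma packing_total_length:
  assumes "packing a b P"
  shows "total_length P = measure lborel (\<Union>p\<in>P. {fst p<..<snd p})"
proof -
  have "measure lborel (\<Union>p\<in>P. {fst p<..<snd p}) = (\<Sum>p\<in>P. measure lborel {fst p<..<snd p})"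
    using assms by (intro measure_UNION') (auto simp: packing_def fmeasurable_def)
  also have "\<dots> = total_length P"
    unfolding total_length_def using assms by (intro sum.cong) (auto simp: packing_def)
  finally show ?thesis ..
qed

lemma packing_total_length_le:
  assumes "packing a b P" "a \<le> b"
  shows "total_length P \<le> b - a"
proof -
  have "measure lborel (\<Union>p\<in>P. {fst p<..<snd p}) \<le> measure lborel {a..b}"
    using assms by (intro measure_mono_fmeasurable) (auto simp: packing_def fmeasurable_def intro!: sets.finite_UN)
  then show ?thesis using assms by (simp add: packing_total_length)
qed

lemma increments_join:
  assumes P: "packing x y P" and Q: "packing y z Q" and xyz: "x \<le> y" "y \<le> z"
  shows "packing x z (P \<union> Q)" "increments g (P \<union> Q) = increments g P + increments g Q"
proof -
  have "disjnt {fst p<..<snd p} {fst q<..<snd q}" if "p \<in> P" "q \<in> Q" for p q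
  proof -
    have "snd p \<le> y" "y \<le> fst q" using that P Q by (auto simp: packing_def)
    then show ?thesis by (auto simp: disjnt_def)
  qed
  then have "pairwise (\<lambda>p q. disjnt {fst p<..<snd p} {fst q<..<snd q}) (P \<union> Q)"
    using P Q unfolding packing_def pairwise_def by (meson UnE disjnt_sym)
  moreover have "packing x z P" "packing x z Q"
    using P Q xyz by (auto intro: packing_mono)
  ultimately show "packing x z (P \<union> Q)" unfolding packing_def by auto
  have deg: "norm (g (snd p) - g (fst p)) = 0" if "p \<in> P \<inter> Q" for p
  proof -
    have "snd p \<le> y" "y \<le> fst p" "fst p \<le> snd p" using that P Q by (auto simp: packing_def)
    then have "snd p = fst p" by linarith
    then show ?thesis by simp
  qed
  have "increments g (P \<union> Q) + increments g (P \<inter> Q) = increments g P + increments g Q"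
    unfolding increments_def using P Q by (intro sum.union_inter) (auto simp: packing_def)
  moreover have "increments g (P \<inter> Q) = 0"
    unfolding increments_def using deg by (intro sum.neutral) auto
  ultimately show "increments g (P \<union> Q) = increments g P + increments g Q" by simp
qed

text \<open>Distinct intervals with the same image under a clamping map must have a degenerate image, because
images of nonoverlapping intervals do not overlap; thus nothing is lost in the sum over the image.\<close>
lemma packing_clamp:
  assumes P: "packing x z P" and h: "mono h" "\<And>t. t \<in> {x..z} \<Longrightarrow> h t \<in> {x'..z'}"
    and sub: "\<And>u v. {h u<..<h v} \<subseteq> {u<..<v}"
  shows "packing x' z' ((\<lambda>p. (h (fst p), h (snd p))) ` P)"
    "increments g ((\<lambda>p. (h (fst p), h (snd p))) ` P) = (\<Sum>p\<in>P. norm (g (h (snd p)) - g (h (fst p))))"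
proof -
  have dis: "disjnt {h (fst p)<..<h (snd p)} {h (fst q)<..<h (snd q)}"
    if "p \<in> P" "q \<in> P" "p \<noteq> q" for p q
  proof -
    have "disjnt {fst p<..<snd p} {fst q<..<snd q}" using P that by (auto simp: packing_def pairwise_def)
    then show ?thesis using sub by (meson disjnt_subset1 disjnt_subset2)
  qed
  have rng: "x \<le> fst p" "fst p \<le> snd p" "snd p \<le> z" if "p \<in> P" for p using P that by (auto simp: packing_def)
  show "packing x' z' ((\<lambda>p. (h (fst p), h (snd p))) ` P)"
    unfolding packing_def
  proof (intro conjI)
    show "finite ((\<lambda>p. (h (fst p), h (snd p))) ` P)" using P by (simp add: packing_def)
    show "\<forall>p\<in>(\<lambda>p. (h (fst p), h (snd p))) ` P. x' \<le> fst p \<and> fst p \<le> snd p \<and> snd p \<le> z'"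
    proof clarsimp
      fix u v assume uv: "(u, v) \<in> P"
      have "x \<le> u" "u \<le> v" "v \<le> z" using rng[OF uv] by auto
      then show "x' \<le> h u \<and> h u \<le> h v \<and> h v \<le> z'"
        using h(2)[of u] h(2)[of v] monoD[OF h(1), of u v] by auto
    qed
    show "pairwise (\<lambda>p q. disjnt {fst p<..<snd p} {fst q<..<snd q}) ((\<lambda>p. (h (fst p), h (snd p))) ` P)"
      unfolding pairwise_image by (rule pairwiseI) (use dis in auto)
  qed
  show "increments g ((\<lambda>p. (h (fst p), h (snd p))) ` P) = (\<Sum>p\<in>P. norm (g (h (snd p)) - g (h (fst p))))"
    unfolding increments_def
  proof (subst sum.reindex_nontrivial)
    show "finite P" using P by (simp add: packing_def)
    fix p q assume pq: "p \<in> P" "q \<in> P" "p \<noteq> q" "(h (fst p), h (snd p)) = (h (fst q), h (snd q))"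
    from dis[OF pq(1-3)] pq(4) have "{h (fst p)<..<h (snd p)} = {}" by (auto simp: disjnt_def)
    moreover have "h (fst p) \<le> h (snd p)" using monoD[OF h(1) rng(2)[OF pq(1)]] .
    ultimately show "norm (g (snd (h (fst p), h (snd p))) - g (fst (h (fst p), h (snd p)))) = 0" by auto
  qed simp
qed

text \<open>Cutting every interval at \<open>y\<close> amounts to clamping it from above and from below; only an interval that
contains \<open>y\<close> is really cut, and there the triangle inequality applies.\<close>
lemma increments_split:
  assumes P: "packing x z P" and xyz: "x \<le> y" "y \<le> z"
  obtains Q R where "packing x y Q" "packing y z R" "increments g P \<le> increments g Q + increments g R"
proof -
  let ?m = "\<lambda>t. min t y" and ?M = "\<lambda>t. max t y"
  have m: "mono ?m" "\<And>t. t \<in> {x..z} \<Longrightarrow> ?m t \<in> {x..y}" "\<And>u v. {?m u<..<?m v} \<subseteq> {u<..<v}"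
    using xyz by (auto simp: mono_def)
  have M: "mono ?M" "\<And>t. t \<in> {x..z} \<Longrightarrow> ?M t \<in> {y..z}" "\<And>u v. {?M u<..<?M v} \<subseteq> {u<..<v}"
    using xyz by (auto simp: mono_def)
  have "increments g P \<le> (\<Sum>p\<in>P. norm (g (?m (snd p)) - g (?m (fst p))) + norm (g (?M (snd p)) - g (?M (fst p))))"
    unfolding increments_def
  proof (rule sum_mono)
    fix p assume "p \<in> P"
    then have le: "fst p \<le> snd p" using P by (auto simp: packing_def)
    consider "snd p \<le> y" | "y \<le> fst p" | "fst p \<le> y" "y \<le> snd p" by linarith
    then show "norm (g (snd p) - g (fst p)) \<le>
        norm (g (?m (snd p)) - g (?m (fst p))) + norm (g (?M (snd p)) - g (?M (fst p)))"
    proof cases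
      case 3
      then show ?thesis using norm_triangle_ineq[of "g y - g (fst p)" "g (snd p) - g y"] by simp
    qed (use le in auto)
  qed
  then show ?thesis
    using packing_clamp(1)[OF P m] packing_clamp(1)[OF P M]
      packing_clamp(2)[OF P m, of g] packing_clamp(2)[OF P M, of g]
    by (intro that) (auto simp: sum.distrib)
qed

definition variation :: "(real \<Rightarrow> 'a::real_normed_vector) \<Rightarrow> real \<Rightarrow> real" where
  "variation g x = Sup {increments g P |P. packing 0 x P}"

text \<open>On an interval shorter than \<open>\<delta>\<close> the increments of any packing add up to less than \<open>1\<close>, and \<open>[0,b]\<close> is
a union of finitely many intervals of length \<open>\<delta> / 2\<close>.\<close>
lemma ac_increments_bounded:
  assumes "ac_half_line g"
  shows "\<exists>M. \<forall>P. packing 0 b P \<longrightarrow> increments g P \<le> M"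
proof -
  obtain \<delta> where \<delta>: "0 < \<delta>" "\<And>P. packing 0 b P \<Longrightarrow> total_length P < \<delta> \<Longrightarrow> increments g P < 1"
    using assms unfolding ac_half_line_def by (metis zero_less_one)
  have *: "increments g P \<le> real n" if "packing (b - real n * (\<delta> / 2)) b P" "packing 0 b P" for n P
    using that
  proof (induction n arbitrary: P)
    case 0
    then have "snd p = fst p" if "p \<in> P" for p using that by (force simp: packing_def)
    then show ?case by (simp add: increments_def)
  next
    case (Suc n)
    let ?x = "b - real (Suc n) * (\<delta> / 2)" and ?y = "b - real n * (\<delta> / 2)"
    have xy: "?x \<le> ?y" "?y \<le> b" using \<delta>(1) by (auto simp: algebra_simps)
    show ?case
    proof (cases "0 \<le> ?y")
      case True
      have "packing (max 0 ?x) b P" using Suc.prems by (auto simp: packing_def)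
      then obtain Q R where QR: "packing (max 0 ?x) ?y Q" "packing ?y b R" "increments g P \<le> increments g Q + increments g R"
        using increments_split[of "max 0 ?x" b P ?y g] xy True by auto
      have "total_length Q \<le> ?y - max 0 ?x" using QR(1) True xy by (intro packing_total_length_le) auto
      also have "\<dots> < \<delta>" using \<delta>(1) by (auto simp: algebra_simps max_def)
      finally have "increments g Q < 1"
        using QR(1) xy by (intro \<delta>(2)) (auto intro: packing_mono)
      moreover have "increments g R \<le> real n"
        using QR(2) True by (intro Suc.IH) (auto intro: packing_mono)
      ultimately show ?thesis using QR(3) by simp
    next
      case False
      then have "packing ?y b P" using Suc.prems(2) by (auto intro: packing_mono)
      then show ?thesis using Suc.IH Suc.prems(2) by fastforce
    qed
  qed
  obtain n :: nat where n: "b / (\<delta> / 2) \<le> real n" using real_arch_simple by blast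
  then have "b - real n * (\<delta> / 2) \<le> 0" using \<delta>(1) by (simp add: field_simps)
  then show ?thesis using * packing_mono by blast
qed

lemma
  assumes g: "ac_half_line g"
  shows increments_le_variation: "packing 0 x P \<Longrightarrow> increments g P \<le> variation g x"
    and variation_approx: "0 < \<eta> \<Longrightarrow> \<exists>P. packing 0 x P \<and> variation g x < increments g P + \<eta>"
proof -
  have ne: "{increments g P |P. packing 0 x P} \<noteq> {}" using packing_empty by blast
  have bdd: "bdd_above {increments g P |P. packing 0 x P}"
    using ac_increments_bounded[OF g, of x] unfolding bdd_above_def by blast
  show "increments g P \<le> variation g x" if "packing 0 x P"
    unfolding variation_def using that bdd by (intro cSup_upper) auto
  show "\<exists>P. packing 0 x P \<and> variation g x < increments g P + \<eta>" if "0 < \<eta>"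
  proof -
    have "variation g x - \<eta> < Sup {increments g P |P. packing 0 x P}"
      using that by (simp add: variation_def)
    then obtain P where "packing 0 x P" "variation g x - \<eta> < increments g P"
      using less_cSupD[OF ne] by blast
    then show ?thesis by (auto simp: algebra_simps)
  qed
qed

lemma variation_nonpos:
  assumes "x \<le> 0"
  shows "variation g x = 0"
proof -
  have "increments g P = 0" if "packing 0 x P" for P
  proof -
    have "snd p = fst p" if "p \<in> P" for p
      using \<open>packing 0 x P\<close> that assms by (force simp: packing_def)
    then show ?thesis by (simp add: increments_def)
  qed
  then have "{increments g P |P. packing 0 x P} = {0}" using packing_empty[of 0 x] by (auto simp: increments_def intro!: exI[of _ "{}"])
  then show ?thesis by (simp add: variation_def)
qed

lemma variation_increment_ge:
  assumes g: "ac_half_line g" and xy: "x \<le> y"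
  shows "norm (g y - g x) \<le> variation g y - variation g x"
proof -
  have *: "norm (g y - g x) \<le> variation g y - variation g x" if "0 \<le> x" "x \<le> y" for x y
  proof (rule field_le_epsilon)
    fix \<eta> :: real assume "0 < \<eta>"
    then obtain P where P: "packing 0 x P" "variation g x < increments g P + \<eta>"
      using variation_approx[OF g] by blast
    have Q: "packing x y {(x, y)}" using that by (simp add: packing_single)
    have "increments g P + norm (g y - g x) = increments g (P \<union> {(x, y)})"
      unfolding increments_join(2)[OF P(1) Q that] by (simp add: increments_def)
    also have "\<dots> \<le> variation g y"
      by (rule increments_le_variation[OF g increments_join(1)[OF P(1) Q that]])
    finally show "norm (g y - g x) \<le> variation g y - variation g x + \<eta>" using P(2) by simp
  qed
  have g0: "g t = g 0" if "t \<le> 0" for t using g that unfolding ac_half_line_def by blast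
  consider "0 \<le> x" | "x \<le> 0" "0 \<le> y" | "y \<le> 0" by linarith
  then show ?thesis
  proof cases
    case 2
    then show ?thesis using *[of 0 y] g0[of x] variation_nonpos[of x g] variation_nonpos[of 0 g] by simp
  next
    case 3
    then show ?thesis using xy g0[of x] g0[of y] variation_nonpos[of x g] variation_nonpos[of y g] by simp
  qed (use * xy in auto)
qed

lemma variation_increment_approx:
  assumes g: "ac_half_line g" and xy: "0 \<le> x" "x \<le> y" and \<eta>: "0 < \<eta>"
  shows "\<exists>Q. packing x y Q \<and> variation g y - variation g x < increments g Q + \<eta>"
proof -
  obtain P where P: "packing 0 y P" "variation g y < increments g P + \<eta>"
    using variation_approx[OF g \<eta>] by blast
  obtain Q R where "packing 0 x Q" "packing x y R" "increments g P \<le> increments g Q + increments g R"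
    using increments_split[OF P(1) xy] by blast
  then show ?thesis using P(2) increments_le_variation[OF g, of x Q] by (intro exI[of _ R]) auto
qed

text \<open>Replace each interval of a short packing by a packing of it that almost realises the growth of the
variation there. Together these form a packing that is just as short, to which the absolute
continuity of \<open>g\<close> applies.\<close>
lemma ac_variation:
  assumes g: "ac_half_line g"
  shows "ac_half_line (variation g)"
  unfolding ac_half_line_def
proof (intro conjI allI impI)
  fix x :: real assume "x \<le> 0" then show "variation g x = variation g 0" by (simp add: variation_nonpos)
next
  fix b \<epsilon> :: real assume \<epsilon>: "0 < \<epsilon>"
  then obtain \<delta> where \<delta>: "0 < \<delta>" "\<And>P. packing 0 b P \<Longrightarrow> total_length P < \<delta> \<Longrightarrow> increments g P < \<epsilon> / 2"
    using g unfolding ac_half_line_def by (metis half_gt_zero)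
  show "\<exists>\<delta>>0. \<forall>P. packing 0 b P \<and> total_length P < \<delta> \<longrightarrow> increments (variation g) P < \<epsilon>"
  proof (intro exI[of _ \<delta>] conjI allI impI \<delta>(1), elim conjE)
    fix P assume P: "packing 0 b P" and len: "total_length P < \<delta>"
    define \<eta> where "\<eta> = \<epsilon> / (2 * (real (card P) + 1))"
    have \<eta>: "0 < \<eta>" using \<epsilon> by (simp add: \<eta>_def)
    have rng: "0 \<le> fst p" "fst p \<le> snd p" "snd p \<le> b" if "p \<in> P" for p using P that by (auto simp: packing_def)
    have "\<exists>Q. packing (fst p) (snd p) Q \<and> variation g (snd p) - variation g (fst p) < increments g Q + \<eta>" if "p \<in> P" for p
      using rng[OF that] by (intro variation_increment_approx g \<eta>)
    then obtain Q where Q: "\<And>p. p \<in> P \<Longrightarrow> packing (fst p) (snd p) (Q p)"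
      "\<And>p. p \<in> P \<Longrightarrow> variation g (snd p) - variation g (fst p) < increments g (Q p) + \<eta>"
      by metis
    \<comment> \<open>without the degenerate intervals the packings of different \<open>p\<close> are disjoint as sets\<close>
    define R where "R p = {q \<in> Q p. fst q < snd q}" for p
    have Rinc: "increments g (R p) = increments g (Q p)" if "p \<in> P" for p
      unfolding increments_def R_def using Q(1)[OF that]
      by (intro sum.mono_neutral_left) (auto simp: packing_def order_class.less_le)
    have R: "packing (fst p) (snd p) (R p)" if "p \<in> P" for p
      by (rule packing_subset[OF Q(1)[OF that]]) (auto simp: R_def)
    have sub: "{fst q<..<snd q} \<subseteq> {fst p<..<snd p}" "{fst q<..<snd q} \<noteq> {}" if "p \<in> P" "q \<in> R p" for p q
    proof -
      have "fst p \<le> fst q" "snd q \<le> snd p" using R[OF that(1)] that(2) by (auto simp: packing_def)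
      then show "{fst q<..<snd q} \<subseteq> {fst p<..<snd p}" by auto
      show "{fst q<..<snd q} \<noteq> {}" using that(2) by (auto simp: R_def)
    qed
    have disjP: "disjnt {fst p<..<snd p} {fst q<..<snd q}" if "p \<in> P" "q \<in> P" "p \<noteq> q" for p q
      using P that by (auto simp: packing_def pairwise_def)
    have disjR: "R p \<inter> R p' = {}" if pp: "p \<in> P" "p' \<in> P" "p \<noteq> p'" for p p'
    proof (rule ccontr)
      assume "R p \<inter> R p' \<noteq> {}"
      then obtain q where "q \<in> R p" "q \<in> R p'" by blast
      then show False using sub[of p q] sub[of p' q] disjP[OF pp] pp unfolding disjnt_def by blast
    qed
    have finR: "finite P" "\<And>p. p \<in> P \<Longrightarrow> finite (R p)" using P R by (auto simp: packing_def)
    have pack: "packing 0 b (\<Union>p\<in>P. R p)"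
      unfolding packing_def
    proof (intro conjI ballI)
      show "finite (\<Union>p\<in>P. R p)" using finR by blast
      show "pairwise (\<lambda>p q. disjnt {fst p<..<snd p} {fst q<..<snd q}) (\<Union>p\<in>P. R p)"
      proof (rule pairwiseI)
        fix q q' assume "q \<in> (\<Union>p\<in>P. R p)" "q' \<in> (\<Union>p\<in>P. R p)" and ne: "q \<noteq> q'"
        then obtain p p' where p: "p \<in> P" "q \<in> R p" "p' \<in> P" "q' \<in> R p'" by blast
        show "disjnt {fst q<..<snd q} {fst q'<..<snd q'}"
        proof (cases "p = p'")
          case True
          then show ?thesis using R[OF p(1)] p ne by (auto simp: packing_def pairwise_def)
        next
          case False
          then show ?thesis using disjP[OF p(1,3)] sub(1)[OF p(1,2)] sub(1)[OF p(3,4)]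
            by (meson disjnt_subset1 disjnt_subset2)
        qed
      qed
      fix q assume "q \<in> (\<Union>p\<in>P. R p)"
      then obtain p where p: "p \<in> P" "q \<in> R p" by blast
      then show "0 \<le> fst q" "fst q \<le> snd q" "snd q \<le> b"
        using rng[OF p(1)] R[OF p(1)] unfolding packing_def by force+
    qed
    have "total_length (\<Union>p\<in>P. R p) = (\<Sum>p\<in>P. total_length (R p))"
      unfolding total_length_def using finR disjR by (intro sum.UNION_disjoint) auto
    also have "\<dots> \<le> (\<Sum>p\<in>P. snd p - fst p)"
      by (intro sum_mono packing_total_length_le R rng)
    also have "\<dots> < \<delta>" using len by (simp add: total_length_def)
    finally have "increments g (\<Union>p\<in>P. R p) < \<epsilon> / 2" by (rule \<delta>(2)[OF pack])
    also have "increments g (\<Union>p\<in>P. R p) = (\<Sum>p\<in>P. increments g (R p))"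
      unfolding increments_def using finR disjR by (intro sum.UNION_disjoint) auto
    finally have "(\<Sum>p\<in>P. increments g (Q p)) < \<epsilon> / 2" using Rinc by simp
    moreover have "increments (variation g) P \<le> (\<Sum>p\<in>P. increments g (Q p) + \<eta>)"
      unfolding increments_def[of "variation g"]
    proof (rule sum_mono)
      fix p assume p: "p \<in> P"
      have "0 \<le> variation g (snd p) - variation g (fst p)"
        using variation_increment_ge[OF g rng(2)[OF p]] norm_ge_zero order_trans by blast
      then show "norm (variation g (snd p) - variation g (fst p)) \<le> increments g (Q p) + \<eta>"
        using Q(2)[OF p] by simp
    qed
    moreover have "(\<Sum>p\<in>P. increments g (Q p) + \<eta>) = (\<Sum>p\<in>P. increments g (Q p)) + real (card P) * \<eta>"
      by (simp add: sum.distrib)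
    moreover have "real (card P) * \<eta> < \<epsilon> / 2" using \<epsilon> by (simp add: \<eta>_def field_simps)
    ultimately show "increments (variation g) P < \<epsilon>" by linarith
  qed
qed


lemma ac_isCont:
  assumes g: "ac_half_line g"
  shows "isCont g x"
  unfolding continuous_at_eps_delta
proof (intro allI impI)
  fix e :: real assume "0 < e"
  then obtain \<delta> where \<delta>: "0 < \<delta>" "\<And>P. packing 0 (\<bar>x\<bar> + 1) P \<Longrightarrow> total_length P < \<delta> \<Longrightarrow> increments g P < e"
    using g unfolding ac_half_line_def by metis
  have g0: "g t = g (max 0 t)" for t
  proof (cases "t \<le> 0")
    case True
    then have "g t = g 0" using g unfolding ac_half_line_def by blast
    then show ?thesis using True by (simp add: max_def)
  qed (simp add: max_def)
  show "\<exists>d>0. \<forall>y. dist y x < d \<longrightarrow> dist (g y) (g x) < e"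
  proof (intro exI[of _ "min \<delta> 1"] conjI allI impI)
    show "0 < min \<delta> 1" using \<delta>(1) by simp
    fix y assume "dist y x < min \<delta> 1"
    then have d: "\<bar>y - x\<bar> < \<delta>" "\<bar>y - x\<bar> < 1" by (auto simp: dist_real_def)
    define u v where "u = max 0 (min x y)" and "v = max 0 (max x y)"
    have uv: "0 \<le> u" "u \<le> v" "v \<le> \<bar>x\<bar> + 1" "v - u \<le> \<bar>y - x\<bar>" using d by (auto simp: u_def v_def)
    have "increments g {(u, v)} < e"
      by (rule \<delta>(2)) (use uv d in \<open>auto simp: packing_single total_length_def\<close>)
    moreover have "increments g {(u, v)} = dist (g y) (g x)"
    proof -
      have "dist (g y) (g x) = dist (g (max 0 y)) (g (max 0 x))" using g0 by metis
      then show ?thesis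
        by (cases "x \<le> y") (simp_all add: increments_def u_def v_def dist_norm norm_minus_commute)
    qed
    ultimately show "dist (g y) (g x) < e" by simp
  qed
qed

lemma emeasure_Union_bound:
  assumes "countable D" "\<And>K. K \<in> D \<Longrightarrow> K \<in> sets M"
    and "\<And>E. finite E \<Longrightarrow> E \<subseteq> D \<Longrightarrow> emeasure M (\<Union>E) \<le> e"
  shows "emeasure M (\<Union>D) \<le> e"
proof (cases "D = {}")
  case False
  let ?K = "from_nat_into D"
  have K: "range ?K = D" by (rule range_from_nat_into[OF False assms(1)])
  have "emeasure M (\<Union>n. \<Union>i<n. ?K i) = (SUP n. emeasure M (\<Union>i<n. ?K i))"
  proof (rule SUP_emeasure_incseq[symmetric])
    show "range (\<lambda>n. \<Union>i<n. ?K i) \<subseteq> sets M"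
      using assms(2) from_nat_into[OF False] by (auto intro!: sets.finite_UN)
    show "incseq (\<lambda>n. \<Union>i<n. ?K i)" unfolding incseq_def by (intro allI impI UN_mono) auto
  qed
  also have "(\<Union>n. \<Union>i<n. ?K i) = (\<Union>i. ?K i)" by (blast intro: lessI)
  also have "\<dots> = \<Union>D" using K by simp
  also have "(SUP n. emeasure M (\<Union>i<n. ?K i)) \<le> e"
    using from_nat_into[OF False] by (intro SUP_least assms(3)) auto
  finally show ?thesis .
qed (use assms(3)[of "{}"] in simp)

text \<open>A null set is covered by nonoverlapping closed intervals of small total length. The measure of each is
an increment of \<open>F\<close>, so absolute continuity makes the measure of the cover small.\<close>
lemma ac_mono_null_sets:
  assumes F: "ac_half_line F" "mono (F :: real \<Rightarrow> real)" and N: "N \<in> null_sets lborel"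
  shows "emeasure (interval_measure F) N = 0"
proof -
  let ?M = "interval_measure F"
  have cont: "continuous (at_right a) F" for a
    using ac_isCont[OF F(1), of a] by (rule continuous_at_imp_continuous_at_within)
  have contU: "continuous_on UNIV F" using ac_isCont[OF F(1)] by (simp add: continuous_at_imp_continuous_on)
  have Icc: "emeasure ?M {a..b} = ennreal (F b - F a)" if "a \<le> b" for a b
    using that monoD[OF F(2)] contU by (intro emeasure_interval_measure_Icc) auto
  have Nb: "N \<in> sets borel" using N by auto
  have pieces: "emeasure ?M (N \<inter> {0..real n}) = 0" for n
  proof (rule ccontr)
    assume "emeasure ?M (N \<inter> {0..real n}) \<noteq> 0"
    moreover have "emeasure ?M (N \<inter> {0..real n}) \<le> ennreal \<epsilon>" if \<epsilon>: "0 < \<epsilon>" for \<epsilon> :: real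
    proof -
      obtain \<delta> where \<delta>: "0 < \<delta>" "\<And>P. packing 0 (real n) P \<Longrightarrow> total_length P < \<delta> \<Longrightarrow> increments F P < \<epsilon>"
        using F(1) \<epsilon> unfolding ac_half_line_def by metis
      have null: "N \<inter> {0..real n} \<in> null_sets lebesgue"
        by (rule null_sets_completion_subset[of _ N]) (use N null_sets_completionI in auto)
      then have neg: "negligible (N \<inter> {0..real n})" by (simp add: negligible_iff_null_sets)
      have lm: "N \<inter> {0..real n} \<in> lmeasurable" using neg by (rule negligible_imp_measurable)
      have box: "N \<inter> {0..real n} \<subseteq> cbox 0 (real n)" "0 < \<delta> / 2" using \<delta>(1) by auto
      obtain D where D: "countable D" and Dbox: "\<And>K. K \<in> D \<Longrightarrow> K \<subseteq> cbox 0 (real n) \<and> K \<noteq> {} \<and> (\<exists>c d. K = cbox c d)"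
        and Dint: "pairwise (\<lambda>A B. interior A \<inter> interior B = {}) D"
        and cov: "N \<inter> {0..real n} \<subseteq> \<Union>D" and Dm: "\<Union>D \<in> lmeasurable"
        and small: "measure lebesgue (\<Union>D) \<le> measure lebesgue (N \<inter> {0..real n}) + \<delta> / 2"
        by (rule measurable_outer_intervals_bounded[OF lm box]) (rule that; assumption)
      have K: "K = {Inf K..Sup K}" "Inf K \<le> Sup K" "0 \<le> Inf K" "Sup K \<le> real n" if KD: "K \<in> D" for K
      proof -
        obtain c d where "K = {c..d}" "c \<le> d" "K \<subseteq> {0..real n}" using Dbox[OF KD] by (auto simp: cbox_interval)
        then show "K = {Inf K..Sup K}" "Inf K \<le> Sup K" "0 \<le> Inf K" "Sup K \<le> real n" by auto
      qed
      have Dsets: "K \<in> sets ?M" if "K \<in> D" for K using Dbox[OF that] by auto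
      have "emeasure ?M (N \<inter> {0..real n}) \<le> emeasure ?M (\<Union>D)"
        using D Dsets by (intro emeasure_mono cov sets.countable_Union subsetI)
      also have "\<dots> \<le> ennreal \<epsilon>"
      proof (rule emeasure_Union_bound[OF D])
        show "K \<in> sets ?M" if "K \<in> D" for K using that by (rule Dsets)
        fix E assume E: "finite E" "E \<subseteq> D"
        define P where "P = (\<lambda>K. (Inf K, Sup K)) ` E"
        have inj: "inj_on (\<lambda>K. (Inf K, Sup K)) E"
          by (rule inj_onI) (metis E(2) K(1) prod.inject subsetD)
        have pack: "packing 0 (real n) P"
          unfolding packing_def
        proof (intro conjI)
          show "finite P" using E by (simp add: P_def)
          show "\<forall>p\<in>P. 0 \<le> fst p \<and> fst p \<le> snd p \<and> snd p \<le> real n" using E K by (auto simp: P_def)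
          have int: "interior K = {Inf K<..<Sup K}" if "K \<in> D" for K
            by (subst K(1)[OF that]) simp
          show "pairwise (\<lambda>p q. disjnt {fst p<..<snd p} {fst q<..<snd q}) P"
            unfolding P_def pairwise_image
          proof (rule pairwiseI, rule impI)
            fix A B assume AB: "A \<in> E" "B \<in> E" "A \<noteq> B"
            then have AD: "A \<in> D" "B \<in> D" using E by auto
            have "interior A \<inter> interior B = {}" using Dint AD AB unfolding pairwise_def by blast
            then show "disjnt {fst (Inf A, Sup A)<..<snd (Inf A, Sup A)} {fst (Inf B, Sup B)<..<snd (Inf B, Sup B)}"
              unfolding int[OF AD(1)] int[OF AD(2)] disjnt_def fst_conv snd_conv .
          qed
        qed
        have "total_length P = measure lborel (\<Union>p\<in>P. {fst p<..<snd p})" by (rule packing_total_length[OF pack])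
        also have "\<dots> = measure lebesgue (\<Union>p\<in>P. {fst p<..<snd p})"
          using E by (intro measure_completion[symmetric]) (auto intro!: sets.finite_UN simp: P_def)
        also have "\<dots> \<le> measure lebesgue (\<Union>D)"
        proof (rule measure_mono_fmeasurable[OF _ _ Dm])
          show "(\<Union>p\<in>P. {fst p<..<snd p}) \<subseteq> \<Union>D"
          proof clarify
            fix x p assume p: "p \<in> P" "x \<in> {fst p<..<snd p}"
            then obtain A where A: "A \<in> E" "p = (Inf A, Sup A)" by (auto simp: P_def)
            have "x \<in> {Inf A..Sup A}" using p A by auto
            then show "x \<in> \<Union>D" using K(1)[of A] A E by blast
          qed
        qed (use E in \<open>auto intro!: sets.finite_UN simp: P_def\<close>)
        also have "\<dots> < \<delta>" using small negligible_imp_measure0[OF neg] \<delta>(1) by simp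
        finally have inc: "increments F P < \<epsilon>" by (rule \<delta>(2)[OF pack])
        have "emeasure ?M (\<Union>E) \<le> (\<Sum>K\<in>E. emeasure ?M K)"
          using E Dbox emeasure_subadditive_finite[of E "\<lambda>K. K" ?M] by fastforce
        also have "\<dots> = (\<Sum>K\<in>E. ennreal (F (Sup K) - F (Inf K)))"
        proof (rule sum.cong[OF refl])
          fix A assume "A \<in> E"
          then have A: "A \<in> D" using E by auto
          show "emeasure ?M A = ennreal (F (Sup A) - F (Inf A))"
            using Icc[OF K(2)[OF A]] K(1)[OF A] by simp
        qed
        also have "\<dots> = ennreal (\<Sum>K\<in>E. F (Sup K) - F (Inf K))"
          using E K(2) by (intro sum_ennreal) (auto intro!: monoD[OF F(2)])
        also have "(\<Sum>K\<in>E. F (Sup K) - F (Inf K)) \<le> increments F P"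
          unfolding increments_def P_def by (subst sum.reindex[OF inj]) (auto intro: sum_mono)
        finally show "emeasure ?M (\<Union>E) \<le> ennreal \<epsilon>"
          using inc by (meson ennreal_leI less_imp_le order_trans)
      qed
      finally show ?thesis .
    qed
    moreover have "emeasure ?M (N \<inter> {0..real n}) \<le> 0"
      by (rule ennreal_le_epsilon) (use calculation(2) in simp)
    ultimately show False by simp
  qed
  have neg: "emeasure ?M {- real n..0} = 0" for n
  proof -
    have "- real n \<le> 0" by simp
    then have "F (- real n) = F 0" using F(1) unfolding ac_half_line_def by blast
    then show ?thesis using Icc[of "- real n" 0] by simp
  qed
  have "N \<subseteq> (\<Union>n. N \<inter> {0..real n}) \<union> (\<Union>n. {- real n..0})"
  proof
    fix x assume "x \<in> N"
    obtain n :: nat where "\<bar>x\<bar> \<le> real n" using real_arch_simple by blast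
    then show "x \<in> (\<Union>n. N \<inter> {0..real n}) \<union> (\<Union>n. {- real n..0})"
      using \<open>x \<in> N\<close> by (cases "0 \<le> x") (auto intro!: exI[of _ n])
  qed
  moreover have "(\<Union>n. N \<inter> {0..real n}) \<union> (\<Union>n. {- real n..0}) \<in> null_sets ?M"
    using pieces neg Nb by (intro null_sets.Un null_sets_UN) (auto intro!: null_setsI)
  ultimately have "N \<in> null_sets ?M"
    by (intro null_sets_subset[of "(\<Union>n. N \<inter> {0..real n}) \<union> (\<Union>n. {- real n..0})" ?M N]) (use Nb in simp_all)
  then show ?thesis by auto
qed


lemma ac_mono_density:
  assumes F: "ac_half_line F" "mono (F :: real \<Rightarrow> real)" and F0: "F 0 = 0"
  obtains w where "w \<in> borel_measurable borel" "\<And>t. 0 \<le> (w t :: real)" "\<And>t. t \<le> 0 \<Longrightarrow> w t = 0"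
    "\<And>x. nconv (modulus heaviside) (\<lambda>t. ennreal (w t)) x = ennreal (F x)"
proof -
  let ?M = "interval_measure F"
  have cont: "continuous (at_right a) F" for a
    using ac_isCont[OF F(1), of a] by (rule continuous_at_imp_continuous_at_within)
  have Fle: "F x = 0" if "x \<le> 0" for x using F(1) that F0 unfolding ac_half_line_def by metis
  have Ioc: "emeasure ?M {a<..b} = ennreal (F b - F a)" if "a \<le> b" for a b
    using that monoD[OF F(2)] cont by (intro emeasure_interval_measure_Ioc) auto
  have "absolutely_continuous lborel ?M"
    unfolding absolutely_continuous_def using ac_mono_null_sets[OF F]
    by (auto intro!: null_setsI)
  then obtain f where f[measurable]: "f \<in> borel_measurable borel" and dens: "density lborel f = ?M"
    using sigma_finite_measure.Radon_Nikodym[OF lborel.sigma_finite_measure_axioms, of ?M] by auto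
  have f_Ioc: "(\<integral>\<^sup>+t. f t * indicator {a<..b} t \<partial>lborel) = ennreal (F b - F a)" if "a \<le> b" for a b
    using Ioc[OF that] unfolding dens[symmetric] by (subst (asm) emeasure_density) auto
  have fin: "AE t in lborel. f t \<noteq> \<infinity>"
  proof -
    have "AE t in lborel. \<forall>n::nat. f t * indicator {- real n<..real n} t \<noteq> \<infinity>"
      unfolding AE_all_countable
      by (intro allI nn_integral_PInf_AE) (simp_all add: f_Ioc)
    then show ?thesis
    proof eventually_elim
      case (elim t)
      obtain n :: nat where "\<bar>t\<bar> < real n" using reals_Archimedean2 by blast
      then have "t \<in> {- real n<..real n}" by auto
      then show ?case using elim[rule_format, of n] by simp
    qed
  qed
  define w where "w t = (if 0 < t then enn2real (f t) else 0)" for t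
  have w[measurable]: "w \<in> borel_measurable borel" unfolding w_def[abs_def] by measurable
  show ?thesis
  proof (rule that[OF w])
    show "0 \<le> w t" for t by (simp add: w_def)
    show "w t = 0" if "t \<le> 0" for t using that by (simp add: w_def)
    fix x
    have "nconv (modulus heaviside) (\<lambda>t. ennreal (w t)) x = (\<integral>\<^sup>+t. f t * indicator {0<..max 0 x} t \<partial>lborel)"
      unfolding heaviside_nconv_eq
    proof (rule nn_integral_cong_AE)
      show "AE t in lborel. indicator {..<x} t * ennreal (w t) = f t * indicator {0<..max 0 x} t"
        using fin AE_lborel_singleton[of x]
        by eventually_elim (auto simp: w_def less_top split: split_indicator)
    qed
    also have "\<dots> = ennreal (F (max 0 x) - F 0)" by (rule f_Ioc) simp
    also have "\<dots> = ennreal (F x)" using Fle[of x] F0 by (cases "x \<le> 0") (auto simp: max_def)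
    finally show "nconv (modulus heaviside) (\<lambda>t. ennreal (w t)) x = ennreal (F x)" .
  qed
qed

lemma ac_mono_primitive:
  assumes F: "ac_half_line F" "mono (F :: real \<Rightarrow> real)" and F0: "F 0 = 0"
  obtains h where "loc_int h" "\<And>x. conv heaviside h x = complex_of_real (F x)"
proof -
  obtain w where w[measurable]: "w \<in> borel_measurable borel" and w0: "\<And>t. 0 \<le> (w t :: real)" "\<And>t. t \<le> 0 \<Longrightarrow> w t = 0"
    and I: "\<And>x. nconv (modulus heaviside) (\<lambda>t. ennreal (w t)) x = ennreal (F x)"
    using ac_mono_density[OF assms] by metis
  let ?h = "\<lambda>t. complex_of_real (w t)"
  have mod: "modulus ?h = (\<lambda>t. ennreal (w t))" using w0 by (auto simp: modulus_def)
  have Fnn: "0 \<le> F x" for x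
  proof (cases "x \<le> 0")
    case True
    then have "F x = F 0" using F(1) unfolding ac_half_line_def by blast
    then show ?thesis using F0 by simp
  qed (use monoD[OF F(2), of 0 x] F0 in auto)
  show ?thesis
  proof (rule that[of ?h])
    show "loc_int ?h" unfolding loc_int_def mod I using w0 by auto
    fix x
    have "(LINT t|lborel. indicator {..<x} t * w t) = F x"
    proof (rule integral_eq_nn_integral[THEN trans])
      have "(\<integral>\<^sup>+t. ennreal (indicator {..<x} t * w t) \<partial>lborel) = ennreal (F x)"
        unfolding I[symmetric] heaviside_nconv_eq by (intro nn_integral_cong) (auto split: split_indicator)
      then show "enn2real (\<integral>\<^sup>+t. ennreal (indicator {..<x} t * w t) \<partial>lborel) = F x" using Fnn by simp
    qed (use w0 in auto)
    moreover have "conv heaviside ?h x = (LINT t|lborel. complex_of_real (indicator {..<x} t * w t))"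
      unfolding conv_def heaviside_def by (intro Bochner_Integration.integral_cong) (auto split: split_indicator)
    ultimately show "conv heaviside ?h x = complex_of_real (F x)" unfolding integral_complex_of_real by simp
  qed
qed

lemma ac_half_line_add:
  assumes f: "ac_half_line f" and g: "ac_half_line g"
    and le: "\<And>x y. x \<le> y \<Longrightarrow> norm (h y - h x) \<le> norm (f y - f x) + norm (g y - g x)"
  shows "ac_half_line h"
  unfolding ac_half_line_def
proof (intro conjI allI impI)
  fix x :: real assume x: "x \<le> 0"
  then have "f x = f 0" "g x = g 0" using f g unfolding ac_half_line_def by blast+
  then show "h x = h 0" using le[OF x] by simp
next
  fix b \<epsilon> :: real assume "0 < \<epsilon>"
  then have e: "0 < \<epsilon> / 2" by simp
  obtain \<delta> where \<delta>: "0 < \<delta>" "\<And>P. packing 0 b P \<Longrightarrow> total_length P < \<delta> \<Longrightarrow> increments f P < \<epsilon> / 2"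
    using f e unfolding ac_half_line_def by metis
  obtain \<delta>' where \<delta>': "0 < \<delta>'" "\<And>P. packing 0 b P \<Longrightarrow> total_length P < \<delta>' \<Longrightarrow> increments g P < \<epsilon> / 2"
    using g e unfolding ac_half_line_def by metis
  have m: "0 < min \<delta> \<delta>'" using \<delta> \<delta>' by simp
  show "\<exists>\<delta>>0. \<forall>P. packing 0 b P \<and> total_length P < \<delta> \<longrightarrow> increments h P < \<epsilon>"
  proof (intro exI[of _ "min \<delta> \<delta>'"] conjI allI impI m, elim conjE)
    fix P assume P: "packing 0 b P" "total_length P < min \<delta> \<delta>'"
    have "increments h P \<le> increments f P + increments g P"
      unfolding increments_def sum.distrib[symmetric]
      using P by (intro sum_mono le) (auto simp: packing_def)
    also have "\<dots> < \<epsilon>" using \<delta>(2)[OF P(1)] \<delta>'(2)[OF P(1)] P(2) by simp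
    finally show "increments h P < \<epsilon>" .
  qed
qed

text \<open>The variation \<open>V\<close> increases at least as fast as the real and the imaginary part of \<open>g\<close>, so \<open>V\<close>,
\<open>V + Re g\<close> and \<open>V + Im g\<close> are increasing and absolutely continuous, and each of them has a density by
the Radon-Nikodym theorem. The density of \<open>g\<close> is a combination of these.\<close>
theorem ac_half_line_primitive:
  fixes g :: "real \<Rightarrow> complex"
  assumes g: "ac_half_line g"
  obtains h where "loc_int h" "\<And>x. g x = g 0 + conv heaviside h x"
proof -
  let ?V = "variation g"
  have part: "\<exists>h. loc_int h \<and> (\<forall>x. conv heaviside h x = complex_of_real (?V x + (\<phi> (g x) - \<phi> (g 0))))"
    if \<phi>: "\<And>u v. \<bar>\<phi> u - \<phi> v\<bar> \<le> norm (u - v)" for \<phi> :: "complex \<Rightarrow> real"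
  proof -
    let ?F = "\<lambda>x. ?V x + (\<phi> (g x) - \<phi> (g 0))"
    have "ac_half_line ?F"
    proof (rule ac_half_line_add[OF ac_variation[OF g] g])
      show "norm (?F y - ?F x) \<le> norm (?V y - ?V x) + norm (g y - g x)" for x y
        using \<phi>[of "g y" "g x"] by simp
    qed
    moreover have "mono ?F"
    proof (rule monoI)
      fix x y :: real assume "x \<le> y"
      from variation_increment_ge[OF g this] \<phi>[of "g y" "g x"] show "?F x \<le> ?F y" by simp
    qed
    ultimately show ?thesis
      using variation_nonpos[of 0 g] by (metis (no_types, lifting) ac_mono_primitive add_0 diff_self order_refl)
  qed
  obtain hV where hV: "loc_int hV" "\<And>x. conv heaviside hV x = complex_of_real (?V x)"
    using part[of "\<lambda>_. 0"] by auto
  obtain hR where hR: "loc_int hR" "\<And>x. conv heaviside hR x = complex_of_real (?V x + (Re (g x) - Re (g 0)))"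
    using part[of Re] by (metis abs_Re_le_cmod minus_complex.sel(1))
  obtain hI where hI: "loc_int hI" "\<And>x. conv heaviside hI x = complex_of_real (?V x + (Im (g x) - Im (g 0)))"
    using part[of Im] by (metis abs_Im_le_cmod minus_complex.sel(2))
  let ?u = "\<lambda>t. hR t + (- 1) * hV t" and ?v = "\<lambda>t. hI t + (- 1) * hV t"
  have u: "loc_int ?u" and v: "loc_int ?v" by (intro loc_int_add loc_int_cmult hR hV hI)+
  let ?h = "\<lambda>t. ?u t + \<i> * ?v t"
  have h: "loc_int ?h" by (intro loc_int_add[OF u] loc_int_cmult[OF v])
  have add: "conv heaviside (\<lambda>t. p t + c * q t) x = conv heaviside p x + c * conv heaviside q x"
    if "loc_int p" "loc_int q" for p q c x
    using that loc_int_finite[OF that(1), of x] loc_int_finite[OF loc_int_cmult[OF that(2)], of c x]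
    by (subst conv_add_right) (auto simp: conv_cmult_right dest: loc_int_measurable)
  show ?thesis
  proof (rule that[OF h])
    fix x
    have "conv heaviside ?h x = complex_of_real (Re (g x) - Re (g 0)) + \<i> * complex_of_real (Im (g x) - Im (g 0))"
      unfolding add[OF u v] add[OF hR(1) hV(1)] add[OF hI(1) hV(1)] hR(2) hI(2) hV(2) by simp
    also have "\<dots> = g x - g 0" by (simp add: complex_eq_iff)
    finally show "g x = g 0 + conv heaviside ?h x" by simp
  qed
qed

section \<open>The fundamental theorem of calculus on the half line\<close>

lemma loc_int_set_integrable:
  assumes h: "loc_int h"
  shows "set_integrable lborel {..<b} h" "set_integrable lborel {0..b} h"
proof -
  note [measurable] = loc_int_measurable[OF h]
  have *: "set_integrable lborel {..<b} h" for b
    unfolding set_integrable_def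
  proof (rule integrableI_bounded)
    have "(\<integral>\<^sup>+t. ennreal (norm (indicator {..<b} t *\<^sub>R h t)) \<partial>lborel) = nconv (modulus heaviside) (modulus h) b"
      unfolding heaviside_nconv_eq by (intro nn_integral_cong) (auto simp: modulus_def split: split_indicator)
    then show "(\<integral>\<^sup>+t. ennreal (norm (indicator {..<b} t *\<^sub>R h t)) \<partial>lborel) < \<infinity>"
      using loc_int_finite[OF h, of b] by simp
  qed auto
  show "set_integrable lborel {..<b} h" by (rule *)
  show "set_integrable lborel {0..b} h" by (rule set_integrable_subset[OF *[of "b + 1"]]) auto
qed

lemma conv_heaviside_eq: "conv heaviside h x = (LINT t:{..<x}|lborel. h t)"
  unfolding conv_def set_lebesgue_integral_def heaviside_def
  by (intro Bochner_Integration.integral_cong) (auto split: split_indicator)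

lemma conv_heaviside_diff:
  assumes h: "loc_int h" and uv: "u \<le> v"
  shows "conv heaviside h v - conv heaviside h u = (LINT t:{u..<v}|lborel. h t)"
proof -
  have "(LINT t:{..<u} \<union> {u..<v}|lborel. h t) = (LINT t:{..<u}|lborel. h t) + (LINT t:{u..<v}|lborel. h t)"
    by (rule set_integral_Un) (auto intro: loc_int_set_integrable[OF h] set_integrable_subset[OF loc_int_set_integrable(1)[OF h, of v]])
  moreover have "{..<u} \<union> {u..<v} = {..<v}" using uv by auto
  ultimately show ?thesis by (simp add: conv_heaviside_eq)
qed

lemma conv_heaviside_integral:
  assumes h: "loc_int h" and x: "0 \<le> x"
  shows "conv heaviside h x = integral {0..x} h"
proof -
  note [measurable] = loc_int_measurable[OF h]
  have "conv heaviside h x = (LINT t:{0..x}|lborel. h t)"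
    unfolding conv_heaviside_eq set_lebesgue_integral_def
  proof (rule integral_cong_AE)
    show "AE t in lborel. indicat_real {..<x} t *\<^sub>R h t = indicat_real {0..x} t *\<^sub>R h t"
      using AE_lborel_singleton[of x] by eventually_elim (auto simp: loc_int_nonpos[OF h] split: split_indicator)
  qed auto
  also have "\<dots> = integral {0..x} h"
    by (rule set_borel_integral_eq_integral(2)[OF loc_int_set_integrable(2)[OF h]])
  finally show ?thesis .
qed

lemma loc_int_derivative_AE:
  assumes h: "loc_int h"
  shows "AE x in lborel. 0 < x \<longrightarrow> (conv heaviside h has_vector_derivative h x) (at x)"
proof -
  have "AE x in lborel. \<forall>n::nat. 0 < x \<and> x < real n \<longrightarrow> (conv heaviside h has_vector_derivative h x) (at x)"
    unfolding AE_all_countable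
  proof
    fix n :: nat
    have "h integrable_on {0..real n}"
      by (rule set_borel_integral_eq_integral(1)[OF loc_int_set_integrable(2)[OF h]])
    from integral_derivative_AE[OF this]
    have "AE x in lebesgue. x \<notin> {x \<in> {0<..<real n}. \<not> ((\<lambda>u. integral {0..u} h) has_vector_derivative h x) (at x)}"
      unfolding negligible_iff_null_sets by (rule AE_not_in)
    then have "AE x in lebesgue. 0 < x \<and> x < real n \<longrightarrow> (conv heaviside h has_vector_derivative h x) (at x)"
    proof eventually_elim
      case (elim x)
      show ?case
      proof
        assume x: "0 < x \<and> x < real n"
        then have "((\<lambda>u. integral {0..u} h) has_vector_derivative h x) (at x)" using elim by auto
        then show "(conv heaviside h has_vector_derivative h x) (at x)"
          by (rule has_vector_derivative_transform_within_open[of _ _ _ "{0<..}"])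
             (use x conv_heaviside_integral[OF h] in auto)
      qed
    qed
    then show "AE x in lborel. 0 < x \<and> x < real n \<longrightarrow> (conv heaviside h has_vector_derivative h x) (at x)"
      by (simp only: AE_completion_iff)
  qed
  then show ?thesis
  proof eventually_elim
    case (elim x)
    obtain n :: nat where "x < real n" using reals_Archimedean2 by blast
    then show ?case using elim by blast
  qed
qed

text \<open>Uniform absolute continuity of the integral: cut \<open>\<bar>h\<bar>\<close> at a height \<open>m\<close> such that the part above \<open>m\<close> has
integral less than \<open>e / 2\<close>; the part below contributes at most \<open>m\<close> times the total length.\<close>
lemma abs_continuous_conv_heaviside:
  assumes h: "loc_int h"
  shows "abs_continuous_on {..b} (conv heaviside h)"
  unfolding abs_continuous_on_def
proof (intro allI impI)
  fix e :: real assume e: "0 < e"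
  note [measurable] = loc_int_measurable[OF h]
  define r where "r t = indicator {..<b} t * norm (h t)" for t
  define v where "v n t = r t - min (r t) (real n)" for n :: nat and t
  have r0: "0 \<le> r t" for t by (simp add: r_def)
  have v0: "0 \<le> v n t" "v n t \<le> r t" for n t using r0[of t] by (auto simp: v_def)
  have rint: "integrable lborel r"
    using integrable_norm[OF loc_int_set_integrable(1)[OF h, of b, unfolded set_integrable_def]]
    by (simp add: r_def[abs_def])
  have rm[measurable]: "r \<in> borel_measurable borel" and vm[measurable]: "v n \<in> borel_measurable borel" for n
    unfolding v_def[abs_def] r_def[abs_def] by measurable
  have vint: "integrable lborel (v n)" for n
    by (rule Bochner_Integration.integrable_bound[OF rint]) (use v0 r0 in \<open>auto simp: abs_of_nonneg\<close>)
  have "(\<lambda>n. LINT t|lborel. v n t) \<longlonglongrightarrow> (LINT (t::real)|lborel. (0::real))"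
  proof (rule integral_dominated_convergence[where w = r and f = "\<lambda>_. 0" and s = v])
    show "AE t in lborel. (\<lambda>n. v n t) \<longlonglongrightarrow> 0"
    proof (rule AE_I2)
      fix t
      obtain N :: nat where "r t \<le> real N" using real_arch_simple by blast
      then have "v n t = 0" if "N \<le> n" for n using that by (simp add: v_def)
      then show "(\<lambda>n. v n t) \<longlonglongrightarrow> 0"
        by (intro tendsto_eventually) (auto simp: eventually_sequentially)
    qed
  qed (use rint v0 in auto)
  then have "(\<lambda>n. LINT t|lborel. v n t) \<longlonglongrightarrow> 0" by simp
  from order_tendstoD(2)[OF this, of "e / 2"] e
  obtain m where m: "(LINT t|lborel. v m t) < e / 2" by (auto simp: eventually_sequentially)
  show "\<exists>\<delta>>0. \<forall>n a c. (\<forall>i<(n::nat). a i \<le> c i \<and> {a i..c i} \<subseteq> {..b}) \<and>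
      disjoint_family_on (\<lambda>i. {a i<..<c i}) {..<n} \<and> (\<Sum>i<n. c i - a i) < \<delta> \<longrightarrow>
      (\<Sum>i<n. norm (conv heaviside h (c i) - conv heaviside h (a i))) < e"
  proof (intro exI[of _ "e / (2 * (real m + 1))"] conjI allI impI, goal_cases)
    case 1 show ?case using e by simp
  next
    case (2 n a c)
    then have ac: "\<forall>i<n. a i \<le> c i \<and> c i \<le> b" and dis: "disjoint_family_on (\<lambda>i. {a i<..<c i}) {..<n}"
      and len: "(\<Sum>i<n. c i - a i) < e / (2 * (real m + 1))"
      by auto
    have one: "norm (conv heaviside h (c i) - conv heaviside h (a i))
        \<le> (LINT t|lborel. indicator {a i<..<c i} t * v m t) + real m * (c i - a i)" if i: "i < n" for i
    proof -
      have le: "a i \<le> c i" "c i \<le> b" using ac i by auto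
      have si: "set_integrable lborel {a i..<c i} h"
        by (rule set_integrable_subset[OF loc_int_set_integrable(1)[OF h, of b]]) (use le in auto)
      have ind: "integrable lborel (indicat_real {a i..<c i})"
        by (rule integrable_real_indicator) (use le in auto)
      have "norm (conv heaviside h (c i) - conv heaviside h (a i)) \<le> (LINT t:{a i..<c i}|lborel. norm (h t))"
        unfolding conv_heaviside_diff[OF h le(1)] set_lebesgue_integral_def
        by (rule order_trans[OF integral_norm_bound]) simp
      also have "\<dots> \<le> (LINT t|lborel. indicator {a i<..<c i} t * v m t + real m * indicator {a i..<c i} t)"
        unfolding set_lebesgue_integral_def
      proof (rule integral_mono_AE)
        show "integrable lborel (\<lambda>t. indicat_real {a i..<c i} t *\<^sub>R norm (h t))"
          using set_integrable_norm[OF si] by (simp add: set_integrable_def)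
        show "integrable lborel (\<lambda>t. indicator {a i<..<c i} t * v m t + real m * indicator {a i..<c i} t)"
          using vint[of m] ind by (intro Bochner_Integration.integrable_add integrable_mult_right)
            (auto intro: integrable_real_mult_indicator simp: mult.commute)
        show "AE t in lborel. indicat_real {a i..<c i} t *\<^sub>R norm (h t) \<le>
            indicator {a i<..<c i} t * v m t + real m * indicator {a i..<c i} t"
          using AE_lborel_singleton[of "a i"]
          by eventually_elim (use le in \<open>auto simp: v_def r_def split: split_indicator\<close>)
      qed
      also have "\<dots> = (LINT t|lborel. indicator {a i<..<c i} t * v m t) + real m * (c i - a i)"
        using vint[of m] le ind by (subst Bochner_Integration.integral_add)
          (auto intro: integrable_real_mult_indicator simp: mult.commute)
      finally show ?thesis .
    qed
    have iv: "integrable lborel (\<lambda>t. indicator {a i<..<c i} t * v m t)" for i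
      using vint[of m] by (auto intro: integrable_real_mult_indicator simp: mult.commute)
    have "(\<Sum>i<n. norm (conv heaviside h (c i) - conv heaviside h (a i)))
       \<le> (\<Sum>i<n. (LINT t|lborel. indicator {a i<..<c i} t * v m t) + real m * (c i - a i))"
      by (intro sum_mono one) auto
    also have "\<dots> = (\<Sum>i<n. LINT t|lborel. indicator {a i<..<c i} t * v m t) + real m * (\<Sum>i<n. c i - a i)"
      by (simp add: sum.distrib sum_distrib_left)
    also have "(\<Sum>i<n. LINT t|lborel. indicator {a i<..<c i} t * v m t)
        = (LINT t|lborel. (\<Sum>i<n. indicator {a i<..<c i} t * v m t))"
      by (rule Bochner_Integration.integral_sum[symmetric]) (rule iv)
    also have "\<dots> \<le> (LINT t|lborel. v m t)"
    proof (rule integral_mono[OF Bochner_Integration.integrable_sum[OF iv] vint])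
      fix t
      have "(\<Sum>i<n. indicator {a i<..<c i} t * v m t) = indicator (\<Union>i<n. {a i<..<c i}) t * v m t"
      proof -
        have "indicat_real (\<Union>i<n. {a i<..<c i}) t = (\<Sum>i<n. indicator {a i<..<c i} t)"
          by (rule indicator_UN_disjoint[OF _ dis]) simp
        then show ?thesis by (simp add: sum_distrib_right)
      qed
      also have "\<dots> \<le> v m t" using v0 by (auto split: split_indicator)
      finally show "(\<Sum>i<n. indicator {a i<..<c i} t * v m t) \<le> v m t" .
    qed
    also have "\<dots> < e / 2" by (rule m)
    also have "real m * (\<Sum>i<n. c i - a i) \<le> real m * (e / (2 * (real m + 1)))"
      using len by (intro mult_left_mono) auto
    also have "\<dots> \<le> e / 2" using e by (simp add: field_simps)
    finally show ?case by simp
  qed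
qed

lemma abs_continuous_on_add_const:
  assumes ac: "abs_continuous_on S p" and TS: "T \<subseteq> S" and g: "\<And>x. x \<in> T \<Longrightarrow> g x = k + p x"
  shows "abs_continuous_on T g"
  unfolding abs_continuous_on_def
proof (rule allI, rule impI)
  fix e :: real assume "0 < e"
  from ac[unfolded abs_continuous_on_def, rule_format, OF this]
  obtain \<delta> where \<delta>: "0 < \<delta>" and *: "\<forall>n a c. (\<forall>i<(n::nat). a i \<le> c i \<and> {a i..c i} \<subseteq> S) \<and>
      disjoint_family_on (\<lambda>i. {a i<..<c i}) {..<n} \<and> (\<Sum>i<n. c i - a i) < \<delta> \<longrightarrow>
      (\<Sum>i<n. norm (p (c i) - p (a i))) < e"
    by (elim exE conjE) (rule that)
  show "\<exists>\<delta>>0. \<forall>n a c. (\<forall>i<(n::nat). a i \<le> c i \<and> {a i..c i} \<subseteq> T) \<and>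
      disjoint_family_on (\<lambda>i. {a i<..<c i}) {..<n} \<and> (\<Sum>i<n. c i - a i) < \<delta> \<longrightarrow>
      (\<Sum>i<n. norm (g (c i) - g (a i))) < e"
  proof (intro exI[of _ \<delta>] conjI allI impI \<delta>, elim conjE)
    fix n :: nat and a c :: "nat \<Rightarrow> real"
    assume T: "\<forall>i<n. a i \<le> c i \<and> {a i..c i} \<subseteq> T"
      and dis: "disjoint_family_on (\<lambda>i. {a i<..<c i}) {..<n}" "(\<Sum>i<n. c i - a i) < \<delta>"
    have "a i \<in> T \<and> c i \<in> T" if "i < n" for i using T that by fastforce
    then have "(\<Sum>i<n. norm (g (c i) - g (a i))) = (\<Sum>i<n. norm (p (c i) - p (a i)))"
      by (intro sum.cong) (auto simp: g)
    also have "\<dots> < e" using *[rule_format, of n a c] T dis TS by blast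
    finally show "(\<Sum>i<n. norm (g (c i) - g (a i))) < e" .
  qed
qed

lemma abs_continuous_primitive:
  assumes h: "loc_int h" and g: "\<And>x. 0 < x \<Longrightarrow> g x = k + conv heaviside h x"
  shows "abs_continuous_on {0<..b} g"
  by (rule abs_continuous_on_add_const[OF abs_continuous_conv_heaviside[OF h, of b]]) (use g in auto)

lemma primitive_tendsto:
  assumes h: "loc_int h" and g: "\<And>x. 0 < x \<Longrightarrow> g x = k + conv heaviside h x"
  shows "(g \<longlongrightarrow> k) (at_right 0)"
proof -
  have "continuous_on {0..1} (\<lambda>x. integral {0..x} h)"
    by (intro indefinite_integral_continuous_1 set_borel_integral_eq_integral(1) loc_int_set_integrable(2)[OF h])
  then have "((\<lambda>x. integral {0..x} h) \<longlongrightarrow> integral {0..0} h) (at 0 within {0..1})"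
    unfolding continuous_on_def by (rule bspec) simp
  moreover have "at 0 within {0..1} = at_right (0::real)" by (rule at_within_Icc_at_right) simp
  ultimately have "((\<lambda>x. k + integral {0..x} h) \<longlongrightarrow> k + 0) (at_right 0)"
    by (intro tendsto_add tendsto_const) simp
  moreover have "eventually (\<lambda>x. k + integral {0..x} h = g x) (at_right 0)"
    by (rule eventually_at_rightI[of 0 1]) (auto simp: g conv_heaviside_integral[OF h])
  ultimately show ?thesis by (simp add: Lim_transform_eventually)
qed

text \<open>Intervals touching \<open>0\<close> are not covered by the hypothesis. They are moved into \<open>(0,b]\<close> by clamping all
endpoints from below at a small \<open>\<eta>\<close>, and \<open>\<eta>\<close> tends to \<open>0\<close> in the finite sum of increments.\<close>
lemma ac_half_line_extend:
  fixes g :: "real \<Rightarrow> complex"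
  assumes ac: "\<And>b. 0 < b \<Longrightarrow> abs_continuous_on {0<..b} g" and lim: "(g \<longlongrightarrow> k) (at_right 0)"
  shows "ac_half_line (\<lambda>x. if x \<le> 0 then k else g x)"
  unfolding ac_half_line_def
proof (intro conjI allI impI)
  let ?g = "\<lambda>x. if x \<le> 0 then k else g x"
  fix b e :: real assume e: "0 < e"
  define b' where "b' = max b 1"
  have b': "0 < b'" "b \<le> b'" "1 \<le> b'" by (auto simp: b'_def)
  obtain \<delta> where \<delta>: "0 < \<delta>" and small: "\<And>n a c. (\<forall>i<(n::nat). a i \<le> c i \<and> {a i..c i} \<subseteq> {0<..b'}) \<Longrightarrow>
      disjoint_family_on (\<lambda>i. {a i<..<c i}) {..<n} \<Longrightarrow> (\<Sum>i<n. c i - a i) < \<delta> \<Longrightarrow>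
      (\<Sum>i<n. norm (g (c i) - g (a i))) < e / 2"
  proof -
    have "0 < e / 2" using e by simp
    with ac[OF b'(1)] obtain \<delta> where "0 < \<delta>" and "\<forall>(n::nat) a c. (\<forall>i<n. a i \<le> c i \<and> {a i..c i} \<subseteq> {0<..b'}) \<and>
      disjoint_family_on (\<lambda>i. {a i<..<c i}) {..<n} \<and> (\<Sum>i<n. c i - a i) < \<delta> \<longrightarrow>
      (\<Sum>i<n. norm (g (c i) - g (a i))) < e / 2"
      unfolding abs_continuous_on_def by blast
    then show ?thesis by (intro that[of \<delta>]) simp_all
  qed
  show "\<exists>\<delta>>0. \<forall>P. packing 0 b P \<and> total_length P < \<delta> \<longrightarrow> increments ?g P < e"
  proof (intro exI[of _ \<delta>] conjI allI impI \<delta>, elim conjE)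
    fix P assume P: "packing 0 b P" and len: "total_length P < \<delta>"
    have finP: "finite P" and rng: "\<And>p. p \<in> P \<Longrightarrow> 0 \<le> fst p \<and> fst p \<le> snd p \<and> snd p \<le> b"
      and dis: "\<And>p q. p \<in> P \<Longrightarrow> q \<in> P \<Longrightarrow> p \<noteq> q \<Longrightarrow> disjnt {fst p<..<snd p} {fst q<..<snd q}"
      using P by (auto simp: packing_def pairwise_def)
    obtain \<phi> where \<phi>: "bij_betw \<phi> {..<card P} P"
      using ex_bij_betw_nat_finite[OF finP] by (auto simp: atLeast0LessThan)
    have \<phi>P: "\<phi> i \<in> P" if "i < card P" for i using \<phi> that by (auto simp: bij_betw_def)
    have *: "(\<Sum>p\<in>P. norm (g (max (snd p) \<eta>) - g (max (fst p) \<eta>))) < e / 2" if \<eta>: "0 < \<eta>" "\<eta> < 1" for \<eta>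
    proof -
      have "(\<Sum>i<card P. norm (g (max (snd (\<phi> i)) \<eta>) - g (max (fst (\<phi> i)) \<eta>))) < e / 2"
      proof (rule small)
        show "\<forall>i<card P. max (fst (\<phi> i)) \<eta> \<le> max (snd (\<phi> i)) \<eta> \<and>
            {max (fst (\<phi> i)) \<eta>..max (snd (\<phi> i)) \<eta>} \<subseteq> {0<..b'}"
          using rng[OF \<phi>P] \<eta> b' by fastforce
        show "disjoint_family_on (\<lambda>i. {max (fst (\<phi> i)) \<eta><..<max (snd (\<phi> i)) \<eta>}) {..<card P}"
          unfolding disjoint_family_on_def
        proof (intro ballI impI)
          fix i j assume ij: "i \<in> {..<card P}" "j \<in> {..<card P}" "i \<noteq> j"
          then have "\<phi> i \<noteq> \<phi> j" using \<phi> by (auto simp: bij_betw_def inj_on_def)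
          then have "disjnt {fst (\<phi> i)<..<snd (\<phi> i)} {fst (\<phi> j)<..<snd (\<phi> j)}" using ij by (intro dis \<phi>P) auto
          moreover have "{max (fst p) \<eta><..<max (snd p) \<eta>} \<subseteq> {fst p<..<snd p}" for p by auto
          ultimately show "{max (fst (\<phi> i)) \<eta><..<max (snd (\<phi> i)) \<eta>} \<inter> {max (fst (\<phi> j)) \<eta><..<max (snd (\<phi> j)) \<eta>} = {}"
            unfolding disjnt_def by blast
        qed
        have "(\<Sum>i<card P. max (snd (\<phi> i)) \<eta> - max (fst (\<phi> i)) \<eta>) \<le> (\<Sum>i<card P. snd (\<phi> i) - fst (\<phi> i))"
          using rng[OF \<phi>P] by (intro sum_mono) (fastforce simp: max_def)
        also have "\<dots> = total_length P"
          unfolding total_length_def using sum.reindex_bij_betw[OF \<phi>] by simp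
        finally show "(\<Sum>i<card P. max (snd (\<phi> i)) \<eta> - max (fst (\<phi> i)) \<eta>) < \<delta>" using len by simp
      qed
      then show ?thesis
        using sum.reindex_bij_betw[OF \<phi>, of "\<lambda>p. norm (g (max (snd p) \<eta>) - g (max (fst p) \<eta>))"] by simp
    qed
    have pt: "((\<lambda>\<eta>. g (max t \<eta>)) \<longlongrightarrow> ?g t) (at_right 0)" if "0 \<le> t" for t
    proof (cases "t = 0")
      case True
      have "eventually (\<lambda>\<eta>. g \<eta> = g (max t \<eta>)) (at_right 0)"
        unfolding True by (rule eventually_at_rightI[of 0 1]) auto
      from Lim_transform_eventually[OF lim this] show ?thesis using True by simp
    next
      case False
      then have "eventually (\<lambda>\<eta>. g (max t \<eta>) = g t) (at_right 0)"
        using that by (intro eventually_at_rightI[of 0 t]) auto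
      then show ?thesis using False that by (simp add: tendsto_eventually)
    qed
    have "((\<lambda>\<eta>. \<Sum>p\<in>P. norm (g (max (snd p) \<eta>) - g (max (fst p) \<eta>))) \<longlongrightarrow> increments ?g P) (at_right 0)"
      unfolding increments_def
    proof (intro tendsto_sum tendsto_norm tendsto_diff)
      fix p assume "p \<in> P"
      then have "0 \<le> fst p" "0 \<le> snd p" using rng[of p] by auto
      then show "((\<lambda>\<eta>. g (max (fst p) \<eta>)) \<longlongrightarrow> ?g (fst p)) (at_right 0)"
        "((\<lambda>\<eta>. g (max (snd p) \<eta>)) \<longlongrightarrow> ?g (snd p)) (at_right 0)" by (simp_all only: pt)
    qed
    moreover have "eventually (\<lambda>\<eta>. (\<Sum>p\<in>P. norm (g (max (snd p) \<eta>) - g (max (fst p) \<eta>))) \<le> e / 2) (at_right 0)"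
      by (rule eventually_at_rightI[of 0 1]) (use * in \<open>auto intro: less_imp_le\<close>)
    ultimately have "increments ?g P \<le> e / 2"
      by (rule tendsto_upperbound) simp
    then show "increments ?g P < e" using e by simp
  qed
qed simp

theorem abs_continuous_fundamental_theorem:
  fixes g :: "real \<Rightarrow> complex"
  assumes ac: "\<And>b. 0 < b \<Longrightarrow> abs_continuous_on {0<..b} g" and lim: "(g \<longlongrightarrow> k) (at_right 0)"
  obtains h where "loc_int h" "\<And>x. 0 < x \<Longrightarrow> g x = k + conv heaviside h x"
proof -
  obtain h where h: "loc_int h" and eq: "\<And>x. (if x \<le> 0 then k else g x) = (if (0::real) \<le> 0 then k else g 0) + conv heaviside h x"
    using ac_half_line_primitive[OF ac_half_line_extend[OF ac lim]] by blast
  show ?thesis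
  proof (rule that[OF h])
    fix x :: real assume "0 < x"
    with eq[of x] show "g x = k + conv heaviside h x" by simp
  qed
qed

lemma primitive_vector_derivative_AE:
  assumes h: "loc_int h" and g: "\<And>x. 0 < x \<Longrightarrow> g x = k + conv heaviside h x"
  shows "AE x in lborel. 0 < x \<longrightarrow> vector_derivative g (at x) = h x"
  using loc_int_derivative_AE[OF h]
proof eventually_elim
  case (elim x)
  show ?case
  proof
    assume x: "0 < x"
    then have "((\<lambda>x. k + conv heaviside h x) has_vector_derivative 0 + h x) (at x)"
      using elim by (intro has_vector_derivative_add has_vector_derivative_const) auto
    then have "(g has_vector_derivative 0 + h x) (at x)"
      by (rule has_vector_derivative_transform_within_open[of _ _ _ "{0<..}"]) (use x g in auto)
    then show "vector_derivative g (at x) = h x" by (simp add: vector_derivative_at)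
  qed
qed

section \<open>Prabhakar integrals as convolutions\<close>

lemma AE_pos_iff: "(AE x in lebesgue_on {0<..}. P x) \<longleftrightarrow> (AE x in lborel. 0 < x \<longrightarrow> P (x::real))"
  by (subst AE_restrict_space_iff) (auto simp: AE_completion_iff)

text \<open>A Borel representative that vanishes on the negative half line. Integrals do not see the difference,
and Borel functions can be convolved without measurability problems on the product space.\<close>
definition represents :: "(real \<Rightarrow> complex) \<Rightarrow> (real \<Rightarrow> complex) \<Rightarrow> bool" where
  "represents p y \<longleftrightarrow> loc_int p \<and> (\<forall>b>0. y absolutely_integrable_on {0..b}) \<and>
     (AE x in lborel. 0 < x \<longrightarrow> y x = p x)"

lemma representsI:
  assumes p: "loc_int p" and eq: "AE x in lborel. 0 < x \<longrightarrow> y x = p x"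
  shows "represents p y"
  unfolding represents_def
proof (intro conjI allI impI p eq)
  fix b :: real assume "0 < b"
  have "AE x in lebesgue. 0 < x \<longrightarrow> y x = p x" using eq by (rule AE_completion)
  then obtain N where "{x \<in> space lebesgue. \<not> (0 < x \<longrightarrow> y x = p x)} \<subseteq> N" "emeasure lebesgue N = 0" "N \<in> sets lebesgue"
    by (rule AE_E)
  then have N: "N \<in> null_sets lebesgue" "{x. \<not> (0 < x \<longrightarrow> y x = p x)} \<subseteq> N" by auto
  have "set_integrable lebesgue {0..b} p"
    using loc_int_set_integrable(2)[OF p, of b] loc_int_measurable[OF p]
    unfolding set_integrable_def by (subst integrable_completion) auto
  moreover have "negligible (insert 0 N)" using N(1) by (simp add: negligible_iff_null_sets)
  ultimately show "y absolutely_integrable_on {0..b}"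
  proof (rule absolutely_integrable_spike)
    fix x assume "x \<in> {0..b} - insert 0 N"
    then have "0 < x" "x \<notin> N" by auto
    then show "y x = p x" using N(2) by blast
  qed
qed

lemma representative_exists:
  assumes y: "\<And>b. 0 < b \<Longrightarrow> y absolutely_integrable_on {0..b}"
  obtains p where "represents p y"
proof -
  define u where "u x = (if 0 < x then y x else 0)" for x :: real
  have m: "(\<lambda>x. indicat_real {0..real (Suc n)} x *\<^sub>R y x) \<in> borel_measurable lebesgue" for n
    using y[of "real (Suc n)"] unfolding set_integrable_def by (auto dest: borel_measurable_integrable)
  have u: "u \<in> borel_measurable lebesgue"
  proof (rule borel_measurable_LIMSEQ_metric)
    show "(\<lambda>x. indicat_real {0<..} x *\<^sub>R (indicat_real {0..real (Suc n)} x *\<^sub>R y x)) \<in> borel_measurable lebesgue" for n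
      by (intro borel_measurable_scaleR m borel_measurable_indicator) auto
    fix x :: real
    obtain N :: nat where N: "x \<le> real N" using real_arch_simple by blast
    have "eventually (\<lambda>n. indicat_real {0<..} x *\<^sub>R (indicat_real {0..real (Suc n)} x *\<^sub>R y x) = u x) sequentially"
      using eventually_ge_at_top[of N] by eventually_elim (use N in \<open>auto simp: u_def split: split_indicator\<close>)
    then show "(\<lambda>n. indicat_real {0<..} x *\<^sub>R (indicat_real {0..real (Suc n)} x *\<^sub>R y x)) \<longlonglongrightarrow> u x"
      by (rule tendsto_eventually)
  qed
  have "(\<lambda>x. Re (u x)) \<in> borel_measurable lebesgue" "(\<lambda>x. Im (u x)) \<in> borel_measurable lebesgue"
    using u by auto
  then obtain a c where [measurable]: "a \<in> borel_measurable lborel" "c \<in> borel_measurable lborel"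
    and ac: "AE x in lborel. Re (u x) = a x" "AE x in lborel. Im (u x) = c x"
    using completion_ex_borel_measurable_real by metis
  define p where "p x = (if 0 < x then complex_of_real (a x) + \<i> * complex_of_real (c x) else 0)" for x
  have p[measurable]: "p \<in> borel_measurable borel" unfolding p_def[abs_def] by measurable
  have up: "AE x in lborel. u x = p x"
    using ac by eventually_elim (auto simp: p_def u_def complex_eq_iff)
  have fin: "nconv (modulus heaviside) (modulus p) b < \<infinity>" for b
  proof -
    let ?b = "max b 1"
    have "nconv (modulus heaviside) (modulus p) b = (\<integral>\<^sup>+t. indicator {..<b} t * modulus p t \<partial>lebesgue)"
      unfolding heaviside_nconv_eq by (simp add: nn_integral_completion)
    also have "\<dots> \<le> (\<integral>\<^sup>+t. ennreal (norm (indicat_real {0..?b} t *\<^sub>R y t)) \<partial>lebesgue)"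
    proof (rule nn_integral_mono_AE)
      show "AE t in lebesgue. indicator {..<b} t * modulus p t \<le> ennreal (norm (indicat_real {0..?b} t *\<^sub>R y t))"
        using AE_completion[OF up]
        by eventually_elim (auto simp: modulus_def u_def p_def split: split_indicator if_splits)
    qed
    also have "\<dots> < \<infinity>" using y[of ?b] unfolding set_integrable_def integrable_iff_bounded by simp
    finally show ?thesis .
  qed
  have "represents p y"
    unfolding represents_def
  proof (intro conjI allI impI y)
    show "loc_int p" using fin by (auto simp: loc_int_def p_def)
    show "AE x in lborel. 0 < x \<longrightarrow> y x = p x"
      using up by eventually_elim (auto simp: u_def)
  qed
  then show ?thesis by (rule that)
qed

text \<open>The Prabhakar integral on representatives. The case \<open>c = 0\<close>, \<open>m = 0\<close> stands for the convolution with
the unit mass at \<open>0\<close>. For the kernels of the derivative, \<open>m = 0\<close> occurs only together with \<open>c = 0\<close>,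
which is the side condition \<open>0 < m \<or> c = 0 \<and> m = 0\<close> of the following lemmas.\<close>
definition prabhakar_op :: "complex \<Rightarrow> real \<Rightarrow> real \<Rightarrow> complex \<Rightarrow> (real \<Rightarrow> complex) \<Rightarrow> real \<Rightarrow> complex" where
  "prabhakar_op c \<rho> m \<omega> h = (if c = 0 \<and> m = 0 then h else conv (pkernel c \<rho> m \<omega>) h)"

lemma prabhakar_op_pos: "0 < m \<Longrightarrow> prabhakar_op c \<rho> m \<omega> h = conv (pkernel c \<rho> m \<omega>) h"
  by (simp add: prabhakar_op_def)

lemma prabhakar_op_0 [simp]: "prabhakar_op 0 \<rho> 0 \<omega> h = h"
  by (simp add: prabhakar_op_def)

lemma prabhakar_integral_conv:
  assumes r: "represents p y" and "0 < \<rho>" "0 < m" and x: "0 < x"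
  shows "prabhakar_integral c \<rho> m \<omega> y x = conv (pkernel c \<rho> m \<omega>) p x"
proof -
  have p: "loc_int p" and y: "set_integrable lebesgue {0..x} y" and eq: "AE t in lborel. 0 < t \<longrightarrow> y t = p t"
    using r x by (auto simp: represents_def)
  note [measurable] = loc_int_measurable[OF p] pkernel_measurable[OF assms(2,3)]
  have m1: "(\<lambda>t. indicat_real {0..x} t *\<^sub>R y t) \<in> borel_measurable lebesgue"
    using y unfolding set_integrable_def by (rule borel_measurable_integrable)
  have m2: "(\<lambda>t. pkernel c \<rho> m \<omega> (x - t)) \<in> borel_measurable lebesgue"
    by (rule measurable_completion) measurable
  have "prabhakar_integral c \<rho> m \<omega> y x
      = (LINT t|lebesgue. pkernel c \<rho> m \<omega> (x - t) * (indicat_real {0..x} t *\<^sub>R y t))"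
    using assms(3) unfolding prabhakar_integral_def set_lebesgue_integral_def
    by (auto intro!: Bochner_Integration.integral_cong simp: pkernel_def split: split_indicator)
  also have "\<dots> = (LINT t|lebesgue. pkernel c \<rho> m \<omega> (x - t) * p t)"
  proof (rule integral_cong_AE)
    show "(\<lambda>t. pkernel c \<rho> m \<omega> (x - t) * (indicat_real {0..x} t *\<^sub>R y t)) \<in> borel_measurable lebesgue"
      by (rule borel_measurable_times[OF m2 m1])
    show "(\<lambda>t. pkernel c \<rho> m \<omega> (x - t) * p t) \<in> borel_measurable lebesgue"
      by (rule measurable_completion) measurable
    show "AE t in lebesgue. pkernel c \<rho> m \<omega> (x - t) * (indicat_real {0..x} t *\<^sub>R y t) = pkernel c \<rho> m \<omega> (x - t) * p t"
      using AE_completion[OF eq] AE_completion[OF AE_lborel_singleton[of 0]]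
      by eventually_elim (auto simp: loc_int_nonpos[OF p] pkernel_nonpos split: split_indicator)
  qed
  also have "\<dots> = conv (pkernel c \<rho> m \<omega>) p x"
    unfolding conv_def by (rule integral_completion) measurable
  finally show ?thesis .
qed

lemma prabhakar_integral_op_AE:
  assumes r: "represents p y" and "0 < \<rho>" and v: "0 < m \<or> c = 0 \<and> m = 0"
  shows "AE x in lborel. 0 < x \<longrightarrow> prabhakar_integral c \<rho> m \<omega> y x = prabhakar_op c \<rho> m \<omega> p x"
proof (cases "0 < m")
  case True
  then show ?thesis using prabhakar_integral_conv[OF r assms(2) True] by (simp add: prabhakar_op_def)
next
  case False
  then have "c = 0" "m = 0" using v by auto
  then show ?thesis using r by (simp add: represents_def prabhakar_op_def prabhakar_integral_def)
qed

lemma pkernel_loc_int: "0 < \<rho> \<Longrightarrow> 0 < m \<Longrightarrow> loc_int (pkernel c \<rho> m \<omega>)"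
  by (rule order_ge_loc_int[OF pkernel_order])

lemma prabhakar_op_loc_int:
  assumes "0 < \<rho>" "0 < m \<or> c = 0 \<and> m = 0" "loc_int h"
  shows "loc_int (prabhakar_op c \<rho> m \<omega> h)"
  using assms by (auto simp: prabhakar_op_def intro!: loc_int_conv pkernel_loc_int)

lemma conv_linear_at:
  assumes [measurable]: "p \<in> borel_measurable borel" "q \<in> borel_measurable borel" "r \<in> borel_measurable borel"
    and "nconv (modulus p) (modulus q) x < \<infinity>" "nconv (modulus p) (modulus r) x < \<infinity>"
  shows "conv p (\<lambda>t. q t + c * r t) x = conv p q x + c * conv p r x"
proof -
  have "nconv (modulus p) (modulus (\<lambda>t. c * r t)) x < \<infinity>"
    using assms by (simp add: modulus_cmult' nconv_cmult_right ennreal_mult_less_top)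
  then show ?thesis using assms by (subst conv_add_right) (auto simp: conv_cmult_right)
qed

lemma conv_linear_AE:
  assumes p: "loc_int p" and q: "loc_int q" and r: "loc_int r"
  shows "AE x in lborel. conv p (\<lambda>t. q t + c * r t) x = conv p q x + c * conv p r x"
  using loc_int_conv_finite_AE[OF p q] loc_int_conv_finite_AE[OF p r]
  by eventually_elim (intro conv_linear_at; use p q r in \<open>auto dest: loc_int_measurable\<close>)

lemma loc_int_linear: "loc_int p \<Longrightarrow> loc_int q \<Longrightarrow> loc_int (\<lambda>t. p t + c * q t)"
  by (intro loc_int_add loc_int_cmult)

lemma prabhakar_op_linear_AE:
  assumes "0 < \<rho>" "0 < m \<or> c = 0 \<and> m = 0" and "loc_int p" "loc_int q"
  shows "AE x in lborel. prabhakar_op c \<rho> m \<omega> (\<lambda>t. p t + k * q t) x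
      = prabhakar_op c \<rho> m \<omega> p x + k * prabhakar_op c \<rho> m \<omega> q x"
  using assms conv_linear_AE[OF pkernel_loc_int, of \<rho> m p q] by (auto simp: prabhakar_op_def)

lemma conv_prabhakar_op_AE:
  assumes "0 < \<rho>" "0 < m \<or> c = 0 \<and> m = 0" and "loc_int p" "loc_int q"
  shows "AE x in lborel. conv p (prabhakar_op c \<rho> m \<omega> q) x = conv (prabhakar_op c \<rho> m \<omega> p) q x"
proof (cases "c = 0 \<and> m = 0")
  case False
  then have m: "0 < m" using assms by auto
  have "prabhakar_op c \<rho> m \<omega> p = conv p (pkernel c \<rho> m \<omega>)"
    unfolding prabhakar_op_pos[OF m] by (rule ext) (rule conv_commute)
  then show ?thesis
    using loc_int_conv_assoc_AE[OF assms(3) pkernel_loc_int[OF assms(1) m] assms(4)] by (simp add: prabhakar_op_pos[OF m])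
qed simp

lemma conv_prabhakar_op:
  assumes "0 < \<rho>" "0 < m \<or> c = 0 \<and> m = 0" and p: "order_ge a p" and q: "loc_int q" and am: "1 \<le> a + m"
  shows "conv p (prabhakar_op c \<rho> m \<omega> q) x = conv (prabhakar_op c \<rho> m \<omega> p) q x"
proof (cases "c = 0 \<and> m = 0")
  case False
  then have m: "0 < m" using assms by auto
  have "prabhakar_op c \<rho> m \<omega> p = conv p (pkernel c \<rho> m \<omega>)"
    unfolding prabhakar_op_pos[OF m] by (rule ext) (rule conv_commute)
  then show ?thesis
    using order_ge_conv_assoc[OF p pkernel_order[OF assms(1) m] am q] by (simp add: prabhakar_op_pos[OF m])
qed simp

lemma prabhakar_op_pkernel:
  assumes "0 < \<rho>" "0 < m \<or> c = 0 \<and> m = 0" "0 < n"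
  shows "prabhakar_op c \<rho> m \<omega> (pkernel d \<rho> n \<omega>) = pkernel (c + d) \<rho> (m + n) \<omega>"
proof (cases "c = 0 \<and> m = 0")
  case False
  then have m: "0 < m" using assms by auto
  then show ?thesis using False assms conv_pkernel[of \<rho> m n c \<omega> d] by (auto simp: prabhakar_op_pos)
qed simp

lemma prabhakar_op_kseries:
  assumes "0 < \<rho>" "0 < m \<or> c = 0 \<and> m = 0" "0 < n" "0 < \<beta>" "0 \<le> d" "0 \<le> s"
  shows "prabhakar_op (complex_of_real c) \<rho> m \<omega> (kseries lam s \<beta> d \<rho> n \<omega>) = kseries lam s \<beta> (c + d) \<rho> (m + n) \<omega>"
proof (cases "c = 0 \<and> m = 0")
  case False
  then have m: "0 < m" using assms by auto
  then show ?thesis using False assms conv_pkernel_kseries[of \<rho> \<beta> n d s m c \<omega> lam] by (auto simp: prabhakar_op_pos)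
qed simp

lemma pkernel_0_1: "0 < \<rho> \<Longrightarrow> pkernel 0 \<rho> 1 \<omega> = heaviside"
proof
  fix x :: real assume "0 < \<rho>"
  from pkernel_sums[OF this, of 1 0 \<omega> x]
  have "(\<lambda>j. pcoef 0 \<omega> j * complex_of_real (powker (\<rho> * real j + 1) x)) sums pkernel 0 \<rho> 1 \<omega> x" by simp
  moreover have "(\<lambda>j. pcoef 0 \<omega> j * complex_of_real (powker (\<rho> * real j + 1) x))
     = (\<lambda>j. if j = 0 then complex_of_real (powker 1 x) else 0)"
    by (auto simp: pcoef_def pochhammer_0_left)
  ultimately have "pkernel 0 \<rho> 1 \<omega> x = complex_of_real (powker 1 x)"
    using sums_single[of 0 "\<lambda>_. complex_of_real (powker 1 x)"] sums_unique2 by fastforce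
  then show "pkernel 0 \<rho> 1 \<omega> x = heaviside x" by (simp add: heaviside_def powker_def)
qed

text \<open>Two functions with the same indefinite integral agree almost everywhere, as both are its derivative.\<close>
lemma conv_heaviside_inject_AE:
  assumes p: "loc_int p" and q: "loc_int q" and eq: "\<And>x. conv heaviside p x = conv heaviside q x"
  shows "AE x in lborel. p x = q x"
proof -
  have e: "conv heaviside p = conv heaviside q" using eq by auto
  show ?thesis
    using loc_int_derivative_AE[OF p] loc_int_derivative_AE[OF q]
  proof eventually_elim
    case (elim x)
    show ?case
    proof (cases "0 < x")
      case True
      then show ?thesis using elim unfolding e by (auto intro: vector_derivative_unique_at)
    qed (simp add: loc_int_nonpos[OF p] loc_int_nonpos[OF q])
  qed
qed

lemma prabhakar_op_cong_AE:
  assumes "0 < \<rho>" "0 < m \<or> c = 0 \<and> m = 0" "loc_int p" "loc_int q" and eq: "AE x in lborel. p x = q x"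
  shows "AE x in lborel. prabhakar_op c \<rho> m \<omega> p x = prabhakar_op c \<rho> m \<omega> q x"
proof (cases "c = 0 \<and> m = 0")
  case False
  then have m: "0 < m" using assms by auto
  from pkernel_measurable[OF assms(1) m]
  have "conv (pkernel c \<rho> m \<omega>) p x = conv (pkernel c \<rho> m \<omega>) q x" for x
    by (rule conv_cong_AE) (use assms in \<open>auto dest: loc_int_measurable\<close>)
  then show ?thesis by (simp add: prabhakar_op_pos[OF m])
qed (use eq in simp)

text \<open>The convolution of \<open>p\<close> with \<open>h + k \<delta>\<close>, where \<open>\<delta>\<close> is the unit mass at \<open>0\<close>. Treating the initial
value as a point mass lets the homogeneous and the inhomogeneous part be computed together.\<close>
definition conv_delta :: "complex \<Rightarrow> (real \<Rightarrow> complex) \<Rightarrow> (real \<Rightarrow> complex) \<Rightarrow> real \<Rightarrow> complex" where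
  "conv_delta k p h t = conv p h t + k * p t"

lemma conv_delta_loc_int: "loc_int p \<Longrightarrow> loc_int h \<Longrightarrow> loc_int (conv_delta k p h)"
  unfolding conv_delta_def[abs_def] by (intro loc_int_linear loc_int_conv)

lemma conv_delta_heaviside: "0 < x \<Longrightarrow> conv_delta k heaviside h x = k + conv heaviside h x"
proof -
  assume "0 < x"
  then have "heaviside x = 1" by (simp add: heaviside_def)
  then show ?thesis by (simp add: conv_delta_def)
qed

lemma conv_conv_delta_at:
  assumes [measurable]: "q \<in> borel_measurable borel" "p \<in> borel_measurable borel" "h \<in> borel_measurable borel"
    and fin: "nconv (modulus q) (nconv (modulus p) (modulus h)) x < \<infinity>" "nconv (modulus q) (modulus p) x < \<infinity>"
  shows "conv q (conv_delta k p h) x = conv_delta k (conv q p) h x"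
proof -
  have "nconv (modulus q) (modulus (conv p h)) x \<le> nconv (modulus q) (nconv (modulus p) (modulus h)) x"
    by (intro nconv_mono mult_left_mono modulus_conv_le) auto
  then have "nconv (modulus q) (modulus (conv p h)) x < \<infinity>" using fin(1) by (rule le_less_trans)
  then have "conv q (conv_delta k p h) x = conv q (conv p h) x + k * conv q p x"
    unfolding conv_delta_def[abs_def] using fin(2) by (intro conv_linear_at) auto
  then show ?thesis using conv_assoc[OF assms(1-3) fin(1)] by (simp add: conv_delta_def)
qed

lemma conv_conv_delta_AE:
  assumes q: "loc_int q" and p: "loc_int p" and h: "loc_int h"
  shows "AE x in lborel. conv q (conv_delta k p h) x = conv_delta k (conv q p) h x"
  unfolding conv_delta_def[abs_def]
  using conv_linear_AE[OF q loc_int_conv[OF p h] p, of k] loc_int_conv_assoc_AE[OF q p h]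
  by eventually_elim simp

text \<open>Associativity at every point, for kernels whose orders add up to at least \<open>1\<close>.\<close>
lemma conv_conv_delta:
  assumes q: "order_ge b q" and p: "order_ge a p" and ab: "1 \<le> b + a" and h: "loc_int h"
  shows "conv q (conv_delta k p h) x = conv_delta k (conv q p) h x"
proof (rule conv_conv_delta_at)
  show "nconv (modulus q) (nconv (modulus p) (modulus h)) x < \<infinity>"
    using order_ge_nconv_finite_everywhere[OF q p ab, of "modulus h" x] loc_int_finite[OF h]
      loc_int_nonpos[OF h] loc_int_measurable[OF h] by (auto simp: modulus_nonpos)
qed (use order_ge_nconv_finite[OF q p] q p h in \<open>auto dest: order_ge_measurable loc_int_measurable\<close>)

lemma prabhakar_op_conv_delta_AE:
  assumes "0 < \<rho>" "0 < m \<or> c = 0 \<and> m = 0" and p: "loc_int p" and h: "loc_int h"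
  shows "AE x in lborel. prabhakar_op c \<rho> m \<omega> (conv_delta k p h) x = conv_delta k (prabhakar_op c \<rho> m \<omega> p) h x"
proof (cases "c = 0 \<and> m = 0")
  case False
  then have m: "0 < m" using assms by auto
  show ?thesis
    unfolding prabhakar_op_pos[OF m] by (rule conv_conv_delta_AE[OF pkernel_loc_int[OF assms(1) m] p h])
qed simp

lemma conv_delta_linear_AE:
  assumes p: "loc_int p" and q: "loc_int q" and h: "loc_int h"
  shows "AE x in lborel. conv_delta k (\<lambda>t. p t + c * q t) h x = conv_delta k p h x + c * conv_delta k q h x"
  using conv_linear_AE[OF h p q, of c]
  by eventually_elim (simp add: conv_delta_def conv_commute[of _ h] algebra_simps)

lemma conv_delta_linear:
  assumes p: "order_ge a p" "1 \<le> a" and q: "order_ge b q" "1 \<le> b" and h: "loc_int h"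
  shows "conv_delta k (\<lambda>t. p t + c * q t) h x = conv_delta k p h x + c * conv_delta k q h x"
proof -
  note [measurable] = order_ge_measurable[OF p(1)] order_ge_measurable[OF q(1)] loc_int_measurable[OF h]
  have "conv h (\<lambda>t. p t + c * q t) x = conv h p x + c * conv h q x"
    using order_ge_conv_finite[OF p h, of x] order_ge_conv_finite[OF q h, of x]
    by (intro conv_linear_at) (auto simp: nconv_commute[of "modulus h"])
  then show ?thesis by (simp add: conv_delta_def conv_commute[of _ h] algebra_simps)
qed

section \<open>The Cauchy problem as a Volterra equation\<close>

locale hilfer_prabhakar =
  fixes \<mu> \<nu> \<rho> \<gamma> \<sigma> \<kappa> :: real and \<omega> lam :: complex and f f' :: "real \<Rightarrow> complex"
  assumes params: "0 < \<mu>" "\<mu> < 1" "0 \<le> \<nu>" "\<nu> \<le> 1" "0 < \<rho>" "0 \<le> \<gamma>" "0 \<le> \<sigma>"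
    and rep_f: "represents f' f"
begin

abbreviation "hp_in \<equiv> hp_inner \<gamma> \<mu> \<nu> \<rho> \<omega>"
abbreviation "hp_deriv \<equiv> hp_derivative \<gamma> \<mu> \<nu> \<rho> \<omega>"
abbreviation "is_solution \<equiv> hp_cauchy_solution \<gamma> \<mu> \<nu> \<rho> \<omega> lam \<sigma> \<kappa> f"
abbreviation "solvable \<equiv> hp_solvable_source \<gamma> \<mu> \<nu> \<rho> \<omega> f"
abbreviation "formula \<equiv> hp_solution_formula \<gamma> \<mu> \<nu> \<rho> \<omega> lam \<sigma> \<kappa> f"
abbreviation "hom \<equiv> hom_term \<gamma> \<mu> \<nu> \<rho> \<omega> lam \<sigma>"
abbreviation "inhom \<equiv> inhom_term \<gamma> \<mu> \<rho> \<omega> lam \<sigma> f"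

text \<open>\<open>A\<close> and \<open>B\<close> are the inner and the outer operator of the derivative, \<open>L\<close> is the kernel of the
right-hand side, and \<open>D\<close> inverts \<open>A\<close> up to an integration. \<open>K\<close> is the kernel of the Volterra equation
and \<open>R\<close> its resolvent. \<open>G\<close> and \<open>F\<close> are the kernels of the homogeneous and the inhomogeneous part of the
solution formula, and \<open>E\<close> is such that \<open>G = D + lam E\<close>.\<close>
definition A where "A = prabhakar_op (complex_of_real (- \<gamma> * (1 - \<nu>))) \<rho> ((1 - \<nu>) * (1 - \<mu>)) \<omega>"
definition B where "B = prabhakar_op (complex_of_real (- \<gamma> * \<nu>)) \<rho> (\<nu> * (1 - \<mu>)) \<omega>"
definition D where "D = pkernel (complex_of_real (\<gamma> * (1 - \<nu>))) \<rho> (\<mu> + \<nu> * (1 - \<mu>)) \<omega>"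
definition K where "K = pkernel (complex_of_real (\<sigma> + \<gamma>)) \<rho> (2 * \<mu>) \<omega>"
definition L where "L = pkernel (complex_of_real \<sigma>) \<rho> \<mu> \<omega>"
definition S where "S c m = kseries lam (\<sigma> + \<gamma>) (2 * \<mu>) c \<rho> m \<omega>"
definition G where "G = S (\<gamma> * (1 - \<nu>)) (\<mu> + \<nu> * (1 - \<mu>))"
definition E where "E = S (\<gamma> * (1 - \<nu>) + (\<sigma> + \<gamma>)) (\<mu> + \<nu> * (1 - \<mu>) + 2 * \<mu>)"
definition F where "F = S \<gamma> \<mu>"
definition R where "R = S (\<sigma> + \<gamma>) (2 * \<mu>)"

lemma valid_A: "0 < (1 - \<nu>) * (1 - \<mu>) \<or> complex_of_real (- \<gamma> * (1 - \<nu>)) = 0 \<and> (1 - \<nu>) * (1 - \<mu>) = 0"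
  using params by (cases "\<nu> = 1") auto

lemma valid_B: "0 < \<nu> * (1 - \<mu>) \<or> complex_of_real (- \<gamma> * \<nu>) = 0 \<and> \<nu> * (1 - \<mu>) = 0"
  using params by (cases "\<nu> = 0") auto

lemma alpha_pos: "0 < \<mu> + \<nu> * (1 - \<mu>)"
  using params by (intro add_pos_nonneg) auto

lemma S_order: "0 \<le> c \<Longrightarrow> 0 < m \<Longrightarrow> order_ge m (S c m)"
  unfolding S_def using params by (intro kseries_order) auto

lemma orders: "order_ge (\<mu> + \<nu> * (1 - \<mu>)) D" "order_ge (2 * \<mu>) K" "order_ge \<mu> L"
  "order_ge (\<mu> + \<nu> * (1 - \<mu>)) G" "order_ge (\<mu> + \<nu> * (1 - \<mu>) + 2 * \<mu>) E" "order_ge \<mu> F" "order_ge (2 * \<mu>) R"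
  unfolding D_def K_def L_def G_def E_def F_def R_def
  using params alpha_pos add_pos_pos[OF alpha_pos, of "2 * \<mu>"] by (auto intro!: pkernel_order S_order)

lemmas loc = orders[THEN order_ge_loc_int]

lemma loc_f: "loc_int f'" using rep_f by (simp add: represents_def)

lemma B_loc: "loc_int h \<Longrightarrow> loc_int (B h)"
  unfolding B_def by (rule prabhakar_op_loc_int[OF params(5) valid_B])

lemma A_D: "A D = heaviside"
proof -
  have "A D = pkernel (complex_of_real (- \<gamma> * (1 - \<nu>)) + complex_of_real (\<gamma> * (1 - \<nu>))) \<rho>
      ((1 - \<nu>) * (1 - \<mu>) + (\<mu> + \<nu> * (1 - \<mu>))) \<omega>"
    unfolding A_def D_def by (rule prabhakar_op_pkernel[OF params(5) valid_A alpha_pos])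
  also have "complex_of_real (- \<gamma> * (1 - \<nu>)) + complex_of_real (\<gamma> * (1 - \<nu>)) = 0" by simp
  also have "(1 - \<nu>) * (1 - \<mu>) + (\<mu> + \<nu> * (1 - \<mu>)) = 1" by (simp add: algebra_simps)
  finally show ?thesis by (simp only: pkernel_0_1[OF params(5)])
qed

lemma L_D: "conv L D = B K"
proof -
  have "B K = pkernel (complex_of_real (- \<gamma> * \<nu>) + complex_of_real (\<sigma> + \<gamma>)) \<rho> (\<nu> * (1 - \<mu>) + 2 * \<mu>) \<omega>"
    unfolding B_def K_def using params by (intro prabhakar_op_pkernel valid_B) auto
  moreover have "conv L D = pkernel (complex_of_real \<sigma> + complex_of_real (\<gamma> * (1 - \<nu>))) \<rho> (\<mu> + (\<mu> + \<nu> * (1 - \<mu>))) \<omega>"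
    unfolding L_def D_def using params alpha_pos by (intro ext conv_pkernel) auto
  moreover have "complex_of_real (- \<gamma> * \<nu>) + complex_of_real (\<sigma> + \<gamma>) = complex_of_real \<sigma> + complex_of_real (\<gamma> * (1 - \<nu>))"
    by (simp add: algebra_simps)
  moreover have "\<nu> * (1 - \<mu>) + 2 * \<mu> = \<mu> + (\<mu> + \<nu> * (1 - \<mu>))" by simp
  ultimately show ?thesis by (simp only:)
qed

lemma conv_pkernel_S:
  assumes "0 \<le> c" "0 < m" "0 < n"
  shows "conv (pkernel (complex_of_real d) \<rho> n \<omega>) (S c m) = S (d + c) (n + m)"
  unfolding S_def using params assms by (intro ext conv_pkernel_kseries) auto

lemma S_shift: "0 \<le> c \<Longrightarrow> 0 < m \<Longrightarrow>
    S c m = (\<lambda>t. pkernel (complex_of_real c) \<rho> m \<omega> t + lam * S (c + (\<sigma> + \<gamma>)) (m + 2 * \<mu>) t)"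
  unfolding S_def using params by (intro ext kseries_shift) auto

lemma B_F: "B F = G"
proof -
  have "B F = S (- \<gamma> * \<nu> + \<gamma>) (\<nu> * (1 - \<mu>) + \<mu>)"
    unfolding B_def F_def S_def using params by (intro prabhakar_op_kseries valid_B[unfolded of_real_eq_0_iff]) auto
  moreover have "- \<gamma> * \<nu> + \<gamma> = \<gamma> * (1 - \<nu>)" "\<nu> * (1 - \<mu>) + \<mu> = \<mu> + \<nu> * (1 - \<mu>)"
    by (simp_all add: algebra_simps)
  ultimately show ?thesis by (simp only: G_def)
qed

lemma G_eq: "G = (\<lambda>t. D t + lam * E t)"
  unfolding G_def E_def D_def using params alpha_pos by (intro S_shift) auto

lemma D_R: "conv D R = E"
  unfolding D_def R_def E_def using params alpha_pos by (intro conv_pkernel_S) auto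

lemma G_K: "conv G K = E"
proof -
  have "conv G K = conv K G" by (rule ext) (rule conv_commute)
  also have "\<dots> = S (\<sigma> + \<gamma> + \<gamma> * (1 - \<nu>)) (2 * \<mu> + (\<mu> + \<nu> * (1 - \<mu>)))"
    unfolding K_def G_def using params alpha_pos by (intro conv_pkernel_S) auto
  finally show ?thesis unfolding E_def by (simp only: add.commute)
qed

lemma R_eq: "R = (\<lambda>t. K t + lam * conv K R t)"
proof -
  have "conv K R = S (\<sigma> + \<gamma> + (\<sigma> + \<gamma>)) (2 * \<mu> + 2 * \<mu>)"
    unfolding K_def R_def using params by (intro conv_pkernel_S) auto
  then show ?thesis unfolding R_def K_def using S_shift[of "\<sigma> + \<gamma>" "2 * \<mu>"] params by simp
qed

lemma conv_F_B_AE: "loc_int h \<Longrightarrow> AE x in lborel. conv F (B h) x = conv G h x"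
  using conv_prabhakar_op_AE[OF params(5) valid_B loc(6), where \<omega> = \<omega>, folded B_def, unfolded B_F] .

lemma hom_term_sum:
  assumes x: "0 < x"
  shows "summable (hom x)" "(\<Sum>k. hom x k) = G x"
proof -
  have eq: "hom x = (\<lambda>k. lam ^ k * pkernel (complex_of_real (\<gamma> * (1 - \<nu>) + real k * (\<sigma> + \<gamma>)))
      \<rho> (\<mu> + \<nu> * (1 - \<mu>) + 2 * \<mu> * real k) \<omega> x)"
  proof
    fix k
    have 1: "\<gamma> + real k * (\<sigma> + \<gamma>) - \<gamma> * \<nu> = \<gamma> * (1 - \<nu>) + real k * (\<sigma> + \<gamma>)" by (simp add: algebra_simps)
    have 2: "\<nu> * (1 - \<mu>) + \<mu> + 2 * real k * \<mu> = \<mu> + \<nu> * (1 - \<mu>) + 2 * \<mu> * real k"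
      "\<nu> * (1 - \<mu>) + \<mu> + 2 * \<mu> * real k - 1 = \<mu> + \<nu> * (1 - \<mu>) + 2 * \<mu> * real k - 1" by simp_all
    show "hom x k = lam ^ k * pkernel (complex_of_real (\<gamma> * (1 - \<nu>) + real k * (\<sigma> + \<gamma>)))
      \<rho> (\<mu> + \<nu> * (1 - \<mu>) + 2 * \<mu> * real k) \<omega> x"
      unfolding hom_term_def 1 2 using x by (simp add: pkernel_def mult.assoc)
  qed
  show "summable (hom x)"
    unfolding eq using params alpha_pos by (intro kseries_summable) auto
  show "(\<Sum>k. hom x k) = G x" unfolding eq G_def S_def kseries_def ..
qed

lemma inhom_term_sum:
  assumes x: "0 < x" and fin: "nconv (modulus f') (\<lambda>t. ennreal (powker \<mu> t)) x < \<infinity>"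
  shows "summable (inhom x)" "(\<Sum>k. inhom x k) = conv F f' x"
proof -
  have eq: "inhom x = (\<lambda>k. lam ^ k * conv f' (pkernel (complex_of_real (\<gamma> + real k * (\<sigma> + \<gamma>)))
      \<rho> (\<mu> + 2 * \<mu> * real k) \<omega>) x)"
  proof
    fix k
    have 1: "\<mu> * (2 * real k + 1) = \<mu> + 2 * \<mu> * real k" by (simp add: algebra_simps)
    have "0 < \<mu> + 2 * \<mu> * real k" using params by (intro add_pos_nonneg) auto
    from prabhakar_integral_conv[OF rep_f params(5) this x]
    show "inhom x k = lam ^ k * conv f' (pkernel (complex_of_real (\<gamma> + real k * (\<sigma> + \<gamma>)))
      \<rho> (\<mu> + 2 * \<mu> * real k) \<omega>) x"
      unfolding inhom_term_def 1 by (simp add: conv_commute[of f'])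
  qed
  have pos: "0 < \<rho>" "0 < 2 * \<mu>" "0 < \<mu>" "0 \<le> \<gamma>" "0 \<le> \<sigma> + \<gamma>" using params by auto
  note tw = conv_kseries_termwise[OF pos loc_int_measurable[OF loc_f] loc_int_nonpos[OF loc_f] fin, of lam \<omega>]
  show "summable (inhom x)" unfolding eq by (rule tw(1))
  show "(\<Sum>k. inhom x k) = conv F f' x"
    using tw(2) unfolding eq F_def S_def conv_commute[of _ f'] by simp
qed

lemma powker_kernel: "loc_int (\<lambda>t. complex_of_real (powker \<mu> t))" "order_ge \<mu> (\<lambda>t. complex_of_real (powker \<mu> t))"
  "modulus (\<lambda>t. complex_of_real (powker \<mu> t)) = (\<lambda>t. ennreal (powker \<mu> t))"
proof -
  show o: "order_ge \<mu> (\<lambda>t. complex_of_real (powker \<mu> t))"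
    unfolding order_ge_def using params powker_nonneg[of \<mu>] by (auto intro!: exI[of _ 1])
  then show "loc_int (\<lambda>t. complex_of_real (powker \<mu> t))" by (rule order_ge_loc_int)
  show "modulus (\<lambda>t. complex_of_real (powker \<mu> t)) = (\<lambda>t. ennreal (powker \<mu> t))"
    using powker_nonneg[of \<mu>] params by (auto simp: modulus_def)
qed

lemma inhom_finite_AE: "AE x in lborel. nconv (modulus f') (\<lambda>t. ennreal (powker \<mu> t)) x < \<infinity>"
  using loc_int_conv_finite_AE[OF loc_f powker_kernel(1)] unfolding powker_kernel(3) .

text \<open>The finiteness condition holds almost everywhere; it is kept explicit because for \<open>\<nu> = 1\<close> the
formula is needed at every point.\<close>
lemma formula_at:
  assumes "0 < x" "nconv (modulus f') (\<lambda>t. ennreal (powker \<mu> t)) x < \<infinity>"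
  shows "formula x = conv F f' x + complex_of_real \<kappa> * G x"
  unfolding hp_solution_formula_def hom_term_sum(2)[OF assms(1)] inhom_term_sum(2)[OF assms] by simp

lemma hp_inner_op_AE:
  assumes "represents p y"
  shows "AE x in lborel. 0 < x \<longrightarrow> hp_in y x = A p x"
  unfolding hp_inner_def A_def by (rule prabhakar_integral_op_AE[OF assms params(5) valid_A])

lemma hp_derivative_op_AE:
  assumes h: "loc_int h" and g: "\<And>x. 0 < x \<Longrightarrow> hp_in y x = k + conv heaviside h x"
  shows "AE x in lborel. 0 < x \<longrightarrow> hp_deriv y x = B h x"
proof -
  have "represents h (\<lambda>x. vector_derivative (hp_in y) (at x))"
    by (rule representsI[OF h primitive_vector_derivative_AE[OF h g]])
  then show ?thesis
    unfolding hp_derivative_def B_def by (rule prabhakar_integral_op_AE[OF _ params(5) valid_B])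
qed

text \<open>Convolving \<open>A * y = \<kappa> + H * h\<close> with \<open>D\<close> gives \<open>y = D * (h + \<kappa>\<delta>)\<close>, after removing a common factor \<open>H\<close>.
The equation then becomes \<open>f = B * h\<^sub>0\<close> with \<open>h\<^sub>0 = h - \<lambda> K * (h + \<kappa>\<delta>)\<close>, and a convolution of the
latter with \<open>G\<close>, together with \<open>G = D + \<lambda> G * K\<close>, gives the formula.\<close>
lemma solution_is_formula:
  assumes sol: "is_solution y"
  shows "solvable"
    and "AE x in lborel. 0 < x \<longrightarrow> y x = formula x"
proof -
  let ?k = "complex_of_real \<kappa>"
  have yint: "\<And>b. 0 < b \<Longrightarrow> y absolutely_integrable_on {0..b}"
    and yac: "\<And>b. 0 < b \<Longrightarrow> abs_continuous_on {0<..b} (hp_in y)"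
    and eqn: "AE x in lborel. 0 < x \<longrightarrow> hp_deriv y x =
        lam * prabhakar_integral (complex_of_real \<sigma>) \<rho> \<mu> \<omega> y x + f x"
    and init: "(hp_in y \<longlongrightarrow> ?k) (at_right 0)"
    using sol unfolding hp_cauchy_solution_def hp_domain_def hp_initial_value_def AE_pos_iff by auto
  obtain y' where ry: "represents y' y" using representative_exists[OF yint] by blast
  have ly: "loc_int y'" and yy': "AE x in lborel. 0 < x \<longrightarrow> y x = y' x" using ry by (auto simp: represents_def)
  obtain h where h: "loc_int h" and g: "\<And>x. 0 < x \<Longrightarrow> hp_in y x = ?k + conv heaviside h x"
    using abs_continuous_fundamental_theorem[OF yac init] by blast
  have Hh: "loc_int heaviside" by (rule order_ge_loc_int[OF heaviside_order])
  have lA: "loc_int (A y')" unfolding A_def by (rule prabhakar_op_loc_int[OF params(5) valid_A ly])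
  have Ay: "AE x in lborel. A y' x = conv_delta ?k heaviside h x"
    using hp_inner_op_AE[OF ry]
  proof eventually_elim
    case (elim x)
    show ?case
    proof (cases "0 < x")
      case True
      then have "A y' x = ?k + conv heaviside h x" using elim g[OF True] by simp
      then show ?thesis unfolding conv_delta_heaviside[OF True] .
    next
      case False
      then show ?thesis using loc_int_nonpos[OF lA] loc_int_nonpos[OF conv_delta_loc_int[OF Hh h]] by simp
    qed
  qed
  have Hy: "conv heaviside y' x = conv heaviside (conv_delta ?k D h) x" for x
  proof -
    have "conv heaviside y' x = conv D (A y') x"
      using conv_prabhakar_op[OF params(5) valid_A orders(1) ly, where \<omega> = \<omega> and x = x, folded A_def, unfolded A_D]
      by (simp add: algebra_simps)
    also have "\<dots> = conv D (conv_delta ?k heaviside h) x"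
      by (rule conv_cong_AE[OF _ _ _ Ay]) (use loc(1) lA conv_delta_loc_int[OF Hh h] in \<open>auto dest: loc_int_measurable\<close>)
    also have "\<dots> = conv_delta ?k (conv D heaviside) h x"
      using alpha_pos by (intro conv_conv_delta[OF orders(1) heaviside_order _ h]) simp
    also have "conv D heaviside = conv heaviside D" by (rule ext) (rule conv_commute)
    also have "conv_delta ?k (conv heaviside D) h x = conv heaviside (conv_delta ?k D h) x"
      using alpha_pos by (intro conv_conv_delta[OF heaviside_order orders(1) _ h, symmetric]) simp
    finally show ?thesis .
  qed
  have yD: "AE x in lborel. y' x = conv_delta ?k D h x"
    by (rule conv_heaviside_inject_AE[OF ly conv_delta_loc_int[OF loc(1) h] Hy])
  have LyK: "AE x in lborel. conv L y' x = conv_delta ?k (B K) h x"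
  proof -
    have "conv L y' x = conv L (conv_delta ?k D h) x" for x
      by (rule conv_cong_AE[OF _ _ _ yD]) (use loc(3) ly conv_delta_loc_int[OF loc(1) h] in \<open>auto dest: loc_int_measurable\<close>)
    then show ?thesis using conv_conv_delta_AE[OF loc(3,1) h, of ?k] by (simp add: L_D)
  qed
  define h0 where "h0 = (\<lambda>t. h t + (- lam) * conv_delta ?k K h t)"
  have lKh: "loc_int (conv_delta ?k K h)" by (rule conv_delta_loc_int[OF loc(2) h])
  have h0: "loc_int h0" unfolding h0_def by (rule loc_int_linear[OF h lKh])
  have der: "AE x in lborel. 0 < x \<longrightarrow> hp_deriv y x = B h x"
    by (rule hp_derivative_op_AE[OF h]) (rule g)
  have fB: "AE x in lborel. 0 < x \<longrightarrow> f x = B h0 x"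
    using eqn der LyK
      prabhakar_op_linear_AE[OF params(5) valid_B h lKh, where \<omega> = \<omega> and k = "- lam", folded B_def]
      prabhakar_op_conv_delta_AE[OF params(5) valid_B loc(2) h, where \<omega> = \<omega> and k = ?k, folded B_def]
  proof eventually_elim
    case (elim x)
    show ?case
    proof
      assume x: "0 < x"
      have "prabhakar_integral (complex_of_real \<sigma>) \<rho> \<mu> \<omega> y x = conv L y' x"
        unfolding L_def by (rule prabhakar_integral_conv[OF ry params(5,1) x])
      then show "f x = B h0 x" using elim x unfolding h0_def by simp
    qed
  qed
  have f'B: "AE x in lborel. f' x = B h0 x"
    using fB rep_f[unfolded represents_def, THEN conjunct2, THEN conjunct2]
  proof eventually_elim
    case (elim x)
    then show ?case by (cases "0 < x") (auto simp: loc_int_nonpos[OF loc_f] loc_int_nonpos[OF B_loc[OF h0]])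
  qed
  have rh0: "represents h0 h0" by (rule representsI[OF h0]) simp
  show "solvable"
    unfolding hp_solvable_source_def AE_pos_iff
  proof (intro exI[of _ h0] conjI allI impI)
    show "h0 absolutely_integrable_on {0..b}" if "0 < b" for b using rh0 that by (auto simp: represents_def)
    show "AE x in lborel. 0 < x \<longrightarrow> f x = prabhakar_integral (complex_of_real (- \<gamma> * \<nu>)) \<rho> (\<nu> * (1 - \<mu>)) \<omega> h0 x"
      using fB prabhakar_integral_op_AE[OF rh0 params(5) valid_B, where \<omega> = \<omega>] unfolding B_def
      by eventually_elim auto
  qed
  have Ff: "conv F f' x = conv F (B h0) x" for x
    by (rule conv_cong_AE[OF _ _ _ f'B]) (use loc(6) loc_f B_loc[OF h0] in \<open>auto dest: loc_int_measurable\<close>)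
  show "AE x in lborel. 0 < x \<longrightarrow> y x = formula x"
    using yy' yD inhom_finite_AE conv_F_B_AE[OF h0]
      conv_linear_AE[OF loc(4) h lKh, where c = "- lam", folded h0_def]
      conv_conv_delta_AE[OF loc(4,2) h, where k = ?k, unfolded G_K]
      conv_delta_linear_AE[OF loc(1,5) h, where k = ?k and c = lam, folded G_eq]
  proof eventually_elim
    case (elim x)
    show ?case
    proof
      assume x: "0 < x"
      have "formula x = conv G h0 x + ?k * G x"
        unfolding formula_at[OF x elim(3)] Ff elim(4) ..
      also have "conv G h0 x = conv_delta ?k G h x - ?k * G x - lam * conv_delta ?k E h x"
        using elim(5,6) by (simp add: conv_delta_def)
      also have "\<dots> + ?k * G x = conv_delta ?k D h x" using elim(7) by simp
      finally show "y x = formula x" using elim(1,2) x by simp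
    qed
  qed
qed

text \<open>With \<open>f = B * h\<^sub>0\<close> put \<open>h = h\<^sub>0 + \<lambda> R * (h\<^sub>0 + \<kappa>\<delta>)\<close>; the formula is then \<open>D * (h + \<kappa>\<delta>)\<close>. The identity
\<open>A * y = \<kappa> + H * h\<close> has to be verified at every \<open>x > 0\<close>. For \<open>\<nu> < 1\<close> it depends on \<open>y\<close> only up to
null sets, since \<open>A\<close> is an integral operator. For \<open>\<nu> = 1\<close>, however, \<open>A\<close> is the identity and \<open>y\<close> itself
must be controlled everywhere; this works because \<open>F\<close> has order \<open>\<mu>\<close>, \<open>B\<close> has order \<open>1 - \<mu>\<close>, and \<open>D\<close>
has order \<open>1\<close>.\<close>
lemma formula_is_solution:
  assumes source: "solvable"
  shows "is_solution formula"
proof -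
  let ?k = "complex_of_real \<kappa>" and ?y = formula
  obtain h1 where h1: "\<And>b. 0 < b \<Longrightarrow> h1 absolutely_integrable_on {0..b}"
    and f_h1: "AE x in lborel. 0 < x \<longrightarrow> f x = prabhakar_integral (complex_of_real (- \<gamma> * \<nu>)) \<rho> (\<nu> * (1 - \<mu>)) \<omega> h1 x"
    using source unfolding hp_solvable_source_def AE_pos_iff by blast
  obtain h0 where r0: "represents h0 h1" using representative_exists[OF h1] by blast
  have h0: "loc_int h0" using r0 by (simp add: represents_def)
  have f'B: "AE x in lborel. f' x = B h0 x"
    using f_h1 prabhakar_integral_op_AE[OF r0 params(5) valid_B, where \<omega> = \<omega>, folded B_def]
      rep_f[unfolded represents_def, THEN conjunct2, THEN conjunct2]
  proof eventually_elim
    case (elim x)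
    then show ?case by (cases "0 < x") (auto simp: loc_int_nonpos[OF loc_f] loc_int_nonpos[OF B_loc[OF h0]])
  qed
  have Ff: "conv F f' x = conv F (B h0) x" for x
    by (rule conv_cong_AE[OF _ _ _ f'B]) (use loc(6) loc_f B_loc[OF h0] in \<open>auto dest: loc_int_measurable\<close>)
  define h where "h = (\<lambda>t. h0 t + lam * conv_delta ?k R h0 t)"
  have lR: "loc_int (conv_delta ?k R h0)" by (rule conv_delta_loc_int[OF loc(7) h0])
  have h: "loc_int h" unfolding h_def by (rule loc_int_linear[OF h0 lR])
  have lD: "loc_int (conv_delta ?k D h)" by (rule conv_delta_loc_int[OF loc(1) h])
  have formula: "?y x = conv_delta ?k D h x"
    if "0 < x" "nconv (modulus f') (\<lambda>t. ennreal (powker \<mu> t)) x < \<infinity>"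
      "conv F (B h0) x = conv G h0 x"
      "conv D h x = conv D h0 x + lam * conv D (conv_delta ?k R h0) x"
      "conv D (conv_delta ?k R h0) x = conv_delta ?k E h0 x"
      "conv_delta ?k G h0 x = conv_delta ?k D h0 x + lam * conv_delta ?k E h0 x" for x
  proof -
    have "?y x = conv_delta ?k G h0 x" unfolding formula_at[OF that(1,2)] Ff that(3) by (simp add: conv_delta_def)
    also have "\<dots> = conv_delta ?k D h x" unfolding that(6) using that(4,5) by (simp add: conv_delta_def)
    finally show ?thesis .
  qed
  have formula_AE: "AE x in lborel. 0 < x \<longrightarrow> ?y x = conv_delta ?k D h x"
    using inhom_finite_AE conv_F_B_AE[OF h0] conv_linear_AE[OF loc(1) h0 lR, where c = lam, folded h_def]
      conv_conv_delta_AE[OF loc(1,7) h0, where k = ?k, unfolded D_R]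
      conv_delta_linear_AE[OF loc(1,5) h0, where k = ?k and c = lam, folded G_eq]
    by eventually_elim (auto intro: formula)
  have ry: "represents (conv_delta ?k D h) ?y" by (rule representsI[OF lD formula_AE])
  have inner: "hp_in ?y x = ?k + conv heaviside h x" if x: "0 < x" for x
  proof (cases "\<nu> = 1")
    case True
    have one: "\<mu> + \<nu> * (1 - \<mu>) = 1" "\<nu> * (1 - \<mu>) = 1 - \<mu>" using True by auto
    have nB: "0 < \<nu> * (1 - \<mu>)" using True params by simp
    have "A u = u" for u unfolding A_def prabhakar_op_def using True by simp
    then have D: "D = heaviside" using A_D by simp
    note m[measurable] = loc_int_measurable[OF h0] loc_int_measurable[OF lR] loc_int_measurable[OF loc_f]
      loc_int_measurable[OF B_loc[OF h0]] loc_int_measurable[OF powker_kernel(1)]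
      pkernel_measurable[OF params(5) nB]
    let ?b = "pkernel (complex_of_real (- \<gamma> * \<nu>)) \<rho> (\<nu> * (1 - \<mu>)) \<omega>"
    have fin: "nconv (modulus f') (\<lambda>t. ennreal (powker \<mu> t)) x < \<infinity>"
    proof -
      let ?p = "\<lambda>t. complex_of_real (powker \<mu> t)"
      have "nconv (modulus ?p) (modulus f') x = nconv (modulus ?p) (modulus (B h0)) x"
        by (rule nconv_cong_AE) (use f'B in \<open>auto simp: modulus_def elim: eventually_mono\<close>)
      also have "\<dots> \<le> nconv (modulus ?p) (nconv (modulus ?b) (modulus h0)) x"
        unfolding B_def prabhakar_op_pos[OF nB] by (intro nconv_mono mult_left_mono modulus_conv_le) auto
      also have "\<dots> < \<infinity>"
        using loc_int_finite[OF h0] loc_int_nonpos[OF h0] one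
        by (intro order_ge_nconv_finite_everywhere[OF powker_kernel(2) pkernel_order[OF params(5) nB]])
          (auto simp: modulus_nonpos)
      finally show ?thesis unfolding powker_kernel(3)[symmetric]
        by (subst nconv_commute) auto
    qed
    have FB: "conv F (B h0) x = conv G h0 x"
      using conv_prabhakar_op[OF params(5) valid_B orders(6) h0, where \<omega> = \<omega> and x = x, folded B_def, unfolded B_F] one by simp
    have "hp_in ?y x = ?y x"
      using True by (simp add: hp_inner_def prabhakar_integral_def)
    also have "\<dots> = conv_delta ?k D h x"
    proof (rule formula[OF x fin FB])
      have "1 \<le> \<mu> + \<nu> * (1 - \<mu>)" "1 \<le> \<mu> + \<nu> * (1 - \<mu>) + 2 * \<mu>" using one params by auto
      note le = this
      show "conv D h x = conv D h0 x + lam * conv D (conv_delta ?k R h0) x"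
        unfolding h_def using order_ge_conv_finite[OF orders(1) le(1)] h0 lR order_ge_measurable[OF orders(1)]
        by (intro conv_linear_at) auto
      show "conv D (conv_delta ?k R h0) x = conv_delta ?k E h0 x"
        using conv_conv_delta[OF orders(1,7) le(2) h0, where k = ?k and x = x] by (simp add: D_R)
      show "conv_delta ?k G h0 x = conv_delta ?k D h0 x + lam * conv_delta ?k E h0 x"
        unfolding G_eq by (rule conv_delta_linear[OF orders(1) le(1) orders(5) le(2) h0])
    qed
    finally show ?thesis unfolding D conv_delta_heaviside[OF x] .
  next
    case False
    then have nA: "0 < (1 - \<nu>) * (1 - \<mu>)" using params by simp
    let ?a = "pkernel (complex_of_real (- \<gamma> * (1 - \<nu>))) \<rho> ((1 - \<nu>) * (1 - \<mu>)) \<omega>"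
    have a: "1 \<le> (1 - \<nu>) * (1 - \<mu>) + (\<mu> + \<nu> * (1 - \<mu>))" by (simp add: algebra_simps)
    have "hp_in ?y x = conv ?a (conv_delta ?k D h) x"
      unfolding hp_inner_def by (rule prabhakar_integral_conv[OF ry params(5) nA x])
    also have "\<dots> = conv_delta ?k (conv ?a D) h x"
      by (rule conv_conv_delta[OF pkernel_order[OF params(5) nA] orders(1) a h])
    also have "conv ?a D = heaviside"
      using A_D unfolding A_def prabhakar_op_pos[OF nA] .
    finally show ?thesis unfolding conv_delta_heaviside[OF x] .
  qed
  \<comment> \<open>\<open>h\<close> solves the Volterra equation\<close>
  have hK: "AE x in lborel. h x = h0 x + lam * conv_delta ?k K h x"
    using conv_linear_AE[OF loc(2) h0 lR, where c = lam, folded h_def]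
      conv_conv_delta_AE[OF loc(2,7) h0, where k = ?k]
      conv_delta_linear_AE[OF loc(2) loc_int_conv[OF loc(2,7)] h0, where k = ?k and c = lam, folded R_eq]
  proof eventually_elim
    case (elim x)
    have "conv_delta ?k K h x = conv_delta ?k R h0 x" using elim by (simp add: conv_delta_def)
    then show ?case by (simp add: h_def)
  qed
  have lK: "loc_int (conv_delta ?k K h)" by (rule conv_delta_loc_int[OF loc(2) h])
  have der: "AE x in lborel. 0 < x \<longrightarrow> hp_deriv ?y x = B h x"
    by (rule hp_derivative_op_AE[OF h]) (rule inner)
  have eqn: "AE x in lborel. 0 < x \<longrightarrow> hp_deriv ?y x =
        lam * prabhakar_integral (complex_of_real \<sigma>) \<rho> \<mu> \<omega> ?y x + f x"
    using der
      prabhakar_op_cong_AE[OF params(5) valid_B h loc_int_linear[OF h0 lK] hK, where \<omega> = \<omega>, folded B_def]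
      prabhakar_op_linear_AE[OF params(5) valid_B h0 lK, where \<omega> = \<omega> and k = lam, folded B_def]
      prabhakar_op_conv_delta_AE[OF params(5) valid_B loc(2) h, where \<omega> = \<omega> and k = ?k, folded B_def]
      conv_conv_delta_AE[OF loc(3,1) h, where k = ?k, unfolded L_D] f'B
      rep_f[unfolded represents_def, THEN conjunct2, THEN conjunct2]
  proof eventually_elim
    case (elim x)
    show ?case
    proof
      assume x: "0 < x"
      have "prabhakar_integral (complex_of_real \<sigma>) \<rho> \<mu> \<omega> ?y x = conv L (conv_delta ?k D h) x"
        unfolding L_def by (rule prabhakar_integral_conv[OF ry params(5,1) x])
      then show "hp_deriv ?y x =
          lam * prabhakar_integral (complex_of_real \<sigma>) \<rho> \<mu> \<omega> ?y x + f x"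
        using elim x by simp
    qed
  qed
  have "abs_continuous_on {0<..b} (hp_in ?y)" for b
    by (rule abs_continuous_primitive[OF h]) (rule inner)
  moreover have "(hp_in ?y \<longlongrightarrow> ?k) (at_right 0)"
    by (rule primitive_tendsto[OF h]) (rule inner)
  ultimately show ?thesis
    unfolding hp_cauchy_solution_def hp_domain_def hp_initial_value_def AE_pos_iff
    using ry eqn by (auto simp: represents_def)
qed

end

theorem theorem5p3:
  fixes \<mu> \<nu> \<rho> \<gamma> \<sigma> \<kappa> :: real and \<omega> lam :: complex and f :: "real \<Rightarrow> complex"
  assumes "0 < \<mu>" "\<mu> < 1" "0 \<le> \<nu>" "\<nu> \<le> 1" "0 < \<rho>" "0 \<le> \<gamma>" "0 \<le> \<sigma>" "0 \<le> \<kappa>"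
    and "f absolutely_integrable_on {0..}"
  shows "(\<forall>x>0. summable (hom_term \<gamma> \<mu> \<nu> \<rho> \<omega> lam \<sigma> x)) \<and>
         (AE x in lebesgue_on {0<..}. summable (inhom_term \<gamma> \<mu> \<rho> \<omega> lam \<sigma> f x)) \<and>
         (\<forall>y. hp_cauchy_solution \<gamma> \<mu> \<nu> \<rho> \<omega> lam \<sigma> \<kappa> f y \<longrightarrow>
            hp_solvable_source \<gamma> \<mu> \<nu> \<rho> \<omega> f \<and>
            (AE x in lebesgue_on {0<..}. y x = hp_solution_formula \<gamma> \<mu> \<nu> \<rho> \<omega> lam \<sigma> \<kappa> f x)) \<and>
         (hp_solvable_source \<gamma> \<mu> \<nu> \<rho> \<omega> f \<longrightarrow>
            hp_cauchy_solution \<gamma> \<mu> \<nu> \<rho> \<omega> lam \<sigma> \<kappa> f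
              (hp_solution_formula \<gamma> \<mu> \<nu> \<rho> \<omega> lam \<sigma> \<kappa> f))"
proof -
  have "f absolutely_integrable_on {0..b}" for b
    by (rule set_integrable_subset[OF assms(9)]) auto
  then obtain f' where "represents f' f" using representative_exists by blast
  then interpret hilfer_prabhakar \<mu> \<nu> \<rho> \<gamma> \<sigma> \<kappa> \<omega> lam f f'
    using assms by unfold_locales auto
  show ?thesis
  proof (intro conjI allI impI)
    show "summable (hom_term \<gamma> \<mu> \<nu> \<rho> \<omega> lam \<sigma> x)" if "0 < x" for x by (rule hom_term_sum(1)[OF that])
    show "AE x in lebesgue_on {0<..}. summable (inhom_term \<gamma> \<mu> \<rho> \<omega> lam \<sigma> f x)"
      unfolding AE_pos_iff using inhom_finite_AE by eventually_elim (auto intro: inhom_term_sum(1))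
    fix y assume "hp_cauchy_solution \<gamma> \<mu> \<nu> \<rho> \<omega> lam \<sigma> \<kappa> f y"
    from solution_is_formula[OF this]
    show "hp_solvable_source \<gamma> \<mu> \<nu> \<rho> \<omega> f"
      "AE x in lebesgue_on {0<..}. y x = hp_solution_formula \<gamma> \<mu> \<nu> \<rho> \<omega> lam \<sigma> \<kappa> f x"
      unfolding AE_pos_iff by auto
  qed (rule formula_is_solution)
qed

end
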